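(* Let $(\mathcal{A},\alpha,\gamma)$ be a graded $C^*$-dynamical system, $\beta\in\mathbb{R}\setminus\{0\}$, $\omega\in\mathcal{S}_\beta(\mathcal{A},\alpha,\gamma)$ a $\gamma$-invariant $(\alpha,\beta)$-KMS state with GNS triple $(\mathcal{H},\pi,\Omega)$, and let $(\mathfrak{M},\Omega,V)$ be the enveloping graded $W^*$-dynamical system, with $\mathfrak{M}=\pi(\mathcal{A})''$. Then there exists a bijection $$\Xi:\mathcal{F}_\beta(\mathcal{A},\alpha,\gamma,\omega)\to B_{\mathfrak{M}}\cap\mathcal{Z}(\mathfrak{M},V)_{s.a.},\qquad\rho\mapsto R_\rho,$$ preserving convex combinations, where $R_\rho$ is defined by $\rho(a)=\langle\Omega,\pi(a)R_\rho\Omega\rangle$ for all $a\in\mathcal{A}$. Here $B_{\mathfrak{M}}$ is the closed unit ball of $\mathfrak{M}$ and the subscript $s.a.$ denotes the selfadjoint elements.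
   Context: All $C^*$-algebras are unital; inner products are linear in the second argument. A graded $C^*$-dynamical system $(\mathcal{A},\alpha,\gamma)$ consists of a $C^*$-algebra $\mathcal{A}$, a strongly continuous action $\alpha$ of $\mathbb{R}$ on $\mathcal{A}$ by automorphisms, and an automorphism $\gamma$ with $\gamma^2=\mathrm{id}$ and $\alpha_t\circ\gamma=\gamma\circ\alpha_t$ for all $t$. $\mathcal{A}_\alpha$ is the ${}^*$-subalgebra of entire analytic elements for $\alpha$. A state $\omega$ is an $(\alpha,\beta)$-KMS state if $\omega(a\alpha_{i\beta}(b))=\omega(ba)$ for all $a,b\in\mathcal{A}_\alpha$; $\mathcal{S}_\beta(\mathcal{A},\alpha,\gamma)$ is the set of $\gamma$-invariant $(\alpha,\beta)$-KMS states. $\mathcal{F}_\beta(\mathcal{A},\alpha,\gamma,\omega)$ is the set of linear functionals $\rho$ on $\mathcal{A}$ such that: $\rho(a\alpha_{i\beta}(b))=\rho(b\gamma(a))$ for all $a,b\in\mathcal{A}_\alpha$ ($\gamma$-twisted KMS condition); $\overline{\rho(a^* )}=\rho(a)$ for all $a\in\mathcal{A}$ (hermitian); and $|\rho(a^*b)|^2\le\omega(a^*a)\omega(b^*b)$ for all $a,b\in\mathcal{A}$ (dominated by $\omega$). For $\omega\in\mathcal{S}_\beta(\mathcal{A},\alpha,\gamma)$ with GNS triple $(\mathcal{H},\pi,\Omega)$, the vector $\Omega$ is cyclic and separating for $\mathfrak{M}=\pi(\mathcal{A})''$; $J$ is the modular conjugation of $(\mathfrak{M},\Omega)$; $V$ is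 the unique unitary on $\mathcal{H}$ with $V\pi(a)V=\pi(\gamma(a))$ ($a\in\mathcal{A}$), $V\Omega=\Omega$, $V^2=1$. The triple $(\mathfrak{M},\Omega,V)$ is called the enveloping graded $W^*$-dynamical system. The $V$-twisted center is $\mathcal{Z}(\mathfrak{M},V)=\{x\in\mathfrak{M}\;|\;Jx^*J=xV\}$. *)

theory Defs
  imports "HOL-Analysis.Analysis"
begin

section \<open>Complex vector spaces, Hilbert spaces and unital C*-algebras\<close>

class complex_vector = real_vector +
  fixes scaleC :: "complex \<Rightarrow> 'a \<Rightarrow> 'a"  (infixr "*\<^sub>C" 75)
  assumes scaleC_add_right: "c *\<^sub>C (x + y) = c *\<^sub>C x + c *\<^sub>C y"
    and scaleC_add_left: "(c + d) *\<^sub>C x = c *\<^sub>C x + d *\<^sub>C x"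
    and scaleC_scaleC: "c *\<^sub>C d *\<^sub>C x = (c * d) *\<^sub>C x"
    and scaleC_of_real: "complex_of_real r *\<^sub>C x = r *\<^sub>R x"

class complex_normed_vector = complex_vector + real_normed_vector +
  assumes norm_scaleC: "norm (c *\<^sub>C x) = cmod c * norm x"

class chilbert_space = complex_normed_vector + banach +
  fixes cinner :: "'a \<Rightarrow> 'a \<Rightarrow> complex"
  assumes cinner_commute: "cinner x y = cnj (cinner y x)"
    and cinner_add_right: "cinner x (y + z) = cinner x y + cinner x z"
    and cinner_scaleC_right: "cinner x (c *\<^sub>C y) = c * cinner x y"
    and cinner_nonneg: "0 \<le> Re (cinner x x)"
    and norm_eq_sqrt_cinner: "norm x = sqrt (Re (cinner x x))"

class cstar_algebra = complex_normed_vector + real_normed_algebra_1 + banach +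
  fixes star :: "'a \<Rightarrow> 'a"
  assumes mult_scaleC_left: "(c *\<^sub>C x) * y = c *\<^sub>C (x * y)"
    and mult_scaleC_right: "x * (c *\<^sub>C y) = c *\<^sub>C (x * y)"
    and star_add: "star (x + y) = star x + star y"
    and star_scaleC: "star (c *\<^sub>C x) = cnj c *\<^sub>C star x"
    and star_mult: "star (x * y) = star y * star x"
    and star_star: "star (star x) = x"
    and cstar_identity: "norm (star x * x) = (norm x)\<^sup>2"

instantiation complex :: complex_normed_vector
begin

definition scaleC_complex :: "complex \<Rightarrow> complex \<Rightarrow> complex"
  where "scaleC_complex = (*)"

instance
  by standard (simp_all add: scaleC_complex_def algebra_simps norm_mult scaleR_conv_of_real)

end

definition clinear :: "('a::complex_vector \<Rightarrow> 'b::complex_vector) \<Rightarrow> bool" where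
  "clinear f \<longleftrightarrow> (\<forall>x y. f (x + y) = f x + f y) \<and> (\<forall>c x. f (c *\<^sub>C x) = c *\<^sub>C f x)"

section \<open>Graded C*-dynamical systems and KMS functionals\<close>

definition star_automorphism :: "('a::cstar_algebra \<Rightarrow> 'a) \<Rightarrow> bool" where
  "star_automorphism f \<longleftrightarrow> bij f \<and> clinear f \<and>
     (\<forall>a b. f (a * b) = f a * f b) \<and> (\<forall>a. f (star a) = star (f a))"

definition graded_cstar_system ::
    "(real \<Rightarrow> 'a::cstar_algebra \<Rightarrow> 'a) \<Rightarrow> ('a \<Rightarrow> 'a) \<Rightarrow> bool" where
  "graded_cstar_system \<alpha> \<gamma> \<longleftrightarrow>
     (\<forall>t. star_automorphism (\<alpha> t)) \<and> \<alpha> 0 = id \<and> (\<forall>s t. \<alpha> (s + t) = \<alpha> s \<circ> \<alpha> t) \<and>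
     (\<forall>a. continuous_on UNIV (\<lambda>t. \<alpha> t a)) \<and>
     star_automorphism \<gamma> \<and> \<gamma> \<circ> \<gamma> = id \<and> (\<forall>t. \<alpha> t \<circ> \<gamma> = \<gamma> \<circ> \<alpha> t)"

text \<open>The library's \<open>holomorphic_on\<close> is restricted to scalar-valued functions.\<close>

definition entire :: "(complex \<Rightarrow> 'a::complex_normed_vector) \<Rightarrow> bool" where
  "entire F \<longleftrightarrow> (\<forall>z. \<exists>D. (F has_derivative (\<lambda>h. h *\<^sub>C D)) (at z))"

definition entire_extension ::
    "(real \<Rightarrow> 'a::cstar_algebra \<Rightarrow> 'a) \<Rightarrow> 'a \<Rightarrow> (complex \<Rightarrow> 'a) \<Rightarrow> bool" where
  "entire_extension \<alpha> a F \<longleftrightarrow> entire F \<and> (\<forall>t. F (complex_of_real t) = \<alpha> t a)"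

definition analytic_elements :: "(real \<Rightarrow> 'a::cstar_algebra \<Rightarrow> 'a) \<Rightarrow> 'a set" where
  "analytic_elements \<alpha> = {a. \<exists>F. entire_extension \<alpha> a F}"

text \<open>\<open>complex_flow \<alpha> z a\<close> is \<open>\<alpha>\<^sub>z(a)\<close> for entire analytic \<open>a\<close>; the extension is unique by
  the identity theorem.\<close>

definition complex_flow :: "(real \<Rightarrow> 'a::cstar_algebra \<Rightarrow> 'a) \<Rightarrow> complex \<Rightarrow> 'a \<Rightarrow> 'a" where
  "complex_flow \<alpha> z a = (THE F. entire_extension \<alpha> a F) z"

definition state :: "('a::cstar_algebra \<Rightarrow> complex) \<Rightarrow> bool" where
  "state \<omega> \<longleftrightarrow> clinear \<omega> \<and> (\<forall>a. \<omega> (star a * a) \<in> \<real>\<^sub>\<ge>\<^sub>0) \<and> \<omega> 1 = 1"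

definition KMS_state ::
    "(real \<Rightarrow> 'a::cstar_algebra \<Rightarrow> 'a) \<Rightarrow> real \<Rightarrow> ('a \<Rightarrow> complex) \<Rightarrow> bool" where
  "KMS_state \<alpha> \<beta> \<omega> \<longleftrightarrow> state \<omega> \<and>
     (\<forall>a \<in> analytic_elements \<alpha>. \<forall>b \<in> analytic_elements \<alpha>.
        \<omega> (a * complex_flow \<alpha> (\<i> * complex_of_real \<beta>) b) = \<omega> (b * a))"

definition invariant_KMS_states ::
    "real \<Rightarrow> (real \<Rightarrow> 'a::cstar_algebra \<Rightarrow> 'a) \<Rightarrow> ('a \<Rightarrow> 'a) \<Rightarrow> ('a \<Rightarrow> complex) set" where
  "invariant_KMS_states \<beta> \<alpha> \<gamma> = {\<omega>. KMS_state \<alpha> \<beta> \<omega> \<and> \<omega> \<circ> \<gamma> = \<omega>}"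

definition twisted_KMS ::
    "real \<Rightarrow> (real \<Rightarrow> 'a::cstar_algebra \<Rightarrow> 'a) \<Rightarrow> ('a \<Rightarrow> 'a) \<Rightarrow> ('a \<Rightarrow> complex) \<Rightarrow> bool" where
  "twisted_KMS \<beta> \<alpha> \<gamma> \<rho> \<longleftrightarrow>
     (\<forall>a \<in> analytic_elements \<alpha>. \<forall>b \<in> analytic_elements \<alpha>.
        \<rho> (a * complex_flow \<alpha> (\<i> * complex_of_real \<beta>) b) = \<rho> (b * \<gamma> a))"

definition hermitian :: "('a::cstar_algebra \<Rightarrow> complex) \<Rightarrow> bool" where
  "hermitian \<rho> \<longleftrightarrow> (\<forall>a. cnj (\<rho> (star a)) = \<rho> a)"

text \<open>\<open>\<omega>\<close> is meant to be a state, so that \<open>Re\<close> only casts its nonnegative values to reals.\<close>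

definition dominated :: "('a::cstar_algebra \<Rightarrow> complex) \<Rightarrow> ('a \<Rightarrow> complex) \<Rightarrow> bool" where
  "dominated \<omega> \<rho> \<longleftrightarrow>
     (\<forall>a b. (cmod (\<rho> (star a * b)))\<^sup>2 \<le> Re (\<omega> (star a * a)) * Re (\<omega> (star b * b)))"

definition twisted_KMS_functionals ::
    "real \<Rightarrow> (real \<Rightarrow> 'a::cstar_algebra \<Rightarrow> 'a) \<Rightarrow> ('a \<Rightarrow> 'a) \<Rightarrow> ('a \<Rightarrow> complex) \<Rightarrow>
     ('a \<Rightarrow> complex) set" where
  "twisted_KMS_functionals \<beta> \<alpha> \<gamma> \<omega> =
     {\<rho>. clinear \<rho> \<and> twisted_KMS \<beta> \<alpha> \<gamma> \<rho> \<and> hermitian \<rho> \<and> dominated \<omega> \<rho>}"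

section \<open>Bounded operators and GNS triples\<close>

definition bounded_clinear :: "('h::chilbert_space \<Rightarrow> 'h) \<Rightarrow> bool" where
  "bounded_clinear x \<longleftrightarrow> clinear x \<and> bounded_linear x"

definition op_adjoint :: "('h::chilbert_space \<Rightarrow> 'h) \<Rightarrow> 'h \<Rightarrow> 'h" where
  "op_adjoint x = (THE y. \<forall>u v. cinner (y u) v = cinner u (x v))"

definition unitary :: "('h::chilbert_space \<Rightarrow> 'h) \<Rightarrow> bool" where
  "unitary u \<longleftrightarrow> clinear u \<and> surj u \<and> (\<forall>v w. cinner (u v) (u w) = cinner v w)"

definition antiunitary :: "('h::chilbert_space \<Rightarrow> 'h) \<Rightarrow> bool" where
  "antiunitary j \<longleftrightarrow> (\<forall>v w. j (v + w) = j v + j w) \<and> (\<forall>c v. j (c *\<^sub>C v) = cnj c *\<^sub>C j v) \<and>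
     surj j \<and> (\<forall>v w. cinner (j v) (j w) = cinner w v)"

definition commutant :: "('h::chilbert_space \<Rightarrow> 'h) set \<Rightarrow> ('h \<Rightarrow> 'h) set" where
  "commutant X = {y. bounded_clinear y \<and> (\<forall>x \<in> X. x \<circ> y = y \<circ> x)}"

definition star_representation :: "('a::cstar_algebra \<Rightarrow> 'h::chilbert_space \<Rightarrow> 'h) \<Rightarrow> bool" where
  "star_representation \<pi> \<longleftrightarrow>
     (\<forall>a. bounded_clinear (\<pi> a)) \<and>
     (\<forall>a b v. \<pi> (a + b) v = \<pi> a v + \<pi> b v) \<and> (\<forall>c a v. \<pi> (c *\<^sub>C a) v = c *\<^sub>C \<pi> a v) \<and>
     (\<forall>a b. \<pi> (a * b) = \<pi> a \<circ> \<pi> b) \<and> \<pi> 1 = id \<and> (\<forall>a. \<pi> (star a) = op_adjoint (\<pi> a))"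

definition GNS_triple ::
    "('a::cstar_algebra \<Rightarrow> complex) \<Rightarrow> ('a \<Rightarrow> 'h::chilbert_space \<Rightarrow> 'h) \<Rightarrow> 'h \<Rightarrow> bool" where
  "GNS_triple \<omega> \<pi> \<Omega> \<longleftrightarrow> star_representation \<pi> \<and>
     closure (range (\<lambda>a. \<pi> a \<Omega>)) = UNIV \<and> (\<forall>a. \<omega> a = cinner \<Omega> (\<pi> a \<Omega>))"

definition enveloping_algebra ::
    "('a::cstar_algebra \<Rightarrow> 'h::chilbert_space \<Rightarrow> 'h) \<Rightarrow> ('h \<Rightarrow> 'h) set" where
  "enveloping_algebra \<pi> = commutant (commutant (range \<pi>))"

definition grading_unitary ::
    "('a::cstar_algebra \<Rightarrow> 'h::chilbert_space \<Rightarrow> 'h) \<Rightarrow> 'h \<Rightarrow> ('a \<Rightarrow> 'a) \<Rightarrow> 'h \<Rightarrow> 'h" where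
  "grading_unitary \<pi> \<Omega> \<gamma> =
     (THE V. unitary V \<and> (\<forall>a. V \<circ> \<pi> a \<circ> V = \<pi> (\<gamma> a)) \<and> V \<Omega> = \<Omega> \<and> V \<circ> V = id)"

section \<open>Modular conjugation and the twisted center\<close>

text \<open>Unbounded (anti)linear operators are represented by their graphs. Since
  \<open>R O T\<close> is relational composition, the graph of the operator product \<open>A B\<close> is \<open>B O A\<close>.\<close>

definition graph_adjoint :: "('h::chilbert_space \<times> 'h) set \<Rightarrow> ('h \<times> 'h) set" where
  "graph_adjoint T = {(u, v). \<forall>(x, y) \<in> T. cinner u y = cinner v x}"

definition antilinear_graph_adjoint :: "('h::chilbert_space \<times> 'h) set \<Rightarrow> ('h \<times> 'h) set" where
  "antilinear_graph_adjoint T = {(u, v). \<forall>(x, y) \<in> T. cinner u y = cinner x v}"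

definition positive_selfadjoint :: "('h::chilbert_space \<times> 'h) set \<Rightarrow> bool" where
  "positive_selfadjoint P \<longleftrightarrow> closure (Domain P) = UNIV \<and> graph_adjoint P = P \<and>
     (\<forall>(x, y) \<in> P. cinner x y \<in> \<real>\<^sub>\<ge>\<^sub>0)"

text \<open>The closure of the antilinear operator \<open>x \<Omega> \<mapsto> x\<^sup>* \<Omega>\<close>, \<open>x \<in> M\<close>.\<close>

definition tomita_operator ::
    "('h::chilbert_space \<Rightarrow> 'h) set \<Rightarrow> 'h \<Rightarrow> ('h \<times> 'h) set" where
  "tomita_operator M \<Omega> = closure ((\<lambda>x. (x \<Omega>, op_adjoint x \<Omega>)) ` M)"

definition modular_operator ::
    "('h::chilbert_space \<Rightarrow> 'h) set \<Rightarrow> 'h \<Rightarrow> ('h \<times> 'h) set" where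
  "modular_operator M \<Omega> =
     tomita_operator M \<Omega> O antilinear_graph_adjoint (tomita_operator M \<Omega>)"

text \<open>The antiunitary part of the polar decomposition \<open>S = J \<Delta>\<^sup>1\<^sup>/\<^sup>2\<close>, \<open>\<Delta> = S\<^sup>* S\<close>, of the
  Tomita operator; \<open>P\<close> is the positive square root of \<open>\<Delta>\<close>. It is meaningful when \<open>\<Omega>\<close> is
  cyclic and separating for \<open>M\<close>.\<close>

definition modular_conjugation ::
    "('h::chilbert_space \<Rightarrow> 'h) set \<Rightarrow> 'h \<Rightarrow> 'h \<Rightarrow> 'h" where
  "modular_conjugation M \<Omega> =
     (THE J. antiunitary J \<and>
        (\<exists>P. positive_selfadjoint P \<and> P O P = modular_operator M \<Omega> \<and>
             tomita_operator M \<Omega> = P O range (\<lambda>u. (u, J u))))"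

definition twisted_center ::
    "('h::chilbert_space \<Rightarrow> 'h) set \<Rightarrow> 'h \<Rightarrow> ('h \<Rightarrow> 'h) \<Rightarrow> ('h \<Rightarrow> 'h) set" where
  "twisted_center M \<Omega> V =
     {x \<in> M. modular_conjugation M \<Omega> \<circ> op_adjoint x \<circ> modular_conjugation M \<Omega> = x \<circ> V}"

definition selfadjoint_part :: "('h::chilbert_space \<Rightarrow> 'h) set \<Rightarrow> ('h \<Rightarrow> 'h) set" where
  "selfadjoint_part X = {x \<in> X. op_adjoint x = x}"

definition unit_ball :: "('h::chilbert_space \<Rightarrow> 'h) set \<Rightarrow> ('h \<Rightarrow> 'h) set" where
  "unit_ball M = {x \<in> M. onorm x \<le> 1}"

end

theory Submission
  imports Defs "HOL-Complex_Analysis.Complex_Analysis"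
begin

text \<open>Write \<open>\<Delta>\<^sup>1\<^sup>/\<^sup>2 \<pi>(a)\<Omega> = \<pi>(\<alpha>\<^bsub>i\<beta>/2\<^esub> a)\<Omega>\<close> and \<open>J \<pi>(a)\<Omega> = \<pi>(\<alpha>\<^bsub>i\<beta>/2\<^esub> a\<^sup>*)\<Omega>\<close> for entire analytic \<open>a\<close>. By the KMS
  condition and Liouville's theorem, \<open>J\<close> extends to an antiunitary involution with
  \<open>J \<pi>(\<A>) J \<subseteq> \<pi>(\<A>)'\<close>, and Gaussian smoothing shows that the closure \<open>P\<close> of the first operator is
  positive and self-adjoint. Hence \<open>J P\<close> is the polar decomposition of the Tomita operator,
  \<open>J\<close> is the modular conjugation, and self-adjointness of \<open>P\<close> gives \<open>J \<MM>' J \<subseteq> \<MM>\<close>.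

  A functional \<open>\<rho>\<close> dominated by \<open>\<omega>\<close> has the form \<open>\<rho>(a\<^sup>* b) = \<langle>\<pi>(a)\<Omega>, T \<pi>(b)\<Omega>\<rangle>\<close> with a contraction
  \<open>T \<in> \<MM>'\<close>, self-adjoint if \<open>\<rho>\<close> is hermitian. The twisted KMS condition makes \<open>\<rho>\<close> invariant
  under the flow, again by Liouville, and is then equivalent to \<open>J T J = T V\<close>, so that
  \<open>R = T V = J T J\<close> lies in \<open>\<MM>\<close> and satisfies \<open>J R J = R V\<close>. Conversely \<open>J R J = R V\<close> makes
  the functional of \<open>R\<close> invariant under \<open>\<alpha>\<^bsub>i\<beta>/2\<^esub>\<close>, hence under the flow.\<close>

section \<open>Hilbert space preliminaries\<close>

text \<open>Since the flow is given beforehand, \<open>\<Delta>^(1/2)\<close> can be written down on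
  a core, as the continuation of the flow to \<open>i \<beta> / 2\<close>, instead of being
  extracted from the Tomita operator by unbounded functional calculus. The price is essential
  self-adjointness on that core; the unitaries implementing the flow pay it, because smoothing over
  them maps every vector into the domain. A second obstacle is that the modular conjugation is a
  definite description: \<open>J\<close> has to be the only antiunitary in any factorisation of the
  Tomita operator with a positive self-adjoint factor. This uniqueness is proved for graphs and
  without square roots. The half period enters because a flow-invariant functional allows the shift
  \<open>i \<beta>\<close> in a KMS relation to be divided evenly between the two factors; each
  factor then becomes an image under \<open>J\<close>, which is how an analytic condition on
  functionals turns into an algebraic one on operators. The sign of \<open>\<beta>\<close> is
  arbitrary throughout.\<close>

lemma scaleC_one [simp]: "1 *\<^sub>C x = (x :: 'a::complex_vector)"
  using scaleC_of_real[of 1 x] by simp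

lemma scaleC_zero_left [simp]: "0 *\<^sub>C x = (0 :: 'a::complex_vector)"
  using scaleC_of_real[of 0 x] by simp

lemma scaleC_zero_right [simp]: "c *\<^sub>C (0 :: 'a::complex_vector) = 0"
  using scaleC_add_right[of c 0 "0 :: 'a"] by simp

lemma scaleC_minus_left [simp]: "(- c) *\<^sub>C x = - (c *\<^sub>C (x :: 'a::complex_vector))"
  using scaleC_add_left[of c "- c" x] by (simp add: add_eq_0_iff)

lemma scaleC_minus_right [simp]: "c *\<^sub>C (- x) = - (c *\<^sub>C (x :: 'a::complex_vector))"
  using scaleC_add_right[of c x "- x"] by (simp add: add_eq_0_iff)

lemma scaleC_diff_left: "(c - d) *\<^sub>C x = c *\<^sub>C x - d *\<^sub>C (x :: 'a::complex_vector)"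
  using scaleC_add_left[of c "- d" x] by simp

lemma scaleC_diff_right: "c *\<^sub>C (x - y) = c *\<^sub>C x - c *\<^sub>C (y :: 'a::complex_vector)"
  using scaleC_add_right[of c x "- y"] by simp

lemma scaleC_conv_of_real: "r *\<^sub>R x = complex_of_real r *\<^sub>C (x :: 'a::complex_vector)"
  by (simp add: scaleC_of_real)

lemma scaleC_scaleR: "c *\<^sub>C (r *\<^sub>R x) = r *\<^sub>R (c *\<^sub>C (x :: 'a::complex_vector))"
  by (simp add: scaleC_conv_of_real scaleC_scaleC mult.commute)

lemma bounded_bilinear_scaleC:
  "bounded_bilinear ((*\<^sub>C) :: complex \<Rightarrow> 'a \<Rightarrow> 'a::complex_normed_vector)"
proof (rule bounded_bilinear.intro)
  show "\<exists>K. \<forall>a (b::'a). norm (a *\<^sub>C b) \<le> norm a * norm b * K"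
    by (rule exI[of _ 1]) (simp add: norm_scaleC)
qed (auto simp: scaleC_add_left scaleC_add_right scaleC_scaleR
       scaleC_of_real scaleC_scaleC scaleR_conv_of_real simp flip: scaleC_scaleC)

lemmas continuous_on_scaleC [continuous_intros] = bounded_bilinear.continuous_on[OF bounded_bilinear_scaleC]

lemma clinear_add: "clinear f \<Longrightarrow> f (x + y) = f x + f y"
  and clinear_scaleC: "clinear f \<Longrightarrow> f (c *\<^sub>C x) = c *\<^sub>C f x"
  by (auto simp: clinear_def)

lemma clinear_zero: "clinear f \<Longrightarrow> f 0 = 0"
  using clinear_scaleC[of f 0 0] by simp

lemma clinear_minus: "clinear f \<Longrightarrow> f (- x) = - f x"
  using clinear_scaleC[of f "-1" x] by simp

lemma clinear_diff: "clinear f \<Longrightarrow> f (x - y) = f x - f y"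
  using clinear_add[of f x "- y"] by (simp add: clinear_minus)

lemma clinear_scaleR: "clinear f \<Longrightarrow> f (r *\<^sub>R x) = r *\<^sub>R f x"
  by (simp add: scaleC_conv_of_real clinear_scaleC)

lemma clinear_bounded_linear:
  fixes f :: "'a::complex_normed_vector \<Rightarrow> 'b::complex_normed_vector"
  assumes "clinear f" "\<And>x. norm (f x) \<le> norm x * K"
  shows "bounded_linear f"
  by (rule bounded_linear_intro[where K = K])
    (use assms in \<open>auto simp: clinear_add clinear_scaleR\<close>)

section \<open>Sesquilinearity, Cauchy-Schwarz and continuity of the inner product\<close>

lemma cinner_add_left: "cinner (x + y) z = cinner x z + cinner y (z :: 'h::chilbert_space)"
  by (subst (1 2 3) cinner_commute) (simp add: cinner_add_right)

lemma cinner_scaleC_left: "cinner (c *\<^sub>C x) y = cnj c * cinner x (y :: 'h::chilbert_space)"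
  by (subst (1 2) cinner_commute) (simp add: cinner_scaleC_right)

lemma cinner_scaleR_right: "cinner x (r *\<^sub>R y) = r *\<^sub>R cinner x (y :: 'h::chilbert_space)"
  by (metis cinner_scaleC_right scaleC_of_real scaleR_conv_of_real)

lemma cinner_scaleR_left: "cinner (r *\<^sub>R x) y = r *\<^sub>R cinner x (y :: 'h::chilbert_space)"
  by (metis cinner_scaleC_left scaleC_of_real scaleR_conv_of_real complex_cnj_complex_of_real)

lemma cinner_zero_right [simp]: "cinner x (0 :: 'h::chilbert_space) = 0"
  using cinner_scaleR_right[of x 0 0] by simp

lemma cinner_zero_left [simp]: "cinner (0 :: 'h::chilbert_space) x = 0"
  using cinner_scaleR_left[of 0 0 x] by simp

lemma cinner_minus_right [simp]: "cinner x (- y) = - cinner x (y :: 'h::chilbert_space)"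
  using cinner_scaleR_right[of x "-1" y] by simp

lemma cinner_minus_left [simp]: "cinner (- x) y = - cinner x (y :: 'h::chilbert_space)"
  using cinner_scaleR_left[of "-1" x y] by simp

lemma cinner_diff_right: "cinner x (y - z) = cinner x y - cinner x (z :: 'h::chilbert_space)"
  using cinner_add_right[of x y "- z"] by simp

lemma cinner_diff_left: "cinner (x - y) z = cinner x z - cinner y (z :: 'h::chilbert_space)"
  using cinner_add_left[of x "- y" z] by simp

lemmas cinner_simps = cinner_add_left cinner_add_right cinner_diff_left cinner_diff_right
  cinner_scaleC_left cinner_scaleC_right cinner_scaleR_left cinner_scaleR_right

lemma power2_norm_eq_cinner: "(norm x)\<^sup>2 = Re (cinner x (x :: 'h::chilbert_space))"
  using norm_eq_sqrt_cinner[of x] cinner_nonneg[of x] by simp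

lemma cinner_self: "cinner x x = complex_of_real ((norm (x :: 'h::chilbert_space))\<^sup>2)"
  using cinner_commute[of x x] by (auto simp: complex_eq_iff power2_norm_eq_cinner)

lemma cinner_Cauchy_Schwarz: "cmod (cinner x y) \<le> norm x * norm (y :: 'h::chilbert_space)"
proof (cases "y = 0")
  case False
  let ?n = "complex_of_real ((norm y)\<^sup>2)"
  \<comment> \<open>The component of \<open>x\<close> orthogonal to \<open>y\<close>, multiplied by
    the squared norm of \<open>y\<close> to avoid a division.\<close>
  let ?z = "?n *\<^sub>C x - cinner y x *\<^sub>C y"
  have "cinner ?z ?z = ?n * (?n * cinner x x - cinner x y * cinner y x)"
    by (simp add: cinner_simps cinner_self[of y] algebra_simps power2_eq_square)
  moreover have "cinner x y * cinner y x = complex_of_real ((cmod (cinner x y))\<^sup>2)"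
    by (subst cinner_commute[of y x]) (simp only: complex_norm_square)
  ultimately have "Re (cinner ?z ?z) =
      (norm y)\<^sup>2 * ((norm y)\<^sup>2 * (norm x)\<^sup>2 - (cmod (cinner x y))\<^sup>2)"
    by (simp add: cinner_self[of x] flip: of_real_mult of_real_diff of_real_power)
  then have "0 \<le> (norm y)\<^sup>2 * ((norm y)\<^sup>2 * (norm x)\<^sup>2 - (cmod (cinner x y))\<^sup>2)"
    by (metis cinner_nonneg)
  then have "(cmod (cinner x y))\<^sup>2 \<le> (norm x * norm y)\<^sup>2"
    using False by (simp add: zero_le_mult_iff power_mult_distrib mult.commute)
  then show ?thesis by (simp add: power2_le_iff_abs_le)
qed simp

lemma bounded_bilinear_cinner: "bounded_bilinear (cinner :: 'h::chilbert_space \<Rightarrow> 'h \<Rightarrow> complex)"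
  by (rule bounded_bilinear.intro)
    (auto simp: cinner_simps intro!: exI[of _ 1] cinner_Cauchy_Schwarz)

lemmas continuous_on_cinner [continuous_intros] = bounded_bilinear.continuous_on[OF bounded_bilinear_cinner]
lemmas tendsto_cinner [tendsto_intros] = bounded_bilinear.tendsto[OF bounded_bilinear_cinner]

lemma cinner_ext_right: "(\<And>v. cinner v x = cinner v y) \<Longrightarrow> x = (y :: 'h::chilbert_space)"
  using cinner_self[of "x - y"] by (simp add: cinner_diff_right)

lemma cinner_ext_left: "(\<And>v. cinner x v = cinner y v) \<Longrightarrow> x = (y :: 'h::chilbert_space)"
  by (rule cinner_ext_right, subst (1 2) cinner_commute) simp

section \<open>Arguments by density\<close>

lemma dense_induct:
  assumes "closure (e ` I) = UNIV" "closed {x. P x}" "\<And>a. a \<in> I \<Longrightarrow> P (e a)"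
  shows "P x"
proof -
  have "closure (e ` I) \<subseteq> {x. P x}"
    using assms(2,3) by (intro closure_minimal) auto
  then show ?thesis using assms(1) by auto
qed

lemma dense_sequence:
  fixes x :: "'b::metric_space"
  assumes "closure (e ` I) = UNIV"
  obtains a where "\<And>n::nat. a n \<in> I" "(\<lambda>n. e (a n)) \<longlonglongrightarrow> x"
proof -
  have "x \<in> closure (e ` I)" using assms by simp
  then obtain f where f: "(\<forall>n. f n \<in> e ` I) \<and> f \<longlonglongrightarrow> x"
    by (rule closure_sequential[THEN iffD1, THEN exE])
  then have "\<forall>n. \<exists>b. b \<in> I \<and> f n = e b" by (simp add: image_iff Bex_def)
  then obtain a where a: "\<forall>n. a n \<in> I \<and> f n = e (a n)" by (rule choice[THEN exE])
  then have "f = (\<lambda>n. e (a n))" by (simp add: fun_eq_iff)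
  with f a show ?thesis by (intro that[of a]) simp_all
qed

text \<open>The estimate with \<open>e a = e b\<close> forces \<open>k\<close> to factor through
  \<open>e\<close>, so a Lipschitz map on the dense image is well defined. It is stated without
  linearity so that linear and antilinear maps are extended alike; their algebraic properties are
  recovered afterwards from inner products.\<close>

lemma dense_extension:
  fixes e :: "'i \<Rightarrow> 'b::real_normed_vector" and k :: "'i \<Rightarrow> 'c::banach"
  assumes "closure (e ` I) = UNIV"
    and le: "\<And>a b. a \<in> I \<Longrightarrow> b \<in> I \<Longrightarrow> norm (k a - k b) \<le> C * norm (e a - e b)"
  obtains f where "continuous_on UNIV f" "\<And>a. a \<in> I \<Longrightarrow> f (e a) = k a"
proof -
  define f where "f x = k (SOME a. a \<in> I \<and> e a = x)" for x
  have fe: "f (e a) = k a" if "a \<in> I" for a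
  proof -
    define b where "b = (SOME b. b \<in> I \<and> e b = e a)"
    have "b \<in> I \<and> e b = e a" unfolding b_def by (rule someI[of _ a]) (simp add: that)
    then show ?thesis using le[of b a] that by (simp add: f_def flip: b_def)
  qed
  have "(max C 0)-lipschitz_on (e ` I) f"
  proof (rule lipschitz_onI)
    fix x y assume "x \<in> e ` I" "y \<in> e ` I"
    then obtain a b where ab: "a \<in> I" "b \<in> I" "x = e a" "y = e b" by blast
    have "norm (k a - k b) \<le> max C 0 * norm (e a - e b)"
      by (rule order_trans[OF le[OF ab(1,2)]]) (simp add: mult_right_mono)
    then show "dist (f x) (f y) \<le> max C 0 * dist x y"
      using ab by (simp add: fe dist_norm)
  qed simp
  then have "uniformly_continuous_on (e ` I) f" by (rule lipschitz_on_uniformly_continuous)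
  from uniformly_continuous_on_extension_on_closure[OF this]
  obtain g where g: "uniformly_continuous_on (closure (e ` I)) g" "\<And>x. x \<in> e ` I \<Longrightarrow> f x = g x"
    by metis
  show ?thesis
  proof (rule that)
    show "continuous_on UNIV g"
      using g(1) assms(1) by (simp add: uniformly_continuous_imp_continuous)
    show "g (e a) = k a" if "a \<in> I" for a
      using g(2)[of "e a"] fe[OF that] that by simp
  qed
qed

lemma dense_cinner_ext:
  fixes x y :: "'h::chilbert_space"
  assumes "closure (e ` I) = UNIV" "\<And>a. a \<in> I \<Longrightarrow> cinner x (e a) = cinner y (e a)"
  shows "x = y"
proof (rule cinner_ext_left)
  show "cinner x v = cinner y v" for v
    using assms(1) by (rule dense_induct) (auto intro!: closed_Collect_eq continuous_intros assms(2))
qed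

lemma dense_cinner_ext_right:
  fixes x y :: "'h::chilbert_space"
  assumes "closure (e ` I) = UNIV" "\<And>a. a \<in> I \<Longrightarrow> cinner (e a) x = cinner (e a) y"
  shows "x = y"
proof (rule dense_cinner_ext[OF assms(1)])
  fix a assume "a \<in> I"
  then show "cinner x (e a) = cinner y (e a)"
    using assms(2)[of a] cinner_commute[of x "e a"] cinner_commute[of y "e a"] by simp
qed

lemma continuous_on_compose_UNIV:
  "continuous_on UNIV f \<Longrightarrow> continuous_on UNIV g \<Longrightarrow> continuous_on UNIV (\<lambda>x. f (g x))"
  by (rule continuous_on_compose2[of UNIV f]) auto

section \<open>The Riesz representation theorem and adjoints\<close>

lemma parallelogram:
  fixes u v :: "'h::chilbert_space"
  shows "(norm (u - v))\<^sup>2 = 2 * (norm u)\<^sup>2 + 2 * (norm v)\<^sup>2 - (norm (u + v))\<^sup>2"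
  by (simp add: power2_norm_eq_cinner cinner_simps)

text \<open>The representing vector is the minimiser of \<open>\<parallel>v\<parallel>\<^sup>2 - 2 Re (f v)\<close>.\<close>

lemma riesz_representation:
  fixes f :: "'h::chilbert_space \<Rightarrow> complex"
  assumes lin: "clinear f" and bd: "\<And>v. cmod (f v) \<le> K * norm v"
  obtains w where "\<And>v. f v = cinner w v"
proof -
  define Q where "Q v = (norm v)\<^sup>2 - 2 * Re (f v)" for v
  have bdd: "bdd_below (range Q)"
  proof (rule bdd_belowI2[where m = "- K\<^sup>2"])
    fix v
    have "Re (f v) \<le> K * norm v" using bd[of v] complex_Re_le_cmod order_trans by blast
    moreover have "0 \<le> (norm v - K)\<^sup>2" by simp
    ultimately show "- K\<^sup>2 \<le> Q v" by (simp add: Q_def power2_diff mult.commute[of K])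
  qed
  define m where "m = (INF v. Q v)"
  have mle: "m \<le> Q v" for v unfolding m_def by (rule cINF_lower[OF bdd]) simp
  have "\<exists>v. Q v < m + inverse (Suc n)" for n
    using cInf_lessD[of "range Q" "m + inverse (Suc n)"] by (auto simp: m_def)
  then obtain v where v: "\<And>n. Q (v n) < m + inverse (Suc n)" by metis
  have half: "f ((1/2) *\<^sub>R x) = (1/2) *\<^sub>R f x" for x using clinear_scaleR[OF lin] by simp
  \<comment> \<open>Parallelogram law, with \<open>Q\<close> at the midpoint of \<open>x\<close> and
    \<open>y\<close> bounded below by \<open>m\<close>: near-minimisers are close together.\<close>
  have par: "(norm (x - y))\<^sup>2 \<le> 2 * Q x + 2 * Q y - 4 * m" for x y
  proof -
    have "4 * m \<le> (norm (x + y))\<^sup>2 - 4 * Re (f x) - 4 * Re (f y)"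
      using mle[of "(1/2) *\<^sub>R (x + y)"]
      by (simp only: Q_def half clinear_add[OF lin] norm_scaleR power_mult_distrib)
        (simp add: power2_eq_square, argo)
    then show ?thesis using parallelogram[of x y] by (simp add: Q_def)
  qed
  have "Cauchy v"
  proof (rule metric_CauchyI)
    fix \<epsilon> :: real assume "\<epsilon> > 0"
    then obtain N where N: "inverse (real (Suc N)) < \<epsilon>\<^sup>2 / 4"
      using reals_Archimedean[of "\<epsilon>\<^sup>2 / 4"] by auto
    have "dist (v i) (v j) < \<epsilon>" if "N \<le> i" "N \<le> j" for i j
    proof -
      have "inverse (real (Suc i)) \<le> inverse (real (Suc N))" "inverse (real (Suc j)) \<le> inverse (real (Suc N))"
        using that by auto
      then have "(norm (v i - v j))\<^sup>2 < \<epsilon>\<^sup>2" using par[of "v i" "v j"] v[of i] v[of j] N by linarith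
      then show ?thesis using \<open>\<epsilon> > 0\<close> by (simp add: dist_norm power_less_imp_less_base)
    qed
    then show "\<exists>M. \<forall>i\<ge>M. \<forall>j\<ge>M. dist (v i) (v j) < \<epsilon>" by blast
  qed
  then obtain w where w: "v \<longlonglongrightarrow> w" by (auto simp: Cauchy_convergent_iff convergent_def)
  have fbl: "bounded_linear f"
    by (rule clinear_bounded_linear[OF lin, of K]) (use bd in \<open>simp add: mult.commute\<close>)
  have "(\<lambda>n. Q (v n)) \<longlonglongrightarrow> Q w"
    unfolding Q_def by (intro tendsto_intros bounded_linear.tendsto[OF fbl] w)
  moreover have "(\<lambda>n. m + inverse (real (Suc n))) \<longlonglongrightarrow> m + 0"
    by (intro tendsto_intros LIMSEQ_inverse_real_of_nat)
  ultimately have "Q w \<le> m + 0"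
    by (rule LIMSEQ_le) (use v less_imp_le in blast)
  then have Qw: "Q w \<le> Q x" for x using mle[of x] by simp
  have Re_eq: "Re (f h) = Re (cinner w h)" for h
  proof (rule ccontr)
    define d where "d = Re (cinner w h) - Re (f h)"
    assume "Re (f h) \<noteq> Re (cinner w h)"
    then have d: "d \<noteq> 0" by (simp add: d_def)
    have quad: "0 \<le> 2 * t * d + t\<^sup>2 * (norm h)\<^sup>2" for t
    proof -
      have "Re (cinner h w) = Re (cinner w h)" by (subst cinner_commute) simp
      then show ?thesis using Qw[of "w + t *\<^sub>R h"]
        by (simp add: Q_def d_def clinear_add[OF lin] clinear_scaleR[OF lin] power2_norm_eq_cinner cinner_simps)
          (simp add: algebra_simps power2_eq_square)
    qed
    \<comment> \<open>The quadratic is minimal at \<open>t = - d / (norm h)^2\<close>; adding 1 to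
      the denominator keeps it positive for \<open>h = 0\<close> and still leaves the value
      negative.\<close>
    define n where "n = (norm h)\<^sup>2 + 1"
    have n: "n > 0" by (simp add: n_def add_nonneg_pos)
    have "0 \<le> 2 * (- d / n) * d + (- d / n)\<^sup>2 * (norm h)\<^sup>2" by (rule quad)
    also have "\<dots> \<le> 2 * (- d / n) * d + (- d / n)\<^sup>2 * n"
      by (intro add_left_mono mult_left_mono) (auto simp: n_def)
    also have "\<dots> = - (d\<^sup>2 / n)"
      using n by (simp add: power2_eq_square)
    also have "\<dots> < 0" using d n by simp
    finally show False by simp
  qed
  show ?thesis
  proof (rule that)
    fix h
    have "Im (f h) = Im (cinner w h)"
      using Re_eq[of "\<i> *\<^sub>C h"] by (simp add: clinear_scaleC[OF lin] scaleC_complex_def cinner_simps)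
    then show "f h = cinner w h" using Re_eq by (simp add: complex_eq_iff)
  qed
qed

lemma op_adjoint_eqI:
  assumes "\<And>u v. cinner (y u) v = cinner u (x v)"
  shows "op_adjoint x = y"
  unfolding op_adjoint_def
proof (rule the_equality)
  show "z = y" if "\<forall>u v. cinner (z u) v = cinner u (x v)" for z
    by (rule ext, rule cinner_ext_left) (use that assms in simp)
qed (use assms in blast)

text \<open>Riesz supplies a function satisfying the adjoint relation; only then does the
  description behind \<open>op_adjoint\<close> denote.\<close>

lemma cinner_op_adjoint_left:
  fixes x :: "'h::chilbert_space \<Rightarrow> 'h"
  assumes "bounded_clinear x"
  shows "cinner (op_adjoint x u) v = cinner u (x v)"
proof -
  from assms have lin: "clinear x" and bl: "bounded_linear x" by (auto simp: bounded_clinear_def)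
  have "\<exists>w. \<forall>v. cinner u (x v) = cinner w v" for u
  proof -
    have "cmod (cinner u (x v)) \<le> norm u * onorm x * norm v" for v
    proof -
      have "norm u * norm (x v) \<le> norm u * (onorm x * norm v)"
        by (intro mult_left_mono onorm[OF bl]) simp
      then show ?thesis using cinner_Cauchy_Schwarz[of u "x v"] by (simp add: mult.assoc)
    qed
    then obtain w where "\<And>v. cinner u (x v) = cinner w v"
    proof (rule riesz_representation[rotated])
      show "clinear (\<lambda>v. cinner u (x v))"
        using lin by (simp add: clinear_def cinner_simps scaleC_complex_def)
    qed blast
    then show ?thesis by blast
  qed
  then obtain y where y: "\<And>u v. cinner u (x v) = cinner (y u) v" by metis
  then have "op_adjoint x = y" by (intro op_adjoint_eqI) simp
  with y show ?thesis by simp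
qed

lemma cinner_op_adjoint_right:
  assumes "bounded_clinear x"
  shows "cinner u (op_adjoint x v) = cinner (x u) v"
  by (subst (1 2) cinner_commute) (simp add: cinner_op_adjoint_left[OF assms])

section \<open>Bounded, unitary and antiunitary operators\<close>

lemma bounded_clinear_add: "bounded_clinear x \<Longrightarrow> x (u + v) = x u + x v"
  and bounded_clinear_scaleC: "bounded_clinear x \<Longrightarrow> x (c *\<^sub>C u) = c *\<^sub>C x u"
  and bounded_clinear_scaleR: "bounded_clinear x \<Longrightarrow> x (r *\<^sub>R u) = r *\<^sub>R x u"
  by (auto simp: bounded_clinear_def clinear_add clinear_scaleC clinear_diff clinear_scaleR clinear_zero)

lemma bounded_clinear_continuous_on: "bounded_clinear x \<Longrightarrow> continuous_on A x"
  by (simp add: bounded_clinear_def linear_continuous_on)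

lemma bounded_clinear_tendsto:
  "bounded_clinear x \<Longrightarrow> (f \<longlongrightarrow> u) F \<Longrightarrow> ((\<lambda>i. x (f i)) \<longlongrightarrow> x u) F"
  by (simp add: bounded_clinear_def bounded_linear.tendsto)

lemma bounded_clinear_norm_le: "bounded_clinear x \<Longrightarrow> norm (x v) \<le> onorm x * norm v"
  by (simp add: bounded_clinear_def onorm)

lemma bounded_clinearI:
  assumes "\<And>u v. x (u + v) = x u + x v" "\<And>c u. x (c *\<^sub>C u) = c *\<^sub>C x u" "\<And>v. norm (x v) \<le> K * norm v"
  shows "bounded_clinear x"
proof -
  have "clinear x" using assms by (simp add: clinear_def)
  moreover have "bounded_linear x"
    by (rule clinear_bounded_linear[OF calculation, of K]) (use assms(3) in \<open>simp add: mult.commute\<close>)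
  ultimately show ?thesis by (simp add: bounded_clinear_def)
qed

lemma bounded_clinear_compose:
  "bounded_clinear x \<Longrightarrow> bounded_clinear y \<Longrightarrow> bounded_clinear (x \<circ> y)"
  by (auto simp: bounded_clinear_def clinear_def o_def intro: bounded_linear_compose)

lemma unitary_norm: "unitary u \<Longrightarrow> norm (u v) = norm v"
  by (simp add: unitary_def norm_eq_sqrt_cinner)

lemma antiunitary_norm: "antiunitary j \<Longrightarrow> norm (j v) = norm v"
  by (simp add: antiunitary_def norm_eq_sqrt_cinner)

lemma antiunitary_diff: "antiunitary j \<Longrightarrow> j (v - w) = j v - j w"
proof -
  assume "antiunitary j"
  then have *: "j (v + (-1) *\<^sub>C w) = j v + cnj (-1) *\<^sub>C j w" unfolding antiunitary_def by metis
  then show ?thesis by simp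
qed

lemma antiunitary_dist: "antiunitary j \<Longrightarrow> norm (j v - j w) = norm (v - w)"
  using antiunitary_diff[of j v w] antiunitary_norm[of j "v - w"] by simp

lemma antiunitary_continuous_on: "antiunitary j \<Longrightarrow> continuous_on A j"
  by (rule lipschitz_on_continuous_on[of 1], rule lipschitz_onI)
    (simp_all add: dist_norm antiunitary_dist)

lemma antiunitary_inj: "antiunitary j \<Longrightarrow> j v = j w \<Longrightarrow> v = w"
  using antiunitary_dist[of j v w] by simp

lemma bounded_clinear_unitary: "unitary u \<Longrightarrow> bounded_clinear u"
  by (rule bounded_clinearI[of _ 1]) (auto simp: unitary_norm, auto simp: unitary_def clinear_def)

section \<open>Contractivity of representations and automorphisms\<close>

lemma norm_star [simp]: "norm (star a) = norm (a :: 'a::cstar_algebra)"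
proof -
  have le: "norm b \<le> norm (star b)" for b :: 'a
  proof (cases "b = 0")
    case False
    have "norm b * norm b \<le> norm (star b) * norm b"
      using cstar_identity[of b] norm_mult_ineq[of "star b" b] by (simp add: power2_eq_square)
    then show ?thesis using False by simp
  qed simp
  from le[of a] le[of "star a"] show ?thesis by (simp add: star_star)
qed

lemma star_one [simp]: "star (1 :: 'a::cstar_algebra) = 1"
proof -
  have "star (star 1 * 1) = star (1 :: 'a) * star (star 1)" by (simp only: star_mult)
  then show ?thesis by (simp add: star_star)
qed

lemma star_scaleR: "star (r *\<^sub>R a) = r *\<^sub>R star (a :: 'a::cstar_algebra)"
  by (simp add: scaleC_conv_of_real star_scaleC)

lemma star_minus: "star (- a) = - star (a :: 'a::cstar_algebra)"
  using star_scaleR[of "-1" a] by simp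

lemma star_diff: "star (a - b) = star a - star (b :: 'a::cstar_algebra)"
  using star_add[of a "- b"] by (simp add: star_minus)

lemma bounded_linear_star: "bounded_linear (star :: 'a::cstar_algebra \<Rightarrow> 'a)"
  by (rule bounded_linear_intro[where K = 1]) (auto simp: star_add star_scaleR)

lemma star_power: "star (a ^ n) = star (a :: 'a::cstar_algebra) ^ n"
  by (induction n) (auto simp: star_mult power_commutes)

text \<open>The binomial series of \<open>\<surd>(1 - x)\<close> converges absolutely at
  \<open>h\<close>. The Cauchy product and the Vandermonde identity compute its square, and
  commutation is inherited from the powers of \<open>h\<close>. This stands in for continuous
  functional calculus.\<close>

lemma sqrt_one_minus:
  fixes h :: "'a::cstar_algebra"
  assumes "norm h < 1" "star h = h"
  obtains s where "star s = s" "s * s = 1 - h" "\<And>k. k * h = h * k \<Longrightarrow> k * s = s * k"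
proof -
  define c :: "nat \<Rightarrow> real" where "c n = (1/2 gchoose n) * (-1) ^ n" for n
  define f where "f n = c n *\<^sub>R h ^ n" for n
  have "norm (norm h) < conv_radius (\<lambda>n. (1/2::real) gchoose n)"
    using assms(1) by (auto simp: conv_radius_gchoose)
  then have "summable (\<lambda>n. norm ((1/2 gchoose n) * norm h ^ n))"
    by (rule abs_summable_in_conv_radius)
  then have sn: "summable (\<lambda>n. norm (f n))"
    by (rule summable_comparison_test'[where N = 0])
      (auto simp: f_def c_def abs_mult norm_mult norm_power power_abs intro!: mult_left_mono norm_power_ineq)
  then have sf: "summable f" by (rule summable_norm_cancel)
  define s where "s = suminf f"
  have "star s = (\<Sum>n. star (f n))"
    unfolding s_def by (rule bounded_linear.suminf[OF bounded_linear_star sf])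
  also have "(\<lambda>n. star (f n)) = f"
    by (rule ext) (simp add: f_def star_scaleR star_power assms)
  finally have "star s = s" by (simp add: s_def)
  moreover have "s * s = 1 - h"
  proof -
    have "(\<lambda>n. \<Sum>i\<le>n. f i * f (n - i)) sums (s * s)"
      unfolding s_def by (rule Cauchy_product_sums[OF sn sn])
    moreover have "(\<Sum>i\<le>n. f i * f (n - i)) = ((1 gchoose n) * (-1) ^ n) *\<^sub>R h ^ n" for n
    proof -
      have "f i * f (n - i) = (((1/2 gchoose i) * (1/2 gchoose (n - i))) * (-1) ^ n) *\<^sub>R h ^ n"
        if "i \<le> n" for i
      proof -
        have "(-1 :: real) ^ i * (-1) ^ (n - i) = (-1) ^ n" "h ^ i * h ^ (n - i) = h ^ n"
          using that by (simp_all flip: power_add)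
        then show ?thesis by (simp add: f_def c_def mult_ac)
      qed
      then have "(\<Sum>i\<le>n. f i * f (n - i)) =
          (\<Sum>i\<le>n. (((1/2 gchoose i) * (1/2 gchoose (n - i))) * (-1) ^ n) *\<^sub>R h ^ n)" by simp
      also have "\<dots> = ((\<Sum>i=0..n. (1/2 gchoose i) * (1/2 gchoose (n - i))) * (-1) ^ n) *\<^sub>R h ^ n"
        by (simp add: scaleR_left.sum sum_distrib_right atMost_atLeast0)
      finally show ?thesis by (simp add: gbinomial_Vandermonde)
    qed
    ultimately have 1: "(\<lambda>n. ((1 gchoose n) * (-1) ^ n) *\<^sub>R h ^ n) sums (s * s)" by simp
    \<comment> \<open>The coefficients are those of \<open>(1 - x)^1\<close>, so every term with
      \<open>n > 1\<close> vanishes.\<close>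
    have "(\<lambda>n. ((1 gchoose n) * (-1 :: real) ^ n) *\<^sub>R h ^ n) sums
        (\<Sum>n\<in>{0,1}. ((1 gchoose n) * (-1 :: real) ^ n) *\<^sub>R h ^ n)"
    proof (rule sums_finite)
      fix n :: nat assume "n \<notin> {0, 1}"
      then have "(1 :: nat) < n" by auto
      then have "(1 :: real) gchoose n = 0"
        using binomial_gbinomial[of 1 n, where 'a = real] by (simp add: binomial_eq_0)
      then show "((1 gchoose n) * (-1 :: real) ^ n) *\<^sub>R h ^ n = 0" by simp
    qed simp
    then have "(\<lambda>n. ((1 gchoose n) * (-1 :: real) ^ n) *\<^sub>R h ^ n) sums (1 - h)" by simp
    with 1 show ?thesis by (rule sums_unique2)
  qed
  moreover have "k * s = s * k" if "k * h = h * k" for k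
  proof -
    have "k * h ^ n = h ^ n * k" for n
      by (induction n) (simp_all, metis mult.assoc that)
    then have "(\<lambda>n. k * f n) = (\<lambda>n. f n * k)" by (simp add: f_def fun_eq_iff)
    moreover have "k * s = (\<Sum>n. k * f n)" "s * k = (\<Sum>n. f n * k)"
      unfolding s_def by (simp_all add: suminf_mult suminf_mult2 sf)
    ultimately show ?thesis by simp
  qed
  ultimately show ?thesis by (rule that)
qed

text \<open>A selfadjoint \<open>k\<close> with \<open>\<parallel>k\<parallel> < 1\<close> is the real part of the unitary \<open>k + i \<surd>(1 - k\<^sup>2)\<close>, so a
  seminorm that is bounded on unitaries is bounded.\<close>

lemma selfadjoint_seminorm_bound:
  fixes N :: "'a::cstar_algebra \<Rightarrow> real"
  assumes add: "\<And>x y. N (x + y) \<le> N x + N y" and scale: "\<And>c x. N (c *\<^sub>C x) = cmod c * N x"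
    and uni: "\<And>u. star u * u = 1 \<Longrightarrow> N u \<le> K"
    and "star k = k"
  shows "N k \<le> K * norm k"
proof -
  have small: "N k \<le> K" if k: "norm k < 1" "star k = k" for k
  proof -
    have "norm (k * k) < 1" using cstar_identity[of k] k by (simp add: power2_eq_square mult_le_one)
      (metis mult_strict_mono' norm_ge_zero mult_1)
    moreover have "star (k * k) = k * k" by (simp add: star_mult k)
    ultimately obtain s where s: "star s = s" "s * s = 1 - k * k"
        "\<And>l. l * (k * k) = k * k * l \<Longrightarrow> l * s = s * l"
      using sqrt_one_minus[of "k * k"] by blast
    have ks: "k * s = s * k" by (rule s(3)) (simp add: mult.assoc)
    define u v where "u = k + \<i> *\<^sub>C s" and "v = k - \<i> *\<^sub>C s"
    have star: "star u = v" "star v = u" by (simp_all add: u_def v_def star_add star_diff star_scaleC k s)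
    have "v * u = 1" "u * v = 1"
      by (simp_all add: u_def v_def algebra_simps mult_scaleC_left mult_scaleC_right scaleC_scaleC scaleC_diff_right scaleC_add_right ks s(2))
    then have "N u \<le> K" "N v \<le> K" using uni[of u] uni[of v] star by simp_all
    moreover have "k = (1/2) *\<^sub>C u + (1/2) *\<^sub>C v"
    proof -
      have "k = (1/2) *\<^sub>C k + (1/2) *\<^sub>C k" by (simp flip: scaleC_add_left)
      then show ?thesis by (simp add: u_def v_def scaleC_add_right scaleC_diff_right)
    qed
    ultimately show ?thesis using add[of "(1/2) *\<^sub>C u" "(1/2) *\<^sub>C v"] by (simp add: scale)
  qed
  have K: "0 \<le> K"
  proof -
    have "N 0 = 0" using scale[of 0 0] by simp
    then show ?thesis using small[of 0] by (simp add: star_minus) (metis norm_zero small star_diff diff_self zero_less_one)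
  qed
  \<comment> \<open>\<open>small\<close> asks for a norm strictly below 1, hence for a radius
    strictly above \<open>norm k\<close>; a limit removes the excess and covers \<open>k = 0\<close>
    as well.\<close>
  have "N k \<le> K * r" if r: "norm k < r" for r
  proof -
    have r0: "r > 0" using r norm_ge_zero order_le_less_trans by blast
    have "N (complex_of_real (inverse r) *\<^sub>C k) \<le> K"
      using r r0 assms(4) by (intro small) (auto simp: norm_scaleC star_scaleC norm_divide field_simps)
    then have "N k * inverse r \<le> K" using r0 by (simp add: scale norm_divide inverse_eq_divide)
    then show ?thesis using r0 by (simp add: field_simps)
  qed
  then have "N k \<le> K * (norm k + \<epsilon>)" if "\<epsilon> > 0" for \<epsilon> using that by simp
  then have *: "N k \<le> K * norm k + K * \<epsilon>" if "\<epsilon> > 0" for \<epsilon> using that by (simp add: distrib_left)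
  show ?thesis
  proof (rule field_le_epsilon)
    fix e :: real assume "e > 0"
    then have "K * (e / (K + 1)) \<le> e" using K by (simp add: field_simps)
    with *[of "e / (K + 1)"] \<open>e > 0\<close> K show "N k \<le> K * norm k + e" by simp
  qed
qed

lemma star_automorphism_one: "star_automorphism \<phi> \<Longrightarrow> \<phi> 1 = 1"
proof -
  assume a: "star_automorphism \<phi>"
  then obtain b where "\<phi> b = 1" by (metis star_automorphism_def bij_pointE)
  with a show ?thesis unfolding star_automorphism_def by (metis mult_1 mult_1_right)
qed

text \<open>An automorphism preserves the relation \<open>star u * u = 1\<close>, and such elements
  have norm at most 1. The seminorm bound applies to the selfadjoint \<open>star x * x\<close>, and
  the C*-identity returns to \<open>x\<close>. Continuity of automorphisms is thus derived from
  algebra.\<close>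

lemma star_automorphism_norm_le:
  assumes a: "star_automorphism \<phi>"
  shows "norm (\<phi> x) \<le> norm x"
proof -
  have "norm (\<phi> (star x * x)) \<le> 1 * norm (star x * x)"
  proof (rule selfadjoint_seminorm_bound)
    fix u :: 'a assume "star u * u = 1"
    then have "star (\<phi> u) * \<phi> u = 1"
      using a star_automorphism_one[OF a] unfolding star_automorphism_def by metis
    then show "norm (\<phi> u) \<le> 1" using cstar_identity[of "\<phi> u"] by (simp add: abs_square_eq_1)
  qed (use a in \<open>auto simp: star_automorphism_def clinear_def norm_triangle_ineq norm_scaleC star_mult star_star\<close>)
  moreover have "\<phi> (star x * x) = star (\<phi> x) * \<phi> x" using a by (simp add: star_automorphism_def)
  ultimately have "(norm (\<phi> x))\<^sup>2 \<le> (norm x)\<^sup>2" by (simp add: cstar_identity)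
  then show ?thesis by (simp add: power2_le_iff_abs_le)
qed

lemma star_representation_cinner:
  assumes "star_representation \<pi>"
  shows "cinner (\<pi> (star a) u) v = cinner u (\<pi> a v)"
  using assms cinner_op_adjoint_left[of "\<pi> a" u v] by (simp add: star_representation_def)

text \<open>The same argument for the seminorm \<open>x \<mapsto> norm (\<pi> x v)\<close> with
  \<open>v\<close> fixed, which \<open>star u * u = 1\<close> bounds by
  \<open>norm v\<close>.\<close>

lemma star_representation_norm_le:
  assumes r: "star_representation \<pi>"
  shows "norm (\<pi> x v) \<le> norm x * norm v"
proof -
  have "norm (\<pi> (star x * x) v) \<le> norm v * norm (star x * x)"
  proof (rule selfadjoint_seminorm_bound)
    fix u :: 'a assume u: "star u * u = 1"
    have "cinner (\<pi> u v) (\<pi> u v) = cinner v (\<pi> (star u * u) v)"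
      using star_representation_cinner[OF r, of "star u"] r by (simp add: star_star star_representation_def)
    then show "norm (\<pi> u v) \<le> norm v"
      using r by (simp add: u norm_eq_sqrt_cinner star_representation_def)
  qed (use r in \<open>auto simp: star_representation_def norm_triangle_ineq norm_scaleC star_mult star_star\<close>)
  then have *: "norm (\<pi> (star x * x) v) \<le> norm v * (norm x)\<^sup>2" by (simp add: cstar_identity)
  have "(norm (\<pi> x v))\<^sup>2 = Re (cinner v (\<pi> (star x * x) v))"
    using star_representation_cinner[OF r, of "star x"] r
    by (simp add: star_star star_representation_def power2_norm_eq_cinner)
  also have "\<dots> \<le> norm v * norm (\<pi> (star x * x) v)"
    using complex_Re_le_cmod cinner_Cauchy_Schwarz order_trans by blast
  also have "\<dots> \<le> norm v * (norm v * (norm x)\<^sup>2)" using * by (intro mult_left_mono) auto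
  finally have "(norm (\<pi> x v))\<^sup>2 \<le> (norm x * norm v)\<^sup>2"
    by (simp add: power_mult_distrib power2_eq_square mult_ac)
  then show ?thesis by (simp add: power2_le_iff_abs_le)
qed

section \<open>Uniqueness of entire extensions\<close>

text \<open>Hahn--Banach by way of minimal sublinear functionals: if \<open>q\<close> is minimal, then
  \<open>directional_inf q y = q\<close> for all \<open>y\<close>, which makes \<open>q\<close> additive.\<close>

definition sublinear :: "('a::real_normed_vector \<Rightarrow> real) \<Rightarrow> bool" where
  "sublinear q \<longleftrightarrow> (\<forall>x y. q (x + y) \<le> q x + q y) \<and> (\<forall>r\<ge>0. \<forall>x. q (r *\<^sub>R x) = r * q x) \<and>
     (\<forall>x. q x \<le> norm x)"

lemma sublinear_homogeneousI:
  fixes q :: "'a::real_vector \<Rightarrow> real"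
  assumes "\<And>r x. r > 0 \<Longrightarrow> q (r *\<^sub>R x) \<le> r * q x" "q 0 = 0" "r \<ge> 0"
  shows "q (r *\<^sub>R x) = r * q x"
proof (cases "r = 0")
  case False
  with assms(3) have r: "r > 0" by simp
  have "q (inverse r *\<^sub>R (r *\<^sub>R x)) \<le> inverse r * q (r *\<^sub>R x)" using r by (intro assms(1)) simp
  moreover have "inverse r *\<^sub>R (r *\<^sub>R x) = x" using False by simp
  ultimately have "q x \<le> inverse r * q (r *\<^sub>R x)" by simp
  then have "r * q x \<le> q (r *\<^sub>R x)" using r by (simp add: field_simps)
  with assms(1)[OF r, of x] show ?thesis by simp
qed (use assms in simp)

lemma sublinear_lower: "sublinear q \<Longrightarrow> - q (- x) \<le> q x"
  unfolding sublinear_def by (metis add.right_inverse mult_zero_left order_refl scaleR_zero_left diff_le_eq diff_0 add.commute)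

definition directional_inf :: "('a::real_normed_vector \<Rightarrow> real) \<Rightarrow> 'a \<Rightarrow> 'a \<Rightarrow> real" where
  "directional_inf q y x = (INF t\<in>{0..}. q (x + t *\<^sub>R y) - t * q y)"

lemma directional_inf:
  assumes q: "sublinear q"
  shows "0 \<le> t \<Longrightarrow> directional_inf q y x \<le> q (x + t *\<^sub>R y) - t * q y"
    and "sublinear (directional_inf q y)"
proof -
  have add: "q (u + v) \<le> q u + q v" and hom: "r \<ge> 0 \<Longrightarrow> q (r *\<^sub>R u) = r * q u" and le: "q u \<le> norm u" for u v r
    using q by (auto simp: sublinear_def)
  \<comment> \<open>Independent of \<open>t\<close>, so the infimum is taken over a set bounded
    below.\<close>
  have lower: "- q (- x) \<le> q (x + t *\<^sub>R y) - t * q y" if "t \<ge> 0" for x t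
    using add[of "x + t *\<^sub>R y" "- x"] hom[OF that, of y] by simp
  have upper: "directional_inf q y x \<le> q (x + t *\<^sub>R y) - t * q y" if "t \<ge> 0" for x t
    unfolding directional_inf_def
    by (rule cINF_lower) (use that lower in \<open>auto intro!: bdd_belowI2\<close>)
  then show "0 \<le> t \<Longrightarrow> directional_inf q y x \<le> q (x + t *\<^sub>R y) - t * q y" .
  have ge: "c \<le> directional_inf q y x" if "\<And>t. t \<ge> 0 \<Longrightarrow> c \<le> q (x + t *\<^sub>R y) - t * q y" for c x
    unfolding directional_inf_def by (rule cINF_greatest) (use that in auto)
  show "sublinear (directional_inf q y)"
    unfolding sublinear_def
  proof (intro conjI allI impI)
    fix x x'
    have "directional_inf q y (x + x') - (q (x' + s *\<^sub>R y) - s * q y) \<le> q (x + t *\<^sub>R y) - t * q y"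
      if "s \<ge> 0" "t \<ge> 0" for s t
      using upper[of "t + s" "x + x'"] add[of "x + t *\<^sub>R y" "x' + s *\<^sub>R y"] that
      by (simp add: algebra_simps)
    then have "directional_inf q y (x + x') - (q (x' + s *\<^sub>R y) - s * q y) \<le> directional_inf q y x"
      if "s \<ge> 0" for s using that by (intro ge) simp
    then have "directional_inf q y (x + x') - directional_inf q y x \<le> q (x' + s *\<^sub>R y) - s * q y"
      if "s \<ge> 0" for s using that by (smt (verit))
    then have "directional_inf q y (x + x') - directional_inf q y x \<le> directional_inf q y x'"
      by (rule ge)
    then show "directional_inf q y (x + x') \<le> directional_inf q y x + directional_inf q y x'" by simp
  next
    have q0: "q 0 = 0" using hom[of 0 0] by simp
    fix r :: real and x assume "r \<ge> 0"
    then show "directional_inf q y (r *\<^sub>R x) = r * directional_inf q y x"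
    proof (rule sublinear_homogeneousI[rotated 2])
      fix r :: real and x assume r: "r > 0"
      have "inverse r * directional_inf q y (r *\<^sub>R x) \<le> q (x + t *\<^sub>R y) - t * q y" if "t \<ge> 0" for t
      proof -
        have "directional_inf q y (r *\<^sub>R x) \<le> q (r *\<^sub>R (x + t *\<^sub>R y)) - r * t * q y"
          using upper[of "r * t" "r *\<^sub>R x"] r that by (simp add: scaleR_add_right)
        moreover have "q (r *\<^sub>R (x + t *\<^sub>R y)) = r * q (x + t *\<^sub>R y)" using r by (simp only: hom less_imp_le)
        ultimately show ?thesis using r by (simp add: field_simps del: scaleR_add_right)
      qed
      then have "inverse r * directional_inf q y (r *\<^sub>R x) \<le> directional_inf q y x" by (rule ge)
      then show "directional_inf q y (r *\<^sub>R x) \<le> r * directional_inf q y x"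
        using r by (simp add: field_simps)
    next
      show "directional_inf q y 0 = 0"
        using upper[of 0 0] ge[of 0 0] lower[of _ 0] q0 by (intro antisym) auto
    qed
  next
    show "directional_inf q y x \<le> norm x" for x using upper[of 0 x] le[of x] by simp
  qed
qed

text \<open>Zorn's lemma for the reversed pointwise order. A chain is bounded by its pointwise
  infimum, which is finite because every member is at least \<open>- norm x\<close>, and subadditive
  because of any two members one lies below the other.\<close>

lemma minimal_sublinear_exists:
  fixes q0 :: "'a::real_normed_vector \<Rightarrow> real"
  assumes "sublinear q0"
  obtains m where "sublinear m" "\<And>x. m x \<le> q0 x" "\<And>q. sublinear q \<Longrightarrow> (\<And>x. q x \<le> m x) \<Longrightarrow> q = m"
proof -
  define A where "A = {q. sublinear q \<and> (\<forall>x. q x \<le> q0 x)}"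
  let ?P = "\<lambda>q q' :: 'a \<Rightarrow> real. \<forall>x. q' x \<le> q x"
  have "\<exists>m\<in>A. \<forall>a\<in>A. ?P m a \<longrightarrow> a = m"
  proof (rule predicate_Zorn)
    show "partial_order_on A (relation_of ?P A)"
      by (rule partial_order_on_relation_ofI) (auto intro: order_trans intro!: ext antisym)
  next
    fix C assume C: "C \<in> Chains (relation_of ?P A)"
    then have CA: "C \<subseteq> A" by (rule Chains_relation_of)
    have chain: "(\<forall>x. q x \<le> q' x) \<or> (\<forall>x. q' x \<le> q x)" if "q \<in> C" "q' \<in> C" for q q'
      using C that unfolding Chains_def relation_of_def by auto
    show "\<exists>u\<in>A. \<forall>a\<in>C. ?P a u"
    proof (cases "C = {}")
      case True then show ?thesis using assms by (auto simp: A_def)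
    next
      case False
      define u where "u x = (INF q\<in>C. q x)" for x
      have sub: "sublinear q" and leq0: "q x \<le> q0 x" if "q \<in> C" for q x
        using CA that by (auto simp: A_def)
      have add: "q (x + y) \<le> q x + q y" and hom: "r \<ge> 0 \<Longrightarrow> q (r *\<^sub>R x) = r * q x" and le: "q x \<le> norm x"
        if "q \<in> C" for q x y r
        using sub[OF that] by (auto simp: sublinear_def)
      have lower: "- norm x \<le> q x" if "q \<in> C" for q x
        using sublinear_lower[OF sub[OF that], of x] le[OF that, of "- x"] by simp
      have u: "u x \<le> q x" if "q \<in> C" for q x
        unfolding u_def by (rule cINF_lower) (use that lower in \<open>auto intro!: bdd_belowI2\<close>)
      have ge: "c \<le> u x" if "\<And>q. q \<in> C \<Longrightarrow> c \<le> q x" for c x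
        unfolding u_def by (rule cINF_greatest) (use that False in auto)
      have "sublinear u"
        unfolding sublinear_def
      proof (intro conjI allI impI)
        fix x y
        have "u (x + y) \<le> q x + q' y" if "q \<in> C" "q' \<in> C" for q q'
          using chain[OF that] u[OF that(1), of "x + y"] u[OF that(2), of "x + y"]
            add[OF that(1), of x y] add[OF that(2), of x y] by (smt (verit))
        then have "u (x + y) - q' y \<le> u x" if "q' \<in> C" for q'
          using that by (intro ge) (simp add: diff_le_eq)
        then have "u (x + y) - u x \<le> q' y" if "q' \<in> C" for q' using that by (smt (verit))
        then have "u (x + y) - u x \<le> u y" by (rule ge)
        then show "u (x + y) \<le> u x + u y" by simp
      next
        fix r :: real and x assume "r \<ge> 0"
        then show "u (r *\<^sub>R x) = r * u x"
        proof (rule sublinear_homogeneousI[rotated 2])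
          fix r :: real and x assume r: "r > 0"
          have "inverse r * u (r *\<^sub>R x) \<le> u x"
            by (rule ge) (use u[of _ "r *\<^sub>R x"] r in \<open>auto simp: hom field_simps\<close>)
          then show "u (r *\<^sub>R x) \<le> r * u x" using r by (simp add: field_simps)
        next
          have "q 0 = 0" if "q \<in> C" for q using hom[OF that, of 0 0] by simp
          then have "(\<lambda>q. q 0) ` C = (\<lambda>_. 0) ` C" by (rule image_cong[OF refl])
          then have "(\<lambda>q. q 0) ` C = {0}" using False by (simp add: image_constant_conv)
          then show "u 0 = 0" by (simp add: u_def)
        qed
      next
        show "u x \<le> norm x" for x using False u le by (meson ex_in_conv order_trans)
      qed
      moreover have "u x \<le> q0 x" for x using False u leq0 by (meson ex_in_conv order_trans)
      ultimately show ?thesis using u by (auto simp: A_def)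
    qed
  qed
  then obtain m where m: "m \<in> A" "\<And>a. a \<in> A \<Longrightarrow> \<forall>x. a x \<le> m x \<Longrightarrow> a = m" by blast
  show ?thesis
  proof (rule that)
    show "sublinear m" "\<And>x. m x \<le> q0 x" using m(1) by (auto simp: A_def)
    show "q = m" if "sublinear q" "\<And>x. q x \<le> m x" for q
      using m that by (auto simp: A_def intro: order_trans)
  qed
qed

text \<open>Minimising below \<open>norm\<close> alone might give the zero functional. Starting from
  \<open>directional_inf norm x0\<close> forces \<open>m (- x0) \<le> - norm x0\<close>, hence
  \<open>m x0 > 0\<close>. The complex functional is the usual
  \<open>m x - i m (i x)\<close>.\<close>

lemma separating_functional:
  fixes x0 :: "'a::complex_normed_vector"
  assumes "x0 \<noteq> 0"
  obtains f :: "'a \<Rightarrow> complex" where "clinear f" "bounded_linear f" "f x0 \<noteq> 0"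
proof -
  have sub_norm: "sublinear (norm :: 'a \<Rightarrow> real)" by (simp add: sublinear_def norm_triangle_ineq)
  obtain m :: "'a \<Rightarrow> real" where m: "sublinear m" and m_le: "\<And>x. m x \<le> directional_inf norm x0 x"
    and min: "\<And>q. sublinear q \<Longrightarrow> (\<And>x. q x \<le> m x) \<Longrightarrow> q = m"
    by (rule minimal_sublinear_exists[OF directional_inf(2)[OF sub_norm]]) blast
  have hom: "r \<ge> 0 \<Longrightarrow> m (r *\<^sub>R x) = r * m x" and le: "m x \<le> norm x" for r x
    using m by (auto simp: sublinear_def)
  have "directional_inf m y = m" for y
    by (rule min[OF directional_inf(2)[OF m]]) (use directional_inf(1)[OF m, of 0] in simp)
  then have "m x \<le> m (x + y) - m y" for x y
    using directional_inf(1)[OF m, of 1 y x] by simp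
  moreover have "m (x + y) \<le> m x + m y" for x y using m by (simp add: sublinear_def)
  ultimately have add: "m (x + y) = m x + m y" for x y by (smt (verit))
  have m0: "m 0 = 0" using hom[of 0 0] by simp
  have neg: "m (- x) = - m x" for x using add[of x "- x"] m0 by simp
  have scale: "m (r *\<^sub>R x) = r * m x" for r x
    using hom[of r x] hom[of "- r" x] neg[of "r *\<^sub>R x"] by (cases "r \<ge> 0") auto
  have abs: "\<bar>m x\<bar> \<le> norm x" for x using le[of x] le[of "- x"] neg[of x] by simp
  have "m (- x0) \<le> - norm x0"
    using m_le[of "- x0"] directional_inf(1)[OF sub_norm, of 1 x0 "- x0"] by simp
  then have pos: "m x0 > 0" using assms neg[of x0] zero_less_norm_iff[of x0] by linarith
  define f where "f x = Complex (m x) (- m (\<i> *\<^sub>C x))" for x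
  have fi: "f (\<i> *\<^sub>C x) = \<i> * f x" for x
    by (simp add: f_def complex_eq_iff scaleC_scaleC neg)
  have fadd: "f (x + y) = f x + f y" for x y by (simp add: f_def complex_eq_iff add scaleC_add_right)
  have fR: "f (r *\<^sub>R x) = of_real r * f x" for r x
    by (simp add: f_def complex_eq_iff scale scaleC_scaleR)
  have fC: "f (c *\<^sub>C x) = c *\<^sub>C f x" for c x
  proof -
    have "c *\<^sub>C x = Re c *\<^sub>R x + \<i> *\<^sub>C (Im c *\<^sub>R x)"
      by (simp add: scaleC_conv_of_real scaleC_scaleC flip: scaleC_add_left) (simp flip: complex_eq)
    then have "f (c *\<^sub>C x) = (of_real (Re c) + \<i> * of_real (Im c)) * f x"
      by (simp add: fadd fi fR algebra_simps)
    then show ?thesis by (simp add: scaleC_complex_def flip: complex_eq)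
  qed
  have lin: "clinear f" by (simp add: clinear_def fadd fC)
  moreover have "bounded_linear f"
  proof (rule clinear_bounded_linear[OF lin])
    fix x
    have "cmod (f x) \<le> \<bar>m x\<bar> + \<bar>m (\<i> *\<^sub>C x)\<bar>"
      using cmod_le[of "f x"] by (simp add: f_def)
    also have "\<dots> \<le> norm x + norm x" using abs[of x] abs[of "\<i> *\<^sub>C x"] by (simp add: norm_scaleC)
    finally show "cmod (f x) \<le> norm x * 2" by simp
  qed
  moreover have "f x0 \<noteq> 0" using pos by (auto simp: f_def complex_eq_iff)
  ultimately show ?thesis by (rule that)
qed

section \<open>Entire vector-valued functions: identity theorem and Liouville\<close>

lemma entire_functional:
  fixes f :: "'a::complex_normed_vector \<Rightarrow> complex"
  assumes "clinear f" "bounded_linear f" "entire F"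
  shows "(\<lambda>z. f (F z)) holomorphic_on UNIV"
  unfolding holomorphic_on_def field_differentiable_def
proof
  fix z
  obtain D where "(F has_derivative (\<lambda>h. h *\<^sub>C D)) (at z)" using assms(3) by (auto simp: entire_def)
  then have "((\<lambda>z. f (F z)) has_derivative (\<lambda>h. f (h *\<^sub>C D))) (at z)"
    by (rule bounded_linear.has_derivative[OF assms(2)])
  moreover have "(\<lambda>h. f (h *\<^sub>C D)) = (*) (f D)"
    using assms(1) by (simp add: clinear_scaleC scaleC_complex_def mult.commute fun_eq_iff)
  ultimately show "\<exists>D. ((\<lambda>z. f (F z)) has_field_derivative D) (at z within UNIV)"
    by (auto simp: has_field_derivative_def)
qed

lemma zero_islimpt_range_of_real: "(0 :: complex) islimpt range of_real"
proof (rule islimptI)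
  fix T :: "complex set" assume "0 \<in> T" "open T"
  then obtain e where e: "e > 0" "ball 0 e \<subseteq> T" by (auto simp: open_contains_ball)
  then have "complex_of_real (e / 2) \<in> T" "complex_of_real (e / 2) \<noteq> 0" by auto
  then show "\<exists>y\<in>range of_real. y \<in> T \<and> y \<noteq> (0 :: complex)" by blast
qed

text \<open>Bounded functionals separate points, which reduces the claim to the scalar identity
  theorem on the real axis. This is what gives the description in \<open>complex_flow\<close> its
  meaning.\<close>

lemma entire_real_unique:
  fixes F G :: "complex \<Rightarrow> 'a::complex_normed_vector"
  assumes F: "entire F" and G: "entire G" and eq: "\<And>t. F (complex_of_real t) = G (complex_of_real t)"
  shows "F = G"
proof (rule ext, rule ccontr)
  fix z assume "F z \<noteq> G z"
  then have "F z - G z \<noteq> 0" by simp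
  then obtain f :: "'a \<Rightarrow> complex" where f: "clinear f" "bounded_linear f" "f (F z - G z) \<noteq> 0"
    by (rule separating_functional) blast
  let ?h = "\<lambda>z. f (F z) - f (G z)"
  have "?h z = 0"
  proof (rule analytic_continuation[of ?h UNIV "range of_real" 0])
    show "?h holomorphic_on UNIV"
      by (intro holomorphic_intros entire_functional f F G)
  qed (auto simp: eq zero_islimpt_range_of_real)
  then show False using f by (simp add: clinear_diff)
qed

lemma entire_extension_unique:
  "entire_extension \<alpha> a F \<Longrightarrow> entire_extension \<alpha> a G \<Longrightarrow> F = G"
  by (rule entire_real_unique) (auto simp: entire_extension_def)

lemma complex_flow_eq: "entire_extension \<alpha> a F \<Longrightarrow> complex_flow \<alpha> z a = F z"
  unfolding complex_flow_def by (subst the_equality[of _ F]) (auto dest: entire_extension_unique)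

lemma entire_extension_complex_flow:
  assumes "a \<in> analytic_elements \<alpha>"
  shows "entire_extension \<alpha> a (\<lambda>z. complex_flow \<alpha> z a)"
proof -
  from assms obtain F where F: "entire_extension \<alpha> a F" by (auto simp: analytic_elements_def)
  then have "(\<lambda>z. complex_flow \<alpha> z a) = F" by (simp add: complex_flow_eq)
  with F show ?thesis by simp
qed

text \<open>The bound \<open>B\<close> depends on the imaginary part only, and periodicity moves
  every point into a horizontal strip on which \<open>B\<close> is bounded. So \<open>h\<close> is
  bounded on the plane.\<close>

lemma periodic_Liouville:
  fixes h :: "complex \<Rightarrow> complex"
  assumes hol: "h holomorphic_on UNIV" and per: "\<And>z. h (z + \<i> * of_real p) = h z" and "p \<noteq> 0"
    and le: "\<And>z. cmod (h z) \<le> B (Im z)" and B: "continuous_on UNIV (B :: real \<Rightarrow> real)"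
  shows "h z = h w"
proof -
  have per_nat: "h (z + of_nat n * (\<i> * of_real p)) = h z" for z n
    by (induction n) (use per[of "z + of_nat n * (\<i> * of_real p)" for z n] in \<open>auto simp: algebra_simps\<close>)
  have per_int: "h (z + of_int n * (\<i> * of_real p)) = h z" for z n
  proof (cases n)
    case (nonneg k) then show ?thesis using per_nat[of z k] by simp
  next
    case (neg k)
    then have "z + of_int n * (\<i> * of_real p) + of_nat (Suc k) * (\<i> * of_real p) = z"
      by (simp add: distrib_right[symmetric] add.assoc)
    then show ?thesis using per_nat[of "z + of_int n * (\<i> * of_real p)" "Suc k"] by metis
  qed
  have "compact (B ` {- \<bar>p\<bar>..\<bar>p\<bar>})"
    by (intro compact_continuous_image continuous_on_subset[OF B]) auto
  then have "bounded (B ` {- \<bar>p\<bar>..\<bar>p\<bar>})" by (rule compact_imp_bounded)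
  then obtain K where K: "\<forall>s\<in>{- \<bar>p\<bar>..\<bar>p\<bar>}. \<bar>B s\<bar> \<le> K"
    unfolding bounded_iff by auto
  have "cmod (h z) \<le> K" for z
  proof -
    \<comment> \<open>Leaves the remainder \<open>p * frac (Im z / p)\<close>; it has the sign of
      \<open>p\<close>, hence the symmetric interval.\<close>
    define n where "n = - \<lfloor>Im z / p\<rfloor>"
    have "Im z + of_int n * p = p * frac (Im z / p)"
      using \<open>p \<noteq> 0\<close> by (simp add: n_def frac_def field_simps)
    moreover have "\<bar>p * frac (Im z / p)\<bar> \<le> \<bar>p\<bar>"
      by (simp add: abs_mult mult_left_le frac_lt_1 less_imp_le)
    ultimately have "Im (z + of_int n * (\<i> * of_real p)) \<in> {- \<bar>p\<bar>..\<bar>p\<bar>}" by (simp add: abs_le_iff)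
    then show ?thesis using le[of "z + of_int n * (\<i> * of_real p)"] K per_int[of z n]
      by (smt (verit))
  qed
  then have "bounded (range h)" by (auto simp: bounded_iff)
  then have "h constant_on UNIV" by (rule Liouville_theorem[OF hol])
  then show ?thesis by (auto simp: constant_on_def)
qed

section \<open>Gaussian smoothing\<close>

lemma has_integral_affinity_UNIV:
  fixes f :: "real \<Rightarrow> 'a::banach"
  assumes f: "(f has_integral i) UNIV" and m: "m > 0"
  shows "((\<lambda>x. f (m * x + c)) has_integral (1 / m) *\<^sub>R i) UNIV"
proof -
  have int: "f integrable_on cbox a b" for a b :: real
    using f unfolding has_integral_alt'[of f] by simp
  have img: "(\<lambda>x. (1 / m) *\<^sub>R x + - ((1 / m) *\<^sub>R c)) ` cbox (m * a + c) (m * b + c) = cbox a b" for a b :: real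
  proof (intro equalityI subsetI)
    fix x assume "x \<in> cbox a b"
    then have "m * x + c \<in> cbox (m * a + c) (m * b + c)" using m by simp
    moreover have "x = (1 / m) *\<^sub>R (m * x + c) + - ((1 / m) *\<^sub>R c)" using m by (simp add: field_simps)
    ultimately show "x \<in> (\<lambda>x. (1 / m) *\<^sub>R x + - ((1 / m) *\<^sub>R c)) ` cbox (m * a + c) (m * b + c)" by blast
  qed (use m in \<open>auto simp: field_simps\<close>)
  have I: "((\<lambda>x. f (m * x + c)) has_integral (1 / m) *\<^sub>R integral (cbox (m * a + c) (m * b + c)) f) (cbox a b)" for a b :: real
    using has_integral_affinity[OF integrable_integral[OF int[of "m * a + c" "m * b + c"]], of m c] m
    unfolding img by simp
  show ?thesis
    unfolding has_integral_alt'[of "\<lambda>x. f (m * x + c)"]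
  proof (intro conjI allI impI)
    show "(\<lambda>x. if x \<in> UNIV then f (m * x + c) else 0) integrable_on cbox a b" for a b :: real
      using I[of a b] by (auto simp: integrable_on_def)
  next
    fix e :: real assume "e > 0"
    then have "m * e > 0" using m by simp
    then have "\<exists>B>0. \<forall>a b. ball (0::real) B \<subseteq> cbox a b \<longrightarrow>
        norm (integral (cbox a b) (\<lambda>x. if x \<in> UNIV then f x else 0) - i) < m * e"
      using f[unfolded has_integral_alt'[of f], THEN conjunct2] by (elim allE) (erule mp)
    then obtain B where B: "B > 0 \<and> (\<forall>a b. ball (0::real) B \<subseteq> cbox a b \<longrightarrow>
        norm (integral (cbox a b) (\<lambda>x. if x \<in> UNIV then f x else 0) - i) < m * e)" ..
    then have B1: "B > 0" and B2: "\<And>a b. ball 0 B \<subseteq> cbox a b \<Longrightarrow> norm (integral (cbox a b) f - i) < m * e"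
      by simp_all
    show "\<exists>B>0. \<forall>a b. ball 0 B \<subseteq> cbox a b \<longrightarrow>
        norm (integral (cbox a b) (\<lambda>x. if x \<in> UNIV then f (m * x + c) else 0) - (1 / m) *\<^sub>R i) < e"
    \<comment> \<open>The preimage of the ball of radius \<open>B\<close> under
      \<open>x \<mapsto> m * x + c\<close> lies in the ball of this radius.\<close>
    proof (intro exI[of _ "(B + \<bar>c\<bar>) / m"] conjI allI impI)
      show "(B + \<bar>c\<bar>) / m > 0" using B1 m by (simp add: add_pos_nonneg)
      fix a b :: real assume sub: "ball (0::real) ((B + \<bar>c\<bar>) / m) \<subseteq> cbox a b"
      have "ball (0::real) B \<subseteq> cbox (m * a + c) (m * b + c)"
      proof
        fix y :: real assume "y \<in> ball 0 B"
        then have "\<bar>(y - c) / m\<bar> < (B + \<bar>c\<bar>) / m" using m by (simp add: abs_divide divide_strict_right_mono)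
        then have "(y - c) / m \<in> cbox a b" using sub by (auto simp: subset_eq dist_norm)
        then show "y \<in> cbox (m * a + c) (m * b + c)" using m by (auto simp: field_simps)
      qed
      then have "norm (integral (cbox (m * a + c) (m * b + c)) f - i) < m * e" by (rule B2)
      then have "1 / m * norm (integral (cbox (m * a + c) (m * b + c)) f - i) < e"
        using m by (simp add: pos_divide_less_eq mult.commute[of e])
      then have "norm ((1 / m) *\<^sub>R (integral (cbox (m * a + c) (m * b + c)) f - i)) < e"
        unfolding norm_scaleR using m by simp
      then show "norm (integral (cbox a b) (\<lambda>x. if x \<in> UNIV then f (m * x + c) else 0) - (1 / m) *\<^sub>R i) < e"
        using integral_unique[OF I[of a b]] by (simp add: scaleR_diff_right)
    qed
  qed
qed

lemma integrable_exp_minus_abs: "(\<lambda>t. exp (- \<bar>t\<bar>)) integrable_on (UNIV :: real set)"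
proof -
  have 1: "(\<lambda>t. exp (- \<bar>t\<bar>)) integrable_on {0::real..}"
    using integrable_on_exp_minus_to_infinity[of 1 0] by (rule integrable_eq) auto
  then have "(\<lambda>t. exp (- \<bar>t\<bar>)) absolutely_integrable_on {0::real..}"
    by (rule nonnegative_absolutely_integrable_1) simp
  then have "(\<lambda>t. exp (- \<bar>- t\<bar>)) absolutely_integrable_on {..0::real}"
    using has_absolute_integral_reflect_real[of "{..0}" "{0..}" "\<lambda>t. exp (- \<bar>t\<bar>)"] by auto
  then have 2: "(\<lambda>t. exp (- \<bar>t\<bar>)) integrable_on {..0::real}"
    by (simp add: set_lebesgue_integral_eq_integral(1))
  have "(\<lambda>t. exp (- \<bar>t\<bar>)) integrable_on ({..0::real} \<union> {0..})"
    by (rule integrable_Un[OF _ 2 1]) (rule negligible_subset[of "{0}"], auto)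
  moreover have "{..0::real} \<union> {0..} = UNIV" by auto
  ultimately show ?thesis by simp
qed

lemma integrable_on_UNIV_dominated:
  fixes f :: "real \<Rightarrow> 'a::banach"
  assumes "continuous_on UNIV f" "\<And>t. norm (f t) \<le> K * exp (- \<bar>t\<bar>)"
  shows "f integrable_on UNIV" "norm (integral UNIV f) \<le> K * integral UNIV (\<lambda>t::real. exp (- \<bar>t\<bar>))"
proof -
  have g: "(\<lambda>t::real. K * exp (- \<bar>t\<bar>)) integrable_on UNIV"
    using integrable_exp_minus_abs by (rule integrable_on_mult_right)
  show f: "f integrable_on UNIV"
  proof (rule integrable_on_all_intervals_integrable_bound[OF _ _ g])
    show "(\<lambda>x. if x \<in> UNIV then f x else 0) integrable_on cbox a b" for a b
      using continuous_on_subset[OF assms(1), of "{a..b}"] by (simp add: integrable_continuous_interval)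
  qed (use assms in auto)
  show "norm (integral UNIV f) \<le> K * integral UNIV (\<lambda>t::real. exp (- \<bar>t\<bar>))"
    using integral_norm_bound_integral[OF f g] assms(2) by (simp add: integral_mult_right)
qed

text \<open>Not normalised, and with a complex centre \<open>z\<close>: varying the centre is what
  continues a smoothed orbit to the complex plane.\<close>

definition gauss_kernel :: "real \<Rightarrow> complex \<Rightarrow> real \<Rightarrow> complex" where
  "gauss_kernel \<epsilon> z t = exp (- (((of_real t - z) / of_real \<epsilon>)\<^sup>2))"

text \<open>A Gaussian absorbs any exponential weight. The weight is included because the difference
  quotient in \<open>z\<close> produces such factors, and one integrable majorant
  \<open>exp (- \<bar>t\<bar>)\<close> should serve for all of them.\<close>

lemma gauss_kernel_bound:
  assumes "\<epsilon> > 0" "A \<ge> 0"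
  obtains K where "K > 0" "\<And>t. exp (A * cmod (of_real t - z)) * cmod (gauss_kernel \<epsilon> z t) \<le> K * exp (- \<bar>t\<bar>)"
proof
  let ?C = "(Im z)\<^sup>2 / \<epsilon>\<^sup>2 + A * \<bar>Im z\<bar> + \<bar>Re z\<bar> + (A + 1)\<^sup>2 * \<epsilon>\<^sup>2 / 4"
  fix t
  let ?s = "\<bar>t - Re z\<bar>"
  have "Re (- (((of_real t - z) / of_real \<epsilon>)\<^sup>2)) = - ((?s\<^sup>2 - (Im z)\<^sup>2) / \<epsilon>\<^sup>2)"
    by (simp add: power_divide Re_power2 flip: of_real_power)
  then have norm: "cmod (gauss_kernel \<epsilon> z t) = exp (- ((?s\<^sup>2 - (Im z)\<^sup>2) / \<epsilon>\<^sup>2))"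
    by (simp add: gauss_kernel_def norm_exp_eq_Re)
  have "cmod (of_real t - z) \<le> ?s + \<bar>Im z\<bar>" using cmod_le[of "of_real t - z"] by simp
  then have 1: "A * cmod (of_real t - z) \<le> A * ?s + A * \<bar>Im z\<bar>"
    using assms(2) by (metis distrib_left mult_left_mono)
  \<comment> \<open>Completing the square at rate \<open>A + 1\<close>: \<open>A\<close> for the
    weight and 1 for the decay that must remain.\<close>
  have "0 \<le> (?s / \<epsilon> - (A + 1) * \<epsilon> / 2)\<^sup>2" by simp
  then have 2: "(A + 1) * ?s \<le> ?s\<^sup>2 / \<epsilon>\<^sup>2 + (A + 1)\<^sup>2 * \<epsilon>\<^sup>2 / 4"
    using assms(1) by (simp add: power2_diff power_divide power_mult_distrib mult.commute[of _ "A + 1"])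
  have 3: "\<bar>t\<bar> \<le> ?s + \<bar>Re z\<bar>" by simp
  have "A * cmod (of_real t - z) + - ((?s\<^sup>2 - (Im z)\<^sup>2) / \<epsilon>\<^sup>2) \<le> ?C + - \<bar>t\<bar>"
    using 1 2 3 by (simp add: diff_divide_distrib algebra_simps)
  then show "exp (A * cmod (of_real t - z)) * cmod (gauss_kernel \<epsilon> z t) \<le> exp ?C * exp (- \<bar>t\<bar>)"
    unfolding norm by (simp only: exp_add[symmetric] exp_le_cancel_iff)
qed simp

lemma continuous_on_gauss_kernel [continuous_intros]: "\<epsilon> > 0 \<Longrightarrow> continuous_on A (gauss_kernel \<epsilon> z)"
  unfolding gauss_kernel_def by (intro continuous_intros) auto

text \<open>Moving the centre multiplies the kernel by \<open>exp k\<close> with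
  \<open>k = (2 w h - h^2) / \<epsilon>^2\<close>, whose part linear in \<open>h\<close> gives the
  derivative. What remains is the second-order remainder of \<open>exp\<close> and the term
  \<open>h^2 / \<epsilon>^2\<close>.\<close>

lemma gauss_kernel_shift_bound:
  assumes "\<epsilon> > 0" "cmod h \<le> 1"
  shows "cmod (gauss_kernel \<epsilon> (z + h) t - gauss_kernel \<epsilon> z t -
      h * (2 * (of_real t - z) / of_real (\<epsilon>\<^sup>2) * gauss_kernel \<epsilon> z t)) \<le>
    (cmod h)\<^sup>2 * (3 * exp (2 / \<epsilon>\<^sup>2) * (exp (4 / \<epsilon>\<^sup>2 * cmod (of_real t - z)) * cmod (gauss_kernel \<epsilon> z t)))"
proof -
  define e where "e = \<epsilon>\<^sup>2"
  have e: "e > 0" using assms(1) by (simp add: e_def)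
  define w where "w = of_real t - z"
  define k where "k = (2 * w * h - h\<^sup>2) / of_real e"
  define m where "m = (2 * cmod w + 1) / e"
  have m0: "m \<ge> 0" using e by (simp add: m_def)
  have "gauss_kernel \<epsilon> (z + h) t = gauss_kernel \<epsilon> z t * exp k"
  proof -
    have "- (((of_real t - (z + h)) / of_real \<epsilon>)\<^sup>2) = - (((of_real t - z) / of_real \<epsilon>)\<^sup>2) + k"
      using assms(1) by (simp add: k_def w_def e_def power2_eq_square field_simps)
    then show ?thesis unfolding gauss_kernel_def by (simp only: exp_add)
  qed
  then have eq: "gauss_kernel \<epsilon> (z + h) t - gauss_kernel \<epsilon> z t -
      h * (2 * (of_real t - z) / of_real (\<epsilon>\<^sup>2) * gauss_kernel \<epsilon> z t) =
      ((exp k - 1 - k) - h\<^sup>2 / of_real e) * gauss_kernel \<epsilon> z t"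
    unfolding e_def[symmetric] w_def[symmetric] using e by (simp add: k_def field_simps power2_eq_square)
  have "cmod (2 * w * h - h\<^sup>2) \<le> 2 * cmod w * cmod h + (cmod h)\<^sup>2"
    using norm_triangle_ineq4[of "2 * w * h" "h\<^sup>2"] by (simp add: norm_mult norm_power)
  also have "\<dots> \<le> cmod h * (2 * cmod w + 1)"
    using assms(2) by (simp add: power2_eq_square algebra_simps mult_left_le)
  finally have km: "cmod k \<le> cmod h * m"
    using e by (simp add: k_def m_def norm_divide divide_right_mono)
  also have "\<dots> \<le> m" using assms(2) m0 by (simp add: mult_left_le_one_le)
  finally have km': "cmod k \<le> m" .
  have "cmod (exp k - 1 - k) \<le> exp (cmod k) * (cmod k)\<^sup>2"
    using Taylor_exp_field[of k 1] by (simp add: diff_diff_eq power2_eq_square)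
  also have "\<dots> \<le> exp m * (cmod h * m)\<^sup>2"
    using km km' by (intro mult_mono power_mono) auto
  also have "\<dots> \<le> exp m * ((cmod h)\<^sup>2 * (2 * exp m))"
  proof -
    have "m\<^sup>2 \<le> 2 * exp m" using exp_lower_Taylor_quadratic[of m] m0 by simp
    then show ?thesis by (simp add: power_mult_distrib mult_left_mono)
  qed
  finally have 1: "cmod (exp k - 1 - k) \<le> (cmod h)\<^sup>2 * (2 * exp (2 * m))"
    using exp_double[of m] by (simp add: power2_eq_square mult_ac)
  have "1 / e \<le> m" using e by (simp add: m_def field_simps)
  also have "m \<le> exp (2 * m)" using exp_ge_add_one_self[of "2 * m"] m0 by linarith
  finally have "cmod (h\<^sup>2 / of_real e) \<le> (cmod h)\<^sup>2 * exp (2 * m)"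
    using e mult_left_mono[of "1 / e" "exp (2 * m)" "(cmod h)\<^sup>2"] by (simp add: norm_divide norm_power)
  \<comment> \<open>The factor 3 is 2 from the Taylor remainder, where
    \<open>m^2 \<le> 2 * exp m\<close>, plus 1 from \<open>h^2 / e\<close>, where
    \<open>1 / e \<le> m \<le> exp (2 * m)\<close>.\<close>
  with 1 have "cmod ((exp k - 1 - k) - h\<^sup>2 / of_real e) \<le> (cmod h)\<^sup>2 * (3 * exp (2 * m))"
    using norm_triangle_ineq4[of "exp k - 1 - k" "h\<^sup>2 / of_real e"] by simp
  moreover have "exp (2 * m) = exp (2 / \<epsilon>\<^sup>2) * exp (4 / \<epsilon>\<^sup>2 * cmod w)"
    unfolding m_def e_def exp_add[symmetric] by (simp add: add_divide_distrib distrib_left add.commute)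
  ultimately show ?thesis unfolding eq norm_mult
    by (simp add: w_def[symmetric] mult_right_mono mult.assoc[symmetric])
qed

text \<open>An explicit quadratic remainder survives integration in the parameter, so no theorem on
  differentiation under the integral sign is called for.\<close>

lemma entire_quadratic_estimate:
  fixes F :: "complex \<Rightarrow> 'a::complex_normed_vector"
  assumes "\<And>z. \<exists>D K. \<forall>h. cmod h \<le> 1 \<longrightarrow> norm (F (z + h) - F z - h *\<^sub>C D) \<le> (cmod h)\<^sup>2 * K"
  shows "entire F"
  unfolding entire_def
proof
  fix z
  obtain D K where DK: "\<And>h. cmod h \<le> 1 \<Longrightarrow> norm (F (z + h) - F z - h *\<^sub>C D) \<le> (cmod h)\<^sup>2 * K"
    using assms[of z] by blast
  have "((\<lambda>h. norm (F (z + h) - F z - h *\<^sub>C D) / norm h) \<longlongrightarrow> 0) (at 0)"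
  proof (rule tendsto_sandwich[OF _ _ tendsto_const])
    show "((\<lambda>h. cmod h * K) \<longlongrightarrow> 0) (at 0)" by (auto intro!: tendsto_eq_intros)
    show "\<forall>\<^sub>F h in at 0. norm (F (z + h) - F z - h *\<^sub>C D) / cmod h \<le> cmod h * K"
      unfolding eventually_at
    proof (intro exI[of _ 1] conjI ballI impI)
      fix h :: complex assume "h \<noteq> 0 \<and> dist h 0 < 1"
      then show "norm (F (z + h) - F z - h *\<^sub>C D) / cmod h \<le> cmod h * K"
        using DK[of h] by (simp add: divide_le_eq power2_eq_square mult_ac)
    qed simp
  qed simp
  moreover have "bounded_linear (\<lambda>h. h *\<^sub>C D)"
    using bounded_bilinear.bounded_linear_left[OF bounded_bilinear_scaleC] .
  ultimately show "\<exists>D. (F has_derivative (\<lambda>h. h *\<^sub>C D)) (at z)"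
    by (auto simp: has_derivative_at)
qed

definition gauss_const :: real where
  "gauss_const = integral UNIV (\<lambda>t::real. exp (- (t\<^sup>2)))"

definition gauss_smooth :: "real \<Rightarrow> (real \<Rightarrow> 'a) \<Rightarrow> complex \<Rightarrow> 'a::{complex_normed_vector,banach}" where
  "gauss_smooth \<epsilon> f z = (1 / (gauss_const * \<epsilon>)) *\<^sub>R integral UNIV (\<lambda>t. gauss_kernel \<epsilon> z t *\<^sub>C f t)"

lemma exp_minus_square_le: "exp (- (t\<^sup>2)) \<le> exp 1 * exp (- \<bar>t :: real\<bar>)"
proof -
  have "0 \<le> (\<bar>t\<bar> - 1/2)\<^sup>2" by simp
  then have "- (t\<^sup>2) \<le> 1 + - \<bar>t\<bar>" by (simp add: power2_diff power_divide)
  then show ?thesis by (simp only: exp_add[symmetric] exp_le_cancel_iff)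
qed

lemma integrable_exp_minus_square: "(\<lambda>t::real. exp (- (t\<^sup>2))) integrable_on UNIV"
  by (rule integrable_on_UNIV_dominated[where K = "exp 1"])
    (auto intro!: continuous_intros simp: exp_minus_square_le)

lemma gauss_const_pos: "gauss_const > 0"
proof -
  have "integral {0..1} (\<lambda>t::real. exp (- (t\<^sup>2))) \<le> gauss_const"
    unfolding gauss_const_def
    by (rule integral_subset_le)
      (auto intro!: integrable_exp_minus_square integrable_continuous_interval continuous_intros)
  moreover have "integral {0..1} (\<lambda>t::real. exp (- 1)) \<le> integral {0..1} (\<lambda>t::real. exp (- (t\<^sup>2)))"
    by (rule integral_le)
      (auto intro!: integrable_continuous_interval continuous_intros simp: abs_square_le_1)
  moreover have "integral {0..1} (\<lambda>t::real. exp (- 1)) = exp (- 1 :: real)" by simp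
  ultimately show ?thesis using exp_gt_zero[of "- 1 :: real"] by linarith
qed

context
  fixes \<epsilon> :: real
  assumes eps: "\<epsilon> > 0"
begin

lemma gauss_weighted:
  fixes f :: "real \<Rightarrow> 'a::{complex_normed_vector,banach}"
  assumes g: "continuous_on UNIV g" "\<And>t. cmod (g t) \<le> K * exp (- \<bar>t\<bar>)" "K \<ge> 0"
    and f: "continuous_on UNIV f" "\<And>t. norm (f t) \<le> C"
  shows "(\<lambda>t. g t *\<^sub>C f t) integrable_on UNIV"
    and "norm (integral UNIV (\<lambda>t. g t *\<^sub>C f t)) \<le> K * C * integral UNIV (\<lambda>t::real. exp (- \<bar>t\<bar>))"
proof -
  have C: "norm (g t *\<^sub>C f t) \<le> K * C * exp (- \<bar>t\<bar>)" for t
  proof -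
    have "cmod (g t) * norm (f t) \<le> (K * exp (- \<bar>t\<bar>)) * C" using g f by (intro mult_mono) auto
    then show ?thesis by (simp add: norm_scaleC mult_ac)
  qed
  have cont: "continuous_on UNIV (\<lambda>t. g t *\<^sub>C f t)" by (intro continuous_intros g f)
  show "(\<lambda>t. g t *\<^sub>C f t) integrable_on UNIV"
    "norm (integral UNIV (\<lambda>t. g t *\<^sub>C f t)) \<le> K * C * integral UNIV (\<lambda>t::real. exp (- \<bar>t\<bar>))"
    using integrable_on_UNIV_dominated[OF cont C] by simp_all
qed

lemma gauss_smooth_integrable:
  fixes f :: "real \<Rightarrow> 'a::{complex_normed_vector,banach}"
  assumes f: "continuous_on UNIV f" "\<And>t. norm (f t) \<le> C"
  shows "(\<lambda>t. gauss_kernel \<epsilon> z t *\<^sub>C f t) integrable_on UNIV"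
proof -
  obtain K where "K > 0" "\<And>t. cmod (gauss_kernel \<epsilon> z t) \<le> K * exp (- \<bar>t\<bar>)"
    using gauss_kernel_bound[OF eps, of 0 z] by auto
  then show ?thesis
    using f by (intro gauss_weighted(1)[of _ K _ C] continuous_intros eps) auto
qed

text \<open>The same \<open>L\<close> serves every \<open>f\<close> at a fixed \<open>z\<close>.
  Smoothing is therefore continuous in \<open>f\<close>, even at complex \<open>z\<close>, and
  limits of vectors may be taken inside it.\<close>

lemma gauss_smooth_bound:
  obtains L where "\<And>(f :: real \<Rightarrow> 'a::{complex_normed_vector,banach}) C. continuous_on UNIV f \<Longrightarrow>
    (\<And>t. norm (f t) \<le> C) \<Longrightarrow> norm (gauss_smooth \<epsilon> f z) \<le> L * C"
proof -
  obtain K where K: "K > 0" "\<And>t. cmod (gauss_kernel \<epsilon> z t) \<le> K * exp (- \<bar>t\<bar>)"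
    using gauss_kernel_bound[OF eps, of 0 z] by auto
  let ?I = "integral UNIV (\<lambda>t::real. exp (- \<bar>t\<bar>))"
  show ?thesis
  proof (rule that)
    fix f :: "real \<Rightarrow> 'a" and C assume f: "continuous_on UNIV f" "\<And>t. norm (f t) \<le> C"
    have "norm (integral UNIV (\<lambda>t. gauss_kernel \<epsilon> z t *\<^sub>C f t)) \<le> K * C * ?I"
      using f K by (intro gauss_weighted(2) continuous_intros eps) auto
    then have "norm (gauss_smooth \<epsilon> f z) \<le> (1 / (gauss_const * \<epsilon>)) * (K * C * ?I)"
      using eps gauss_const_pos unfolding gauss_smooth_def norm_scaleR by (intro mult_mono) auto
    then show "norm (gauss_smooth \<epsilon> f z) \<le> (1 / (gauss_const * \<epsilon>) * K * ?I) * C" by (simp add: mult_ac)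
  qed
qed

lemma entire_gauss_smooth:
  fixes f :: "real \<Rightarrow> 'a::{complex_normed_vector,banach}"
  assumes f: "continuous_on UNIV f" "\<And>t. norm (f t) \<le> C"
  shows "entire (gauss_smooth \<epsilon> f)"
proof (rule entire_quadratic_estimate)
  fix z
  \<comment> \<open>The derivative of the kernel with respect to \<open>z\<close>.\<close>
  define g where "g t = 2 * (of_real t - z) / of_real (\<epsilon>\<^sup>2) * gauss_kernel \<epsilon> z t" for t
  have gc: "continuous_on UNIV g" unfolding g_def using eps by (intro continuous_intros) auto
  obtain K1 where K1: "K1 > 0" "\<And>t. exp (cmod (of_real t - z)) * cmod (gauss_kernel \<epsilon> z t) \<le> K1 * exp (- \<bar>t\<bar>)"
    using gauss_kernel_bound[OF eps, of 1 z] by auto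
  have gb: "cmod (g t) \<le> (2 / \<epsilon>\<^sup>2 * K1) * exp (- \<bar>t\<bar>)" for t
  proof -
    have "cmod (of_real t - z) \<le> exp (cmod (of_real t - z))"
      using exp_ge_add_one_self[of "cmod (of_real t - z)"] by linarith
    then have "cmod (of_real t - z) * cmod (gauss_kernel \<epsilon> z t) \<le> K1 * exp (- \<bar>t\<bar>)"
      by (rule order_trans[OF mult_right_mono K1(2)]) simp
    then have "2 / \<epsilon>\<^sup>2 * (cmod (of_real t - z) * cmod (gauss_kernel \<epsilon> z t)) \<le> 2 / \<epsilon>\<^sup>2 * (K1 * exp (- \<bar>t\<bar>))"
      by (rule mult_left_mono) simp
    then show ?thesis unfolding g_def norm_mult norm_divide by (simp add: norm_power mult_ac)
  qed
  have gi: "(\<lambda>t. g t *\<^sub>C f t) integrable_on UNIV"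
    using K1 by (intro gauss_weighted(1)[OF gc gb _ f]) auto
  obtain K2 where K2: "K2 > 0"
      "\<And>t. exp (4 / \<epsilon>\<^sup>2 * cmod (of_real t - z)) * cmod (gauss_kernel \<epsilon> z t) \<le> K2 * exp (- \<bar>t\<bar>)"
    using gauss_kernel_bound[OF eps, of "4 / \<epsilon>\<^sup>2" z] by auto
  let ?I = "integral UNIV (\<lambda>t::real. exp (- \<bar>t\<bar>))"
  let ?c = "1 / (gauss_const * \<epsilon>)"
  have c: "?c \<ge> 0" using eps gauss_const_pos by simp
  let ?D = "?c *\<^sub>R integral UNIV (\<lambda>t. g t *\<^sub>C f t)"
  let ?K = "?c * (3 * exp (2 / \<epsilon>\<^sup>2) * K2 * C * ?I)"
  have "norm (gauss_smooth \<epsilon> f (z + h) - gauss_smooth \<epsilon> f z - h *\<^sub>C ?D) \<le> (cmod h)\<^sup>2 * ?K"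
    if h: "cmod h \<le> 1" for h
  proof -
    define d where "d t = gauss_kernel \<epsilon> (z + h) t - gauss_kernel \<epsilon> z t - h * g t" for t
    have db: "cmod (d t) \<le> ((cmod h)\<^sup>2 * (3 * exp (2 / \<epsilon>\<^sup>2) * K2)) * exp (- \<bar>t\<bar>)" for t
    proof -
      have "cmod (d t) \<le> (cmod h)\<^sup>2 * (3 * exp (2 / \<epsilon>\<^sup>2) *
          (exp (4 / \<epsilon>\<^sup>2 * cmod (of_real t - z)) * cmod (gauss_kernel \<epsilon> z t)))"
        unfolding d_def g_def by (rule gauss_kernel_shift_bound[OF eps h])
      also have "\<dots> \<le> (cmod h)\<^sup>2 * (3 * exp (2 / \<epsilon>\<^sup>2) * (K2 * exp (- \<bar>t\<bar>)))"
        by (intro mult_left_mono K2(2)) auto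
      finally show ?thesis by (simp add: mult_ac)
    qed
    have "norm (integral UNIV (\<lambda>t. d t *\<^sub>C f t)) \<le> ((cmod h)\<^sup>2 * (3 * exp (2 / \<epsilon>\<^sup>2) * K2)) * C * ?I"
    proof (rule gauss_weighted(2)[OF _ db _ f])
      show "continuous_on UNIV d" unfolding d_def by (intro continuous_intros eps gc)
    qed (use K2 in auto)
    moreover have "integral UNIV (\<lambda>t. d t *\<^sub>C f t) =
        integral UNIV (\<lambda>t. gauss_kernel \<epsilon> (z + h) t *\<^sub>C f t) - integral UNIV (\<lambda>t. gauss_kernel \<epsilon> z t *\<^sub>C f t)
        - h *\<^sub>C integral UNIV (\<lambda>t. g t *\<^sub>C f t)"
    proof -
      have bl: "bounded_linear ((*\<^sub>C) h :: 'a \<Rightarrow> 'a)"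
        by (rule bounded_bilinear.bounded_linear_right[OF bounded_bilinear_scaleC])
      have "((\<lambda>t. h *\<^sub>C (g t *\<^sub>C f t)) has_integral h *\<^sub>C integral UNIV (\<lambda>t. g t *\<^sub>C f t)) UNIV"
        using has_integral_linear[OF integrable_integral[OF gi] bl] by (simp add: o_def)
      from has_integral_diff[OF has_integral_diff[OF
          integrable_integral[OF gauss_smooth_integrable[OF f, of "z + h"]]
          integrable_integral[OF gauss_smooth_integrable[OF f, of z]]] this]
      show ?thesis by (intro integral_unique) (simp add: d_def scaleC_diff_left scaleC_scaleC)
    qed
    ultimately have *: "norm (integral UNIV (\<lambda>t. gauss_kernel \<epsilon> (z + h) t *\<^sub>C f t) -
        integral UNIV (\<lambda>t. gauss_kernel \<epsilon> z t *\<^sub>C f t) - h *\<^sub>C integral UNIV (\<lambda>t. g t *\<^sub>C f t))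
        \<le> (cmod h)\<^sup>2 * (3 * exp (2 / \<epsilon>\<^sup>2) * K2) * C * ?I" by simp
    have "gauss_smooth \<epsilon> f (z + h) - gauss_smooth \<epsilon> f z - h *\<^sub>C ?D =
        ?c *\<^sub>R (integral UNIV (\<lambda>t. gauss_kernel \<epsilon> (z + h) t *\<^sub>C f t) -
        integral UNIV (\<lambda>t. gauss_kernel \<epsilon> z t *\<^sub>C f t) - h *\<^sub>C integral UNIV (\<lambda>t. g t *\<^sub>C f t))"
      unfolding gauss_smooth_def by (simp only: scaleR_diff_right scaleC_scaleR)
    then show ?thesis using mult_left_mono[OF * c] c by (simp add: mult_ac)
  qed
  then show "\<exists>D K. \<forall>h. cmod h \<le> 1 \<longrightarrow>
      norm (gauss_smooth \<epsilon> f (z + h) - gauss_smooth \<epsilon> f z - h *\<^sub>C D) \<le> (cmod h)\<^sup>2 * K" by blast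
qed

lemma gauss_smooth_linear:
  fixes f :: "real \<Rightarrow> 'a::{complex_normed_vector,banach}" and L :: "'a \<Rightarrow> 'b::{complex_normed_vector,banach}"
  assumes f: "continuous_on UNIV f" "\<And>t. norm (f t) \<le> C" and L: "clinear L" "bounded_linear L"
  shows "L (gauss_smooth \<epsilon> f z) = gauss_smooth \<epsilon> (\<lambda>t. L (f t)) z"
proof -
  have "L (integral UNIV (\<lambda>t. gauss_kernel \<epsilon> z t *\<^sub>C f t)) = integral UNIV (\<lambda>t. L (gauss_kernel \<epsilon> z t *\<^sub>C f t))"
    using integral_linear[OF gauss_smooth_integrable[OF f] L(2), symmetric] by (simp add: o_def)
  then show ?thesis using L by (simp add: gauss_smooth_def clinear_scaleR clinear_scaleC)
qed

text \<open>Translation invariance of the integral trades a shift of \<open>f\<close> for a real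
  shift of the centre. For an orbit \<open>f\<close> this says that smoothing intertwines the flow
  with translation of \<open>z\<close>.\<close>

lemma gauss_smooth_shift:
  fixes f :: "real \<Rightarrow> 'a::{complex_normed_vector,banach}"
  assumes f: "continuous_on UNIV f" "\<And>t. norm (f t) \<le> C"
  shows "gauss_smooth \<epsilon> (\<lambda>t. f (t + s)) z = gauss_smooth \<epsilon> f (z + of_real s)"
proof -
  have "((\<lambda>t. gauss_kernel \<epsilon> (z + of_real s) (1 * t + s) *\<^sub>C f (1 * t + s)) has_integral
      (1 / 1) *\<^sub>R integral UNIV (\<lambda>t. gauss_kernel \<epsilon> (z + of_real s) t *\<^sub>C f t)) UNIV"
    by (rule has_integral_affinity_UNIV[OF integrable_integral[OF gauss_smooth_integrable[OF f]]]) simp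
  moreover have "gauss_kernel \<epsilon> (z + of_real s) (t + s) = gauss_kernel \<epsilon> z t" for t
    by (simp add: gauss_kernel_def)
  ultimately show ?thesis unfolding gauss_smooth_def by (simp add: integral_unique)
qed

text \<open>Substituting \<open>\<epsilon> * t\<close> moves \<open>\<epsilon>\<close> from the
  kernel into the argument of \<open>f\<close>; the weight no longer varies, and dominated
  convergence applies as \<open>\<epsilon>\<close> tends to 0.\<close>

lemma gauss_smooth_rescale:
  fixes f :: "real \<Rightarrow> 'a::{complex_normed_vector,banach}"
  assumes f: "continuous_on UNIV f" "\<And>t. norm (f t) \<le> C"
  shows "((\<lambda>t. exp (- (t\<^sup>2)) *\<^sub>R f (\<epsilon> * t)) has_integral gauss_const *\<^sub>R gauss_smooth \<epsilon> f 0) UNIV"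
proof -
  have "((\<lambda>t. gauss_kernel \<epsilon> 0 (\<epsilon> * t + 0) *\<^sub>C f (\<epsilon> * t + 0)) has_integral
      (1 / \<epsilon>) *\<^sub>R integral UNIV (\<lambda>t. gauss_kernel \<epsilon> 0 t *\<^sub>C f t)) UNIV"
    by (rule has_integral_affinity_UNIV[OF integrable_integral[OF gauss_smooth_integrable[OF f]] eps])
  moreover have "gauss_kernel \<epsilon> 0 (\<epsilon> * t) = of_real (exp (- (t\<^sup>2)))" for t
    using eps by (simp add: gauss_kernel_def exp_of_real[symmetric])
  ultimately show ?thesis using gauss_const_pos eps
    by (simp add: gauss_smooth_def scaleC_of_real)
qed

end

lemma gauss_smooth_tendsto:
  fixes f :: "real \<Rightarrow> 'a::{complex_normed_vector,banach}"
  assumes f: "continuous_on UNIV f" "\<And>t. norm (f t) \<le> C"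
  shows "(\<lambda>n. gauss_smooth (inverse (real (Suc n))) f 0) \<longlonglongrightarrow> f 0"
proof -
  define \<epsilon> where "\<epsilon> n = inverse (real (Suc n))" for n
  have eps: "\<epsilon> n > 0" for n by (simp add: \<epsilon>_def)
  have C0: "C \<ge> 0" using f(2)[of 0] norm_ge_zero order_trans by blast
  let ?g = "\<lambda>n t. exp (- (t\<^sup>2)) * norm (f (\<epsilon> n * t) - f 0)"
  have cont: "continuous_on UNIV (\<lambda>t. f (\<epsilon> n * t))" for n
    by (rule continuous_on_compose_UNIV[OF f(1)]) (intro continuous_intros)
  have gb: "?g n t \<le> (exp 1 * (2 * C)) * exp (- \<bar>t\<bar>)" for n t
  proof -
    have "norm (f (\<epsilon> n * t) - f 0) \<le> 2 * C"
      using norm_triangle_ineq4[of "f (\<epsilon> n * t)" "f 0"] f(2)[of "\<epsilon> n * t"] f(2)[of 0] by linarith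
    then have "?g n t \<le> (exp 1 * exp (- \<bar>t\<bar>)) * (2 * C)"
      using exp_minus_square_le[of t] by (intro mult_mono) auto
    then show ?thesis by (simp add: mult_ac)
  qed
  have gi: "?g n integrable_on UNIV" for n
    by (rule integrable_on_UNIV_dominated(1)[OF _ order_trans[OF _ gb]])
      (auto intro!: continuous_intros cont)
  have "(\<lambda>n. integral UNIV (?g n)) \<longlonglongrightarrow> integral UNIV (\<lambda>t::real. 0 :: real)"
  proof (rule dominated_convergence(2)[OF gi])
    show "(\<lambda>t::real. (exp 1 * (2 * C)) * exp (- \<bar>t\<bar>)) integrable_on UNIV"
      by (rule integrable_on_mult_right[OF integrable_exp_minus_abs])
    show "norm (?g n t) \<le> (exp 1 * (2 * C)) * exp (- \<bar>t\<bar>)" for n t using gb[of t n] by simp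
    fix t :: real
    have "\<epsilon> \<longlonglongrightarrow> 0" unfolding \<epsilon>_def by (rule LIMSEQ_inverse_real_of_nat)
    then have "(\<lambda>n. \<epsilon> n * t) \<longlonglongrightarrow> 0 * t" by (intro tendsto_intros)
    then have "(\<lambda>n. f (\<epsilon> n * t)) \<longlonglongrightarrow> f (0 * t)"
      using f(1) by (intro continuous_on_tendsto_compose[of UNIV f]) auto
    then show "(\<lambda>n. ?g n t) \<longlonglongrightarrow> 0" by (auto intro!: tendsto_eq_intros)
  qed
  then have "(\<lambda>n. inverse gauss_const * integral UNIV (?g n)) \<longlonglongrightarrow> inverse gauss_const * 0"
    by (intro tendsto_intros) simp
  then have lim: "(\<lambda>n. inverse gauss_const * integral UNIV (?g n)) \<longlonglongrightarrow> 0" by simp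
  have est: "norm (gauss_smooth (\<epsilon> n) f 0 - f 0) \<le> inverse gauss_const * integral UNIV (?g n)" for n
  proof -
    have 1: "((\<lambda>t::real. exp (- (t\<^sup>2)) *\<^sub>R f 0) has_integral gauss_const *\<^sub>R f 0) UNIV"
      unfolding gauss_const_def
      by (rule has_integral_scaleR_left[OF integrable_integral[OF integrable_exp_minus_square]])
    have 2: "((\<lambda>t. exp (- (t\<^sup>2)) *\<^sub>R (f (\<epsilon> n * t) - f 0)) has_integral
        gauss_const *\<^sub>R (gauss_smooth (\<epsilon> n) f 0 - f 0)) UNIV"
      using has_integral_diff[OF gauss_smooth_rescale[OF eps f] 1] by (simp add: scaleR_diff_right)
    have "norm (integral UNIV (\<lambda>t. exp (- (t\<^sup>2)) *\<^sub>R (f (\<epsilon> n * t) - f 0))) \<le> integral UNIV (?g n)"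
      using 2 by (intro integral_norm_bound_integral gi) (auto simp: integrable_on_def)
    then have "gauss_const * norm (gauss_smooth (\<epsilon> n) f 0 - f 0) \<le> integral UNIV (?g n)"
      using integral_unique[OF 2] gauss_const_pos by simp
    then show ?thesis using gauss_const_pos by (simp add: field_simps)
  qed
  have "(\<lambda>n. gauss_smooth (\<epsilon> n) f 0 - f 0) \<longlonglongrightarrow> 0"
    by (rule Lim_null_comparison[OF always_eventually lim]) (use est in simp)
  then show ?thesis unfolding \<epsilon>_def by (simp add: LIM_zero_iff)
qed

section \<open>Entire analytic elements\<close>

lemma entire_const: "entire (\<lambda>z. a)"
  by (auto simp: entire_def intro!: exI[of _ 0])

lemma entire_bounded_clinear:
  assumes "entire F" "clinear L" "bounded_linear L"
  shows "entire (\<lambda>z. L (F z))"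
  unfolding entire_def
proof
  fix z
  obtain D where "(F has_derivative (\<lambda>h. h *\<^sub>C D)) (at z)" using assms(1) by (auto simp: entire_def)
  then have "((\<lambda>z. L (F z)) has_derivative (\<lambda>h. L (h *\<^sub>C D))) (at z)"
    by (rule bounded_linear.has_derivative[OF assms(3)])
  then show "\<exists>D. ((\<lambda>z. L (F z)) has_derivative (\<lambda>h. h *\<^sub>C D)) (at z)"
    by (auto simp: clinear_scaleC[OF assms(2)])
qed

lemma entire_add:
  assumes "entire F" "entire G"
  shows "entire (\<lambda>z. F z + G z)"
  unfolding entire_def
proof
  fix z
  obtain D E where "(F has_derivative (\<lambda>h. h *\<^sub>C D)) (at z)" "(G has_derivative (\<lambda>h. h *\<^sub>C E)) (at z)"
    using assms unfolding entire_def by meson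
  then have "((\<lambda>z. F z + G z) has_derivative (\<lambda>h. h *\<^sub>C (D + E))) (at z)"
    unfolding scaleC_add_right by (rule has_derivative_add)
  then show "\<exists>D. ((\<lambda>z. F z + G z) has_derivative (\<lambda>h. h *\<^sub>C D)) (at z)" by blast
qed

lemma entire_scaleC: "entire F \<Longrightarrow> entire (\<lambda>z. c *\<^sub>C F z)"
  by (rule entire_bounded_clinear)
    (auto simp: clinear_def scaleC_add_right scaleC_scaleC mult.commute
      intro: bounded_bilinear.bounded_linear_right[OF bounded_bilinear_scaleC])

lemma entire_mult:
  fixes F G :: "complex \<Rightarrow> 'a::cstar_algebra"
  assumes "entire F" "entire G"
  shows "entire (\<lambda>z. F z * G z)"
  unfolding entire_def
proof
  fix z
  obtain D E where "(F has_derivative (\<lambda>h. h *\<^sub>C D)) (at z)" "(G has_derivative (\<lambda>h. h *\<^sub>C E)) (at z)"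
    using assms unfolding entire_def by meson
  from has_derivative_mult[OF this]
  have "((\<lambda>z. F z * G z) has_derivative (\<lambda>h. h *\<^sub>C (F z * E + D * G z))) (at z)"
    by (simp add: mult_scaleC_left mult_scaleC_right scaleC_add_right)
  then show "\<exists>D. ((\<lambda>z. F z * G z) has_derivative (\<lambda>h. h *\<^sub>C D)) (at z)" by blast
qed

lemma entire_star_cnj:
  fixes F :: "complex \<Rightarrow> 'a::cstar_algebra"
  assumes "entire F"
  shows "entire (\<lambda>z. star (F (cnj z)))"
  unfolding entire_def
proof
  fix z
  obtain D where D: "(F has_derivative (\<lambda>h. h *\<^sub>C D)) (at (cnj z))"
    using assms unfolding entire_def by meson
  have "(cnj has_derivative cnj) (at z)"
    by (rule bounded_linear_imp_has_derivative[OF bounded_linear_cnj])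
  from has_derivative_compose[OF this D]
  have "((\<lambda>z. star (F (cnj z))) has_derivative (\<lambda>h. star (cnj h *\<^sub>C D))) (at z)"
    by (rule bounded_linear.has_derivative[OF bounded_linear_star])
  then show "\<exists>D. ((\<lambda>z. star (F (cnj z))) has_derivative (\<lambda>h. h *\<^sub>C D)) (at z)"
    by (auto simp: star_scaleC)
qed

lemma entire_shift:
  assumes "entire F"
  shows "entire (\<lambda>z. F (z + w))"
  unfolding entire_def
proof
  fix z
  obtain D where D: "(F has_derivative (\<lambda>h. h *\<^sub>C D)) (at (z + w))"
    using assms unfolding entire_def by meson
  have "((\<lambda>z. z + w) has_derivative (\<lambda>h. h)) (at z)" by (auto intro!: derivative_eq_intros)
  from has_derivative_compose[OF this D]
  show "\<exists>D. ((\<lambda>z. F (z + w)) has_derivative (\<lambda>h. h *\<^sub>C D)) (at z)" by blast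
qed

lemma entire_continuous_on: "entire F \<Longrightarrow> continuous_on UNIV F"
  unfolding entire_def continuous_on_eq_continuous_at[OF open_UNIV]
  by (metis has_derivative_continuous)

section \<open>The complex flow on entire analytic elements\<close>

locale graded_flow =
  fixes \<alpha> :: "real \<Rightarrow> 'a::cstar_algebra \<Rightarrow> 'a" and \<gamma> :: "'a \<Rightarrow> 'a"
  assumes graded: "graded_cstar_system \<alpha> \<gamma>"
begin

abbreviation flow where "flow \<equiv> complex_flow \<alpha>"
abbreviation analytic where "analytic \<equiv> analytic_elements \<alpha>"

lemma automorphism: "star_automorphism (\<alpha> t)" "star_automorphism \<gamma>"
  and \<alpha>_zero: "\<alpha> 0 a = a"
  and \<alpha>_add: "\<alpha> (s + t) a = \<alpha> s (\<alpha> t a)"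
  and continuous_\<alpha>: "continuous_on UNIV (\<lambda>t. \<alpha> t a)"
  and \<gamma>_\<gamma>: "\<gamma> (\<gamma> a) = a"
  using graded by (auto simp: graded_cstar_system_def fun_eq_iff)

lemma \<alpha>_clinear: "clinear (\<alpha> t)"
  and \<alpha>_mult: "\<alpha> t (a * b) = \<alpha> t a * \<alpha> t b"
  and \<alpha>_star: "\<alpha> t (star a) = star (\<alpha> t a)"
  and \<gamma>_clinear: "clinear \<gamma>"
  and \<gamma>_mult: "\<gamma> (a * b) = \<gamma> a * \<gamma> b"
  and \<gamma>_star: "\<gamma> (star a) = star (\<gamma> a)"
  using automorphism by (auto simp: star_automorphism_def)

lemma norm_\<alpha>_le: "norm (\<alpha> t a) \<le> norm a"
  by (rule star_automorphism_norm_le[OF automorphism(1)])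

lemma \<gamma>_one: "\<gamma> 1 = 1"
  by (rule star_automorphism_one[OF automorphism(2)])

lemma bounded_linear_\<alpha>: "bounded_linear (\<alpha> t)"
  by (rule clinear_bounded_linear[OF \<alpha>_clinear, of _ 1]) (use norm_\<alpha>_le in simp)

lemma flow_entire: "a \<in> analytic \<Longrightarrow> entire (\<lambda>z. flow z a)"
  and flow_of_real: "a \<in> analytic \<Longrightarrow> flow (of_real t) a = \<alpha> t a"
  using entire_extension_complex_flow[of a \<alpha>] by (auto simp: entire_extension_def)

lemma flow_zero: "a \<in> analytic \<Longrightarrow> flow 0 a = a"
  using flow_of_real[of a 0] by (simp add: \<alpha>_zero)

text \<open>The working principle for the algebra of the flow: by uniqueness, any entire function
  with the right values on the real axis is the flow.\<close>

lemma flowI: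
  assumes "entire F" "\<And>t. F (of_real t) = \<alpha> t a"
  shows "a \<in> analytic" "flow z a = F z"
proof -
  have "entire_extension \<alpha> a F" using assms by (simp add: entire_extension_def)
  then show "a \<in> analytic" "flow z a = F z" by (auto simp: analytic_elements_def complex_flow_eq)
qed

lemma analytic_add: "a \<in> analytic \<Longrightarrow> b \<in> analytic \<Longrightarrow> a + b \<in> analytic"
  and flow_add: "a \<in> analytic \<Longrightarrow> b \<in> analytic \<Longrightarrow> flow z (a + b) = flow z a + flow z b"
  using flowI[of "\<lambda>z. flow z a + flow z b" "a + b"]
  by (simp_all add: entire_add flow_entire flow_of_real clinear_add[OF \<alpha>_clinear])

lemma analytic_scaleC: "a \<in> analytic \<Longrightarrow> c *\<^sub>C a \<in> analytic"
  and flow_scaleC: "a \<in> analytic \<Longrightarrow> flow z (c *\<^sub>C a) = c *\<^sub>C flow z a"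
  using flowI[of "\<lambda>z. c *\<^sub>C flow z a" "c *\<^sub>C a"]
  by (simp_all add: entire_scaleC flow_entire flow_of_real clinear_scaleC[OF \<alpha>_clinear])

lemma analytic_diff: "a \<in> analytic \<Longrightarrow> b \<in> analytic \<Longrightarrow> a - b \<in> analytic"
  and flow_diff: "a \<in> analytic \<Longrightarrow> b \<in> analytic \<Longrightarrow> flow z (a - b) = flow z a - flow z b"
  using analytic_add[of a "(-1) *\<^sub>C b"] flow_add[of a "(-1) *\<^sub>C b"] analytic_scaleC[of b "-1"] flow_scaleC[of b _ "-1"]
  by auto

lemma analytic_mult: "a \<in> analytic \<Longrightarrow> b \<in> analytic \<Longrightarrow> a * b \<in> analytic"
  and flow_mult: "a \<in> analytic \<Longrightarrow> b \<in> analytic \<Longrightarrow> flow z (a * b) = flow z a * flow z b"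
  using flowI[of "\<lambda>z. flow z a * flow z b" "a * b"]
  by (simp_all add: entire_mult flow_entire flow_of_real \<alpha>_mult)

lemma analytic_star: "a \<in> analytic \<Longrightarrow> star a \<in> analytic"
  and flow_star: "a \<in> analytic \<Longrightarrow> flow z (star a) = star (flow (cnj z) a)"
  using flowI[of "\<lambda>z. star (flow (cnj z) a)" "star a"]
  by (simp_all add: entire_star_cnj[OF flow_entire] flow_of_real \<alpha>_star)

lemma analytic_one: "1 \<in> analytic" and flow_one: "flow z 1 = 1"
  using flowI[of "\<lambda>z. 1" 1] by (simp_all add: entire_const star_automorphism_one[OF automorphism(1)])

text \<open>The group law for a real first argument, by the identity theorem in \<open>w\<close>. It
  shows that \<open>z \<mapsto> flow (z + w) a\<close> extends the orbit of \<open>flow w a\<close>,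
  from which the full group law follows.\<close>

lemma flow_shift: "a \<in> analytic \<Longrightarrow> flow (of_real t + w) a = \<alpha> t (flow w a)"
proof -
  assume a: "a \<in> analytic"
  have "(\<lambda>w. flow (of_real t + w) a) = (\<lambda>w. \<alpha> t (flow w a))"
  proof (rule entire_real_unique)
    show "entire (\<lambda>w. flow (of_real t + w) a)"
      using entire_shift[OF flow_entire[OF a], of "of_real t"] by (simp add: add.commute)
    show "entire (\<lambda>w. \<alpha> t (flow w a))"
      by (rule entire_bounded_clinear[OF flow_entire[OF a] \<alpha>_clinear bounded_linear_\<alpha>])
    show "flow (of_real t + of_real s) a = \<alpha> t (flow (of_real s) a)" for s
      using flow_of_real[OF a, of "t + s"] by (simp add: flow_of_real[OF a] \<alpha>_add)
  qed
  then show ?thesis by (rule fun_cong)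
qed

lemma analytic_flow: "a \<in> analytic \<Longrightarrow> flow w a \<in> analytic"
  and flow_flow: "a \<in> analytic \<Longrightarrow> flow z (flow w a) = flow (z + w) a"
  using flowI[of "\<lambda>z. flow (z + w) a" "flow w a"]
  by (simp_all add: entire_shift[OF flow_entire] flow_shift)

lemma norm_flow_le: "a \<in> analytic \<Longrightarrow> norm (flow z a) \<le> norm (flow (\<i> * of_real (Im z)) a)"
  using flow_shift[of a "Re z" "\<i> * of_real (Im z)"] norm_\<alpha>_le by (simp flip: complex_eq)

text \<open>Liouville applies because a strip of the width of the period has bounded image.\<close>

lemma imaginary_periodic_invariant:
  fixes f :: "'a \<Rightarrow> complex"
  assumes f: "clinear f" "\<And>a. cmod (f a) \<le> norm a * C"
    and p: "p \<noteq> 0" "\<And>b. b \<in> analytic \<Longrightarrow> f (flow (\<i> * of_real p) b) = f b"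
    and a: "a \<in> analytic"
  shows "f (flow z a) = f a"
proof -
  have bl: "bounded_linear f" by (rule clinear_bounded_linear[OF f])
  have "f (flow z a) = f (flow 0 a)"
  proof (rule periodic_Liouville[where p = p and h = "\<lambda>z. f (flow z a)" and
        B = "\<lambda>s. norm (flow (\<i> * of_real s) a) * C"])
    show "(\<lambda>z. f (flow z a)) holomorphic_on UNIV"
      by (rule entire_functional[OF f(1) bl flow_entire[OF a]])
    show "f (flow (z + \<i> * of_real p) a) = f (flow z a)" for z
      using p(2)[OF analytic_flow[OF a, of z]] by (simp add: flow_flow a add.commute)
    show "p \<noteq> 0" by fact
    have C: "C \<ge> 0" using order_trans[OF norm_ge_zero f(2)[of 1]] by simp
    show "cmod (f (flow z a)) \<le> norm (flow (\<i> * of_real (Im z)) a) * C" for z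
      using mult_right_mono[OF norm_flow_le[OF a, of z] C] f(2)[of "flow z a"] by linarith
    show "continuous_on UNIV (\<lambda>s. norm (flow (\<i> * of_real s) a) * C)"
      by (intro continuous_intros continuous_on_compose_UNIV[OF entire_continuous_on[OF flow_entire[OF a]]])
  qed
  then show ?thesis by (simp add: flow_zero a)
qed

section \<open>Density of the entire analytic elements\<close>

definition smooth :: "real \<Rightarrow> 'a \<Rightarrow> 'a" where
  "smooth \<epsilon> a = gauss_smooth \<epsilon> (\<lambda>t. \<alpha> t a) 0"

lemma
  assumes "\<epsilon> > 0"
  shows analytic_smooth: "smooth \<epsilon> a \<in> analytic"
    and flow_smooth: "flow z (smooth \<epsilon> a) = gauss_smooth \<epsilon> (\<lambda>t. \<alpha> t a) z"
proof -
  \<comment> \<open>On the real axis the entire function \<open>gauss_smooth\<close> restricts to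
    the orbit of the smoothed element, as \<open>flowI\<close> requires.\<close>
  have real: "gauss_smooth \<epsilon> (\<lambda>t. \<alpha> t a) (of_real s) = \<alpha> s (smooth \<epsilon> a)" for s
  proof -
    have "\<alpha> s (smooth \<epsilon> a) = gauss_smooth \<epsilon> (\<lambda>t. \<alpha> s (\<alpha> t a)) 0"
      unfolding smooth_def
      by (rule gauss_smooth_linear[OF assms continuous_\<alpha> norm_\<alpha>_le \<alpha>_clinear bounded_linear_\<alpha>])
    also have "\<dots> = gauss_smooth \<epsilon> (\<lambda>t. \<alpha> (t + s) a) 0"
      by (simp add: add.commute[of _ s] \<alpha>_add)
    also have "\<dots> = gauss_smooth \<epsilon> (\<lambda>t. \<alpha> t a) (0 + of_real s)"
      by (rule gauss_smooth_shift[OF assms continuous_\<alpha> norm_\<alpha>_le])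
    finally show ?thesis by simp
  qed
  have ent: "entire (gauss_smooth \<epsilon> (\<lambda>t. \<alpha> t a))"
    by (rule entire_gauss_smooth[OF assms continuous_\<alpha> norm_\<alpha>_le])
  show "smooth \<epsilon> a \<in> analytic" "flow z (smooth \<epsilon> a) = gauss_smooth \<epsilon> (\<lambda>t. \<alpha> t a) z"
    using flowI[OF ent real] by auto
qed

lemma smooth_tendsto: "(\<lambda>n. smooth (inverse (real (Suc n))) a) \<longlonglongrightarrow> a"
  using gauss_smooth_tendsto[OF continuous_\<alpha> norm_\<alpha>_le, of a] by (simp add: smooth_def \<alpha>_zero)

lemma analytic_approx:
  obtains b where "\<And>n::nat. b n \<in> analytic" "b \<longlonglongrightarrow> a"
  using smooth_tendsto[of a] analytic_smooth[of "inverse (real (Suc n))" a for n] by (metis inverse_positive_iff_positive of_nat_0_less_iff zero_less_Suc)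

end

section \<open>Uniqueness of the polar decomposition\<close>

text \<open>The adjoint of any graph is defined by linear conditions. A graph equal to its adjoint
  is therefore a linear subspace, without linearity being part of the definition.\<close>

lemma
  assumes P: "graph_adjoint P = P"
  shows graph_selfadjoint_iff: "(u, v) \<in> P \<longleftrightarrow> (\<forall>(x, y)\<in>P. cinner u y = cinner v x)"
    and graph_selfadjoint_add: "(u, v) \<in> P \<Longrightarrow> (u', v') \<in> P \<Longrightarrow> (u + u', v + v') \<in> P"
    and graph_selfadjoint_scaleC: "(u, v) \<in> P \<Longrightarrow> (c *\<^sub>C u, c *\<^sub>C v) \<in> P"
    and graph_selfadjoint_diff: "(u, v) \<in> P \<Longrightarrow> (u', v') \<in> P \<Longrightarrow> (u - u', v - v') \<in> P"
    and graph_selfadjoint_sym: "(u, v) \<in> P \<Longrightarrow> (x, y) \<in> P \<Longrightarrow> cinner u y = cinner v x"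
proof -
  have iff: "(u, v) \<in> P \<longleftrightarrow> (\<forall>(x, y)\<in>P. cinner u y = cinner v x)" for u v
  proof -
    have "(u, v) \<in> P \<longleftrightarrow> (u, v) \<in> graph_adjoint P" by (simp add: P)
    then show ?thesis by (simp add: graph_adjoint_def)
  qed
  show "(u, v) \<in> P \<longleftrightarrow> (\<forall>(x, y)\<in>P. cinner u y = cinner v x)" by (rule iff)
  have sym: "cinner u y = cinner v x" if "(u, v) \<in> P" "(x, y) \<in> P" for u v x y
    using iff[of u v] that by auto
  then show "(u, v) \<in> P \<Longrightarrow> (x, y) \<in> P \<Longrightarrow> cinner u y = cinner v x" .
  show "(u + u', v + v') \<in> P" "(u - u', v - v') \<in> P" if "(u, v) \<in> P" "(u', v') \<in> P"
    unfolding iff[of "u + u'"] iff[of "u - u'"]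
    using sym[OF that(1)] sym[OF that(2)] by (auto simp only: cinner_simps split_beta)
  show "(c *\<^sub>C u, c *\<^sub>C v) \<in> P" if "(u, v) \<in> P"
    unfolding iff[of "c *\<^sub>C u"] using sym[OF that] by (auto simp only: cinner_simps split_beta)
qed

lemma positive_selfadjoint_Re_nonneg:
  assumes "positive_selfadjoint P" "(x, y) \<in> P"
  shows "0 \<le> Re (cinner x y)" "Im (cinner x y) = 0"
  using assms by (auto simp: positive_selfadjoint_def complex_nonneg_Reals_iff)

text \<open>Cauchy-Schwarz for the positive form of \<open>P\<close>: a null vector of the form is
  orthogonal to the range of \<open>P\<close>, so its image is orthogonal to the dense domain. The
  quadratic in \<open>t\<close> proves this directly.\<close>

lemma positive_selfadjoint_kernel:
  assumes P: "positive_selfadjoint P" and yq: "(y, q) \<in> P" and zero: "Re (cinner y q) = 0"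
  shows "q = 0"
proof -
  have sa: "graph_adjoint P = P" and dense: "closure (Domain P) = UNIV"
    using P by (auto simp: positive_selfadjoint_def)
  have Re0: "Re (cinner q x) = 0" if xp: "(x, p) \<in> P" for x p
  proof (rule ccontr)
    assume ne: "Re (cinner q x) \<noteq> 0"
    have sym: "cinner y p = cinner q x" by (rule graph_selfadjoint_sym[OF sa yq xp])
    have flip: "Re (cinner x q) = Re (cinner q x)" by (subst cinner_commute) simp
    have quad: "0 \<le> 2 * t * Re (cinner q x) + t\<^sup>2 * Re (cinner x p)" for t
    proof -
      have "(y + of_real t *\<^sub>C x, q + of_real t *\<^sub>C p) \<in> P"
        by (intro graph_selfadjoint_add[OF sa] graph_selfadjoint_scaleC[OF sa] yq xp)
      from positive_selfadjoint_Re_nonneg(1)[OF P this] show ?thesis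
        by (simp add: cinner_simps zero sym flip algebra_simps power2_eq_square)
    qed
    define d where "d = Re (cinner q x)"
    define n where "n = Re (cinner x p) + 1"
    have n: "n > 0" using positive_selfadjoint_Re_nonneg(1)[OF P xp] by (simp add: n_def)
    have "0 \<le> 2 * (- d / n) * d + (- d / n)\<^sup>2 * Re (cinner x p)" unfolding d_def by (rule quad)
    also have "\<dots> \<le> 2 * (- d / n) * d + (- d / n)\<^sup>2 * n"
      by (intro add_left_mono mult_left_mono) (auto simp: n_def)
    also have "\<dots> = - (d\<^sup>2 / n)" using n by (simp add: power2_eq_square)
    also have "\<dots> < 0" using ne n by (simp add: d_def)
    finally show False by simp
  qed
  have "cinner q x = 0" if xp: "(x, p) \<in> P" for x p
    using Re0[OF xp] Re0[OF graph_selfadjoint_scaleC[OF sa xp, of \<i>]] by (simp add: cinner_simps complex_eq_iff)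
  then have "cinner q x = cinner 0 x" if "x \<in> Domain P" for x using that by auto
  moreover have "closure (id ` Domain P) = UNIV" using dense by simp
  ultimately show "q = 0" by (intro dense_cinner_ext[where e = id and I = "Domain P"]) auto
qed

text \<open>Riesz--Nagy: with \<open>T\<^sub>0 = T\<close> and \<open>T\<^sub>n\<^sub>+\<^sub>1 = T\<^sub>n - T\<^sub>n\<^sup>2\<close> one has \<open>T P = \<Sum> T\<^sub>k P T\<^sub>k\<close>. This replaces the
  square root of \<open>T\<close> in the usual proof that the product of commuting positive operators is positive.\<close>

lemma positive_commuting_contraction:
  fixes T :: "'h::chilbert_space \<Rightarrow> 'h" and P :: "('h \<times> 'h) set"
  assumes diff: "\<And>x y. T (x - y) = T x - T y"
    and sym: "\<And>x y. cinner (T x) y = cinner x (T y)"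
    and T: "\<And>x. 0 \<le> Re (cinner x (T x))" "\<And>x. Re (cinner x (T x)) \<le> (norm x)\<^sup>2"
    and comm: "\<And>u v. (u, v) \<in> P \<Longrightarrow> (T u, T v) \<in> P"
    and P_diff: "\<And>u v u' v'. (u, v) \<in> P \<Longrightarrow> (u', v') \<in> P \<Longrightarrow> (u - u', v - v') \<in> P"
    and P_pos: "\<And>u v. (u, v) \<in> P \<Longrightarrow> 0 \<le> Re (cinner u v)"
    and uv: "(u, v) \<in> P"
  shows "0 \<le> Re (cinner (T u) v)"
proof -
  define S where "S n = ((\<lambda>S x. S x - S (S x)) ^^ n) T" for n
  have S0: "S 0 = T" and Suc: "S (Suc n) x = S n x - S n (S n x)" for n x by (simp_all add: S_def)
  have Sdiff: "S n (x - y) = S n x - S n y" for n x y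
    by (induction n arbitrary: x y) (simp_all add: S0 diff Suc)
  have Ssym: "cinner (S n x) y = cinner x (S n y)" for n x y
    by (induction n arbitrary: x y) (simp_all add: S0 sym Suc cinner_simps)
  have Scomm: "(S n u, S n v) \<in> P" if "(u, v) \<in> P" for n u v
    using that by (induction n arbitrary: u v) (simp_all add: S0 comm Suc P_diff)
  have step: "Re (cinner x (S (Suc n) x)) = Re (cinner x (S n x)) - (norm (S n x))\<^sup>2" for n x
    by (simp add: Suc cinner_simps power2_norm_eq_cinner Ssym)
  have Spos: "0 \<le> Re (cinner x (S n x)) \<and> Re (cinner x (S n x)) \<le> (norm x)\<^sup>2" for n x
  proof (induction n arbitrary: x)
    case (Suc n)
    \<comment> \<open>The identity \<open>S - S^2 = S (1 - S) S + (1 - S) S (1 - S)\<close>, in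
      which both summands are positive.\<close>
    have "cinner x (S (Suc n) x) =
        cinner (S n x) (S n x) - cinner (S n x) (S n (S n x)) +
        cinner (x - S n x) (S n (x - S n x))"
      by (simp add: Suc(1) \<open>\<And>n x. S (Suc n) x = S n x - S n (S n x)\<close> Sdiff cinner_simps Ssym)
    moreover have "Re (cinner (S n x) (S n (S n x))) \<le> Re (cinner (S n x) (S n x))"
      using Suc.IH[of "S n x"] by (simp add: power2_norm_eq_cinner)
    ultimately have "0 \<le> Re (cinner x (S (Suc n) x))" using Suc.IH[of "x - S n x"] by simp
    moreover have "Re (cinner x (S (Suc n) x)) \<le> (norm x)\<^sup>2"
      using step[of x n] Suc.IH[of x] zero_le_power2[of "norm (S n x)"] by linarith
    ultimately show ?case by simp
  qed (simp add: S0 T)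
  \<comment> \<open>Each step lowers this sequence by the squared norm of \<open>S n u\<close>;
    being bounded below, it forces \<open>S n u\<close> to tend to 0.\<close>
  have "decseq (\<lambda>n. Re (cinner u (S n u)))"
    by (rule decseq_SucI) (simp add: step)
  then obtain L where L: "(\<lambda>n. Re (cinner u (S n u))) \<longlonglongrightarrow> L"
    using decseq_convergent[of "\<lambda>n. Re (cinner u (S n u))" 0] Spos by blast
  have "(\<lambda>n. Re (cinner u (S n u)) - Re (cinner u (S (Suc n) u))) \<longlonglongrightarrow> L - L"
    by (intro tendsto_diff L LIMSEQ_Suc[OF L])
  then have "(\<lambda>n. (norm (S n u))\<^sup>2) \<longlonglongrightarrow> 0" by (simp add: step)
  then have "(\<lambda>n. sqrt ((norm (S n u))\<^sup>2)) \<longlonglongrightarrow> sqrt 0" by (rule tendsto_real_sqrt)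
  then have "(\<lambda>n. S n u) \<longlonglongrightarrow> 0" by (simp add: tendsto_norm_zero_iff)
  then have "(\<lambda>n. Re (cinner (S n u) v)) \<longlonglongrightarrow> Re (cinner 0 v)" by (intro tendsto_intros)
  then have lim: "(\<lambda>n. Re (cinner (S n u) v)) \<longlonglongrightarrow> 0" by simp
  \<comment> \<open>The decrements are the terms \<open>S P S\<close> of the series, nonnegative by
    positivity of \<open>P\<close>. With limit 0, the first member of the sequence is
    nonnegative.\<close>
  have "decseq (\<lambda>n. Re (cinner (S n u) v))"
  proof (rule decseq_SucI)
    fix n
    have "0 \<le> Re (cinner (S n u) (S n v))" by (rule P_pos[OF Scomm[OF uv]])
    then show "Re (cinner (S (Suc n) u) v) \<le> Re (cinner (S n u) v)"
      by (simp add: Suc cinner_simps Ssym)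
  qed
  from decseq_ge[OF this lim, of 0] show ?thesis by (simp add: S0)
qed

lemma relcomp_range: "(x, z) \<in> P O range (\<lambda>u. (u, f u)) \<longleftrightarrow> (\<exists>u. (x, u) \<in> P \<and> z = f u)"
  by auto

text \<open>The unitary \<open>W = J J'\<close> satisfies \<open>P = W P'\<close>, and
  self-adjointness of \<open>P\<close> and \<open>P'\<close> turns this into
  \<open>W P W = P\<close>. Hence \<open>W - W^(-1)\<close> anticommutes with the positive injective
  \<open>P\<close>, which is possible only if it vanishes on the domain. Then \<open>W\<close> is an
  involution there, and positivity of \<open>P'\<close> excludes the eigenvalue -1.\<close>

lemma polar_decomposition_unique:
  fixes P P' :: "('h::chilbert_space \<times> 'h) set"
  assumes P: "positive_selfadjoint P" and P': "positive_selfadjoint P'"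
    and J: "antiunitary J" "\<And>x. J (J x) = x" and J': "antiunitary J'"
    and eq: "P O range (\<lambda>u. (u, J u)) = P' O range (\<lambda>u. (u, J' u))"
    and inj: "\<And>y. (y, 0) \<in> P \<Longrightarrow> y = 0"
  shows "J' = J"
proof -
  have sa: "graph_adjoint P = P" and sa': "graph_adjoint P' = P'" and dense: "closure (Domain P) = UNIV"
    using P P' by (auto simp: positive_selfadjoint_def)
  define W where "W u = J (J' u)" for u
  have W_cinner: "cinner (W u) (W v) = cinner u v" for u v
    using J J' by (simp add: W_def antiunitary_def)
  have W_diff: "W (u - v) = W u - W v" for u v
    by (simp add: W_def antiunitary_diff J J')
  have W_add: "W (u + v) = W u + W v" for u v
    using J(1) J' by (simp add: W_def antiunitary_def)
  have "surj W"
    unfolding surj_def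
  proof
    fix y
    obtain x where "J y = J' x" using J' by (metis antiunitary_def surjE)
    then have "J (J y) = W x" by (simp add: W_def)
    then have "y = W x" by (simp only: J(2))
    then show "\<exists>x. y = W x" ..
  qed
  then obtain V where WV: "W (V u) = u" for u by (metis surjE)
  have W_inj: "u = v" if "W u = W v" for u v
  proof -
    have "cinner (u - v) (u - v) = 0" using W_cinner[of "u - v" "u - v"] that by (simp add: W_diff)
    then show ?thesis by (simp add: cinner_self)
  qed
  have VW: "V (W u) = u" for u by (rule W_inj) (simp add: WV)
  have V_diff: "V (u - v) = V u - V v" and V_add: "V (u + v) = V u + V v" for u v
    by (rule W_inj, simp add: W_diff W_add WV)+
  have adj: "cinner (W u) v = cinner u (V v)" "cinner (V u) v = cinner u (W v)" for u v
    using W_cinner[of u "V v"] W_cinner[of "V u" v] by (simp_all add: WV)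
  have P'_iff: "(x, u) \<in> P' \<longleftrightarrow> (x, W u) \<in> P" for x u
  proof -
    have "(x, u) \<in> P' \<longleftrightarrow> (x, J' u) \<in> P' O range (\<lambda>u. (u, J' u))"
      unfolding relcomp_range using antiunitary_inj[OF J'] by blast
    also have "\<dots> \<longleftrightarrow> (x, J' u) \<in> P O range (\<lambda>u. (u, J u))" by (simp add: eq)
    also have "\<dots> \<longleftrightarrow> (x, W u) \<in> P"
      unfolding W_def relcomp_range
    proof
      assume "\<exists>p. (x, p) \<in> P \<and> J' u = J p"
      then obtain p where p: "(x, p) \<in> P" "J' u = J p" by blast
      then show "(x, J (J' u)) \<in> P" by (simp add: J(2))
    next
      assume "(x, J (J' u)) \<in> P"
      then show "\<exists>p. (x, p) \<in> P \<and> J' u = J p" by (intro exI[of _ "J (J' u)"]) (simp add: J(2))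
    qed
    finally show ?thesis .
  qed
  \<comment> \<open>This is \<open>W P W = P\<close>, written for graphs to keep track of
    domains.\<close>
  have star: "(u, W v) \<in> P \<longleftrightarrow> (W u, v) \<in> P" for u v
  proof -
    have "(u, W v) \<in> P \<longleftrightarrow> (\<forall>(x, y)\<in>P'. cinner u y = cinner v x)"
      using graph_selfadjoint_iff[OF sa', of u v] P'_iff by simp
    also have "\<dots> \<longleftrightarrow> (\<forall>(x, p)\<in>P. cinner (W u) p = cinner v x)"
    proof (intro iffI ballI; clarify)
      fix x p assume "\<forall>(x, y)\<in>P'. cinner u y = cinner v x" "(x, p) \<in> P"
      then show "cinner (W u) p = cinner v x" using P'_iff[of x "V p"] by (auto simp: WV adj)
    next
      fix x y assume *: "\<forall>(x, p)\<in>P. cinner (W u) p = cinner v x" "(x, y) \<in> P'"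
      then have "cinner (W u) (W y) = cinner v x" using P'_iff[of x y] by blast
      then show "cinner u y = cinner v x" by (simp add: W_cinner)
    qed
    also have "\<dots> \<longleftrightarrow> (W u, v) \<in> P" using graph_selfadjoint_iff[OF sa, of "W u" v] by simp
    finally show ?thesis .
  qed
  have W_P: "(W u, V v) \<in> P" and V_P: "(V u, W v) \<in> P" if "(u, v) \<in> P" for u v
    using star[of u "V v"] star[of "V u" v] that by (simp_all add: WV)
  have W_pos: "0 \<le> Re (cinner (W x) p)" if "(x, p) \<in> P" for x p
    using positive_selfadjoint_Re_nonneg(1)[OF P', of x "V p"] P'_iff[of x "V p"] that by (simp add: WV adj)
  \<comment> \<open>As \<open>P W = V P\<close> and \<open>P V = W P\<close>, the skew-adjoint
    \<open>K\<close> anticommutes with \<open>P\<close>.\<close>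
  define K where "K u = W u - V u" for u
  have K_diff: "K (u - v) = K u - K v" for u v by (simp add: K_def W_diff V_diff)
  have K_adj: "cinner (K u) v = - cinner u (K v)" for u v by (simp add: K_def cinner_simps adj)
  have K_P: "(K u, - K v) \<in> P" if "(u, v) \<in> P" for u v
    using graph_selfadjoint_diff[OF sa W_P[OF that] V_P[OF that]] by (simp add: K_def)
  have K_minus: "K (- u) = - K u" for u using K_diff[of 0 u] K_diff[of 0 0] by simp
  \<comment> \<open>\<open>K\<close> has norm at most 2 and \<open>K^2\<close> is negative and
    commutes with \<open>P\<close>; the factor \<open>- 1 / 4\<close> gives a positive
    contraction.\<close>
  define T where "T u = (-1/4) *\<^sub>R K (K u)" for u
  have T_cinner: "cinner u (T v) = (1/4) * cinner (K u) (K v)" for u v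
    by (simp add: T_def cinner_simps K_adj scaleR_conv_of_real)
  have K_zero: "K v = 0" "K u = 0" if uv: "(u, v) \<in> P" for u v
  proof -
    have KK: "(K u, - K v) \<in> P" by (rule K_P[OF uv])
    have "0 \<le> Re (cinner (T u) v)"
    proof (rule positive_commuting_contraction[where P = P and T = T and u = u and v = v])
      show "T (x - y) = T x - T y" for x y by (simp add: T_def K_diff scaleR_diff_right)
      show "cinner (T x) y = cinner x (T y)" for x y
        by (simp add: T_cinner) (simp add: T_def cinner_simps K_adj scaleR_conv_of_real)
      show "0 \<le> Re (cinner x (T x))" for x by (simp add: T_cinner cinner_nonneg)
      show "Re (cinner x (T x)) \<le> (norm x)\<^sup>2" for x
      proof -
        have nW: "norm (W x) = norm x" by (simp add: norm_eq_sqrt_cinner W_cinner)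
        have "norm (V x) = norm x" using W_cinner[of "V x" "V x"] by (simp add: WV norm_eq_sqrt_cinner)
        with nW have "norm (K x) \<le> 2 * norm x" using norm_triangle_ineq4[of "W x" "V x"] by (simp add: K_def)
        then have "(norm (K x))\<^sup>2 \<le> (2 * norm x)\<^sup>2" by (rule power_mono) simp
        then show ?thesis by (simp add: T_cinner power2_norm_eq_cinner power_mult_distrib)
      qed
      show "(T u, T v) \<in> P" if "(u, v) \<in> P" for u v
        using graph_selfadjoint_scaleC[OF sa K_P[OF K_P[OF that]], of "-1/4"]
        by (simp add: T_def K_minus scaleC_conv_of_real)
      show "(u - u', v - v') \<in> P" if "(u, v) \<in> P" "(u', v') \<in> P" for u v u' v'
        by (rule graph_selfadjoint_diff[OF sa that])
      show "0 \<le> Re (cinner u v)" if "(u, v) \<in> P" for u v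
        by (rule positive_selfadjoint_Re_nonneg(1)[OF P that])
    qed (rule uv)
    moreover have "cinner (T u) v = (1/4) * cinner (K u) (K v)"
      by (simp add: T_def cinner_simps K_adj scaleR_conv_of_real)
    \<comment> \<open>One sign comes from the commuting positive operators \<open>T\<close> and
      \<open>P\<close>, the opposite sign from positivity of \<open>P\<close> at the pair
      \<open>(K u, - K v)\<close>.\<close>
    ultimately have "0 \<le> Re (cinner (K u) (K v))" by simp
    moreover have "0 \<le> - Re (cinner (K u) (K v))"
      using positive_selfadjoint_Re_nonneg(1)[OF P KK] by simp
    ultimately have "Re (cinner (K u) (- K v)) = 0" by simp
    from positive_selfadjoint_kernel[OF P KK this] show "K v = 0" by simp
    then show "K u = 0" using KK by (simp add: inj)
  qed
  have W_id: "W u = u" if uv: "(u, v) \<in> P" for u v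
  proof -
    have V_eq: "V u = W u" "V v = W v" using K_zero[OF uv] by (simp_all add: K_def)
    have "(W u, W v) \<in> P" using W_P[OF uv] V_eq by simp
    then have P1: "(u - W u, v - W v) \<in> P" by (rule graph_selfadjoint_diff[OF sa uv])
    \<comment> \<open>On \<open>u - W u\<close> the involution acts as -1, so that positivity of
      \<open>P' = W^(-1) P\<close> and of \<open>P\<close> contradict each other unless this vector
      is 0.\<close>
    have "W (u - W u) = - (u - W u)" using VW[of u] WV[of u] V_eq by (simp add: W_diff)
    then have "cinner (W (u - W u)) (v - W v) = - cinner (u - W u) (v - W v)"
      by (simp only: cinner_minus_left)
    then have "0 \<le> - Re (cinner (u - W u) (v - W v))" using W_pos[OF P1] by simp
    with positive_selfadjoint_Re_nonneg(1)[OF P P1] have "Re (cinner (u - W u) (v - W v)) = 0" by simp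
    from positive_selfadjoint_kernel[OF P P1 this] have "u - W u = 0" using P1 by (intro inj) simp
    then show ?thesis by simp
  qed
  have "W x = x" for x
  proof (rule dense_induct[where e = id and I = "Domain P" and P = "\<lambda>x. W x = x"])
    show "closure (id ` Domain P) = UNIV" using dense by simp
    show "closed {x. W x = x}"
      unfolding W_def using J(1) J'
      by (intro closed_Collect_eq continuous_on_id
          continuous_on_compose_UNIV[OF antiunitary_continuous_on antiunitary_continuous_on])
  qed (use W_id in auto)
  then have "J (J (J' x)) = J x" for x by (simp add: W_def)
  then show ?thesis by (simp add: J(2) fun_eq_iff)
qed

section \<open>Modular theory of a KMS state\<close>

locale kms_gns = graded_flow \<alpha> \<gamma>
  for \<alpha> :: "real \<Rightarrow> 'a::cstar_algebra \<Rightarrow> 'a" and \<gamma> :: "'a \<Rightarrow> 'a" +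
  fixes \<beta> :: real and \<omega> :: "'a \<Rightarrow> complex" and \<pi> :: "'a \<Rightarrow> 'h::chilbert_space \<Rightarrow> 'h" and \<Omega> :: 'h
  assumes \<beta>_nonzero: "\<beta> \<noteq> 0"
    and invariant_KMS: "\<omega> \<in> invariant_KMS_states \<beta> \<alpha> \<gamma>"
    and GNS: "GNS_triple \<omega> \<pi> \<Omega>"
begin

definition vec :: "'a \<Rightarrow> 'h" where "vec a = \<pi> a \<Omega>"
definition half :: complex where "half = \<i> * of_real (\<beta> / 2)"
definition \<theta> :: "'a \<Rightarrow> 'a" where "\<theta> a = flow half a"

lemma cnj_half: "cnj half = - half"
  by (simp add: half_def)

lemma rep: "star_representation \<pi>"
  using GNS by (simp add: GNS_triple_def)

lemma \<pi>_bounded_clinear: "bounded_clinear (\<pi> a)"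
  and \<pi>_add: "\<pi> (a + b) v = \<pi> a v + \<pi> b v"
  and \<pi>_scaleC: "\<pi> (c *\<^sub>C a) v = c *\<^sub>C \<pi> a v"
  and \<pi>_mult: "\<pi> (a * b) v = \<pi> a (\<pi> b v)"
  and \<pi>_one: "\<pi> 1 v = v"
  and op_adjoint_\<pi>: "op_adjoint (\<pi> a) = \<pi> (star a)"
  using rep by (auto simp: star_representation_def)

lemma \<pi>_clinear: "clinear (\<lambda>a. \<pi> a v)"
  by (simp add: clinear_def \<pi>_add \<pi>_scaleC)

lemma norm_\<pi>_le: "norm (\<pi> a v) \<le> norm a * norm v"
  by (rule star_representation_norm_le[OF rep])

lemma \<pi>_bounded_linear: "bounded_linear (\<lambda>a. \<pi> a v)"
  by (rule clinear_bounded_linear[OF \<pi>_clinear norm_\<pi>_le])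

lemma \<pi>_star_left: "cinner (\<pi> (star a) u) v = cinner u (\<pi> a v)"
  by (rule star_representation_cinner[OF rep])

lemma \<pi>_star_right: "cinner u (\<pi> (star a) v) = cinner (\<pi> a u) v"
  using \<pi>_star_left[of "star a" u v] by (simp add: star_star)

lemma vec_clinear: "clinear vec" and vec_bounded_linear: "bounded_linear vec"
  unfolding vec_def[abs_def] by (rule \<pi>_clinear \<pi>_bounded_linear)+

lemma vec_mult: "vec (a * b) = \<pi> a (vec b)"
  by (simp add: vec_def \<pi>_mult)

lemma vec_one: "vec 1 = \<Omega>"
  by (simp add: vec_def \<pi>_one)

lemma \<omega>_eq: "\<omega> a = cinner \<Omega> (vec a)"
  using GNS by (simp add: GNS_triple_def vec_def)

lemma cinner_vec: "cinner (vec a) (vec b) = \<omega> (star a * b)"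
  by (simp add: \<omega>_eq vec_mult) (simp add: vec_def \<pi>_star_right)

lemma dense_vec: "closure (vec ` UNIV) = UNIV"
  using GNS by (simp add: GNS_triple_def vec_def[abs_def])

lemma state: "state \<omega>" and \<omega>_\<gamma>: "\<omega> (\<gamma> a) = \<omega> a"
  and KMS: "a \<in> analytic \<Longrightarrow> b \<in> analytic \<Longrightarrow> \<omega> (a * flow (\<i> * of_real \<beta>) b) = \<omega> (b * a)"
  using invariant_KMS by (auto simp: invariant_KMS_states_def KMS_state_def fun_eq_iff)

lemma \<omega>_clinear: "clinear \<omega>" and \<omega>_nonneg: "\<omega> (star a * a) \<in> \<real>\<^sub>\<ge>\<^sub>0" and \<omega>_one: "\<omega> 1 = 1"
  using state by (auto simp: state_def)

lemma norm_\<Omega>: "norm \<Omega> = 1"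
proof -
  have "cinner \<Omega> \<Omega> = 1" using \<omega>_eq[of 1] by (simp add: vec_one \<omega>_one)
  then show ?thesis by (simp add: norm_eq_sqrt_cinner)
qed

lemma norm_\<omega>_le: "cmod (\<omega> a) \<le> norm a * 1"
  using cinner_Cauchy_Schwarz[of \<Omega> "vec a"] norm_\<pi>_le[of a \<Omega>] by (simp add: \<omega>_eq norm_\<Omega> vec_def)

lemma \<omega>_bounded_linear: "bounded_linear \<omega>"
  by (rule clinear_bounded_linear[OF \<omega>_clinear norm_\<omega>_le])

lemma dense_analytic: "closure (vec ` analytic) = UNIV"
proof -
  have "vec a \<in> closure (vec ` analytic)" for a
  proof -
    obtain b where b: "\<And>n::nat. b n \<in> analytic" "b \<longlonglongrightarrow> a" by (rule analytic_approx[of a]) blast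
    then have "(\<lambda>n. vec (b n)) \<longlonglongrightarrow> vec a" by (intro bounded_linear.tendsto[OF vec_bounded_linear])
    then show ?thesis using b(1) unfolding closure_sequential by (intro exI[of _ "\<lambda>n. vec (b n)"]) auto
  qed
  then have "closure (vec ` UNIV) \<subseteq> closure (vec ` analytic)"
    by (intro closure_minimal) auto
  then show ?thesis using dense_vec by auto
qed

lemmas analytic_induct = dense_induct[OF dense_analytic]

text \<open>The KMS condition with \<open>a = 1\<close> supplies the imaginary period.\<close>

lemma \<omega>_flow: "a \<in> analytic \<Longrightarrow> \<omega> (flow z a) = \<omega> a"
proof (rule imaginary_periodic_invariant[OF \<omega>_clinear norm_\<omega>_le \<beta>_nonzero])
  show "\<omega> (flow (\<i> * of_real \<beta>) b) = \<omega> b" if "b \<in> analytic" for b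
    using KMS[OF analytic_one that] by simp
qed

lemma \<omega>_\<alpha>: "\<omega> (\<alpha> t a) = \<omega> a"
proof -
  obtain b where b: "\<And>n::nat. b n \<in> analytic" "b \<longlonglongrightarrow> a" by (rule analytic_approx[of a]) blast
  have "(\<lambda>n. \<omega> (\<alpha> t (b n))) \<longlonglongrightarrow> \<omega> (\<alpha> t a)"
    by (intro bounded_linear.tendsto[OF \<omega>_bounded_linear] bounded_linear.tendsto[OF bounded_linear_\<alpha>] b)
  moreover have "\<omega> (\<alpha> t (b n)) = \<omega> (b n)" for n
    using \<omega>_flow[OF b(1), of "of_real t" n] by (simp add: flow_of_real b(1))
  moreover have "(\<lambda>n. \<omega> (b n)) \<longlonglongrightarrow> \<omega> a"
    by (intro bounded_linear.tendsto[OF \<omega>_bounded_linear] b)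
  ultimately show ?thesis by (simp add: LIMSEQ_unique)
qed

section \<open>The flow at half the imaginary period\<close>

lemma analytic_\<theta>: "a \<in> analytic \<Longrightarrow> \<theta> a \<in> analytic"
  by (simp add: \<theta>_def analytic_flow)

lemma analytic_star_\<theta>: "a \<in> analytic \<Longrightarrow> star (\<theta> a) \<in> analytic"
  by (simp add: analytic_\<theta> analytic_star)

lemma \<theta>_mult: "a \<in> analytic \<Longrightarrow> b \<in> analytic \<Longrightarrow> \<theta> (a * b) = \<theta> a * \<theta> b"
  by (simp add: \<theta>_def flow_mult)

lemma \<theta>_star: "a \<in> analytic \<Longrightarrow> \<theta> (star a) = star (flow (- half) a)"
  by (simp add: \<theta>_def flow_star cnj_half)

lemma star_\<theta>: "a \<in> analytic \<Longrightarrow> star (\<theta> a) = flow (- half) (star a)"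
  by (simp add: \<theta>_def flow_star cnj_half)

text \<open>The star replaces \<open>half\<close> by \<open>- half\<close>, so the two shifts
  cancel. On the core this is the statement that \<open>J\<close> is an involution.\<close>

lemma \<theta>_star_\<theta>: "a \<in> analytic \<Longrightarrow> \<theta> (star (\<theta> a)) = star a"
  by (simp add: \<theta>_star analytic_\<theta>) (simp add: \<theta>_def flow_flow flow_zero)

lemma \<theta>_surj: "a \<in> analytic \<Longrightarrow> \<theta> (flow (- half) a) = a"
  by (simp add: \<theta>_def flow_flow flow_zero)

lemma \<omega>_flow_mult: "a \<in> analytic \<Longrightarrow> b \<in> analytic \<Longrightarrow> \<omega> (flow (- z) a * b) = \<omega> (a * flow z b)"
  using \<omega>_flow[of "flow (- z) a * b" z]
  by (simp add: analytic_mult analytic_flow flow_mult flow_flow flow_zero)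

lemma cinner_\<theta>_symmetric:
  assumes "a \<in> analytic" "b \<in> analytic"
  shows "cinner (vec (\<theta> a)) (vec b) = cinner (vec a) (vec (\<theta> b))"
  using \<omega>_flow_mult[of "star a" b half] assms
  by (simp add: cinner_vec star_\<theta> analytic_star) (simp add: \<theta>_def)

text \<open>Collecting both half shifts on one factor gives the full shift \<open>i \<beta>\<close>,
  and the KMS condition exchanges the factors. On the core this is the antiunitarity of
  \<open>J\<close>.\<close>

lemma cinner_\<theta>_star:
  assumes "a \<in> analytic" "b \<in> analytic"
  shows "cinner (vec (\<theta> (star a))) (vec (\<theta> (star b))) = cinner (vec b) (vec a)"
proof -
  have "cinner (vec (\<theta> (star a))) (vec (\<theta> (star b))) = cinner (vec (star a)) (vec (\<theta> (\<theta> (star b))))"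
    by (rule cinner_\<theta>_symmetric) (simp_all add: assms analytic_star analytic_\<theta>)
  also have "\<dots> = \<omega> (a * flow (\<i> * of_real \<beta>) (star b))"
    using assms by (simp add: cinner_vec star_star \<theta>_def flow_flow analytic_star half_def algebra_simps)
  also have "\<dots> = cinner (vec b) (vec a)" by (simp add: KMS assms analytic_star cinner_vec)
  finally show ?thesis .
qed

subsection \<open>The conjugation\<close>

text \<open>The core is dense, so a continuous extension is unique and the choice is no
  choice.\<close>

definition J :: "'h \<Rightarrow> 'h" where
  "J = (SOME f. continuous_on UNIV f \<and> (\<forall>a\<in>analytic. f (vec a) = vec (\<theta> (star a))))"

lemma J_continuous: "continuous_on UNIV J" and J_vec: "a \<in> analytic \<Longrightarrow> J (vec a) = vec (\<theta> (star a))"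
proof -
  have "norm (vec (\<theta> (star a)) - vec (\<theta> (star b))) \<le> 1 * norm (vec a - vec b)"
    if "a \<in> analytic" "b \<in> analytic" for a b
  proof -
    have "norm (vec (\<theta> (star (a - b)))) = norm (vec (a - b))"
      using cinner_\<theta>_star[of "a - b" "a - b"] that by (simp add: norm_eq_sqrt_cinner analytic_diff)
    then show ?thesis using that
      by (simp add: star_diff \<theta>_def flow_diff analytic_star clinear_diff[OF vec_clinear])
  qed
  from dense_extension[where k = "\<lambda>a. vec (\<theta> (star a))", OF dense_analytic this]
  obtain f where "continuous_on UNIV f" "\<And>a. a \<in> analytic \<Longrightarrow> f (vec a) = vec (\<theta> (star a))" by blast
  then have "\<exists>f. continuous_on UNIV f \<and> (\<forall>a\<in>analytic. f (vec a) = vec (\<theta> (star a)))" by blast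
  from someI_ex[OF this] show "continuous_on UNIV J" "a \<in> analytic \<Longrightarrow> J (vec a) = vec (\<theta> (star a))"
    by (auto simp: J_def)
qed

lemma J_continuous' [continuous_intros]: "continuous_on A g \<Longrightarrow> continuous_on A (\<lambda>x. J (g x))"
  by (rule continuous_on_compose2[OF J_continuous]) auto

lemma J_J: "J (J v) = v"
  by (rule analytic_induct[where P = "\<lambda>v. J (J v) = v"])
    (auto intro!: closed_Collect_eq continuous_intros simp: J_vec analytic_\<theta> analytic_star \<theta>_star_\<theta> star_star)

lemma J_cinner: "cinner (J v) (J w) = cinner w v"
proof (rule analytic_induct[where P = "\<lambda>v. cinner (J v) (J w) = cinner w v"])
  fix a assume a: "a \<in> analytic"
  show "cinner (J (vec a)) (J w) = cinner w (vec a)"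
    by (rule analytic_induct[where P = "\<lambda>w. cinner (J (vec a)) (J w) = cinner w (vec a)"])
      (auto intro!: closed_Collect_eq continuous_intros simp: J_vec a cinner_\<theta>_star)
qed (auto intro!: closed_Collect_eq continuous_intros)

lemma J_cinner_left: "cinner (J v) w = cinner (J w) v"
  using J_cinner[of v "J w"] by (simp add: J_J)

lemma J_cinner_right: "cinner v (J w) = cinner w (J v)"
  using J_cinner[of "J v" w] by (simp add: J_J)

text \<open>Antilinearity is read off from \<open>J_cinner_left\<close>: its right-hand side is
  linear in \<open>v\<close>, whereas \<open>J v\<close> stands in the conjugate-linear slot on the
  left.\<close>

lemma antiunitary_J: "antiunitary J"
  unfolding antiunitary_def
proof (intro conjI allI)
  show "J (v + w) = J v + J w" for v w
    by (rule cinner_ext_left) (simp add: J_cinner_left[of "v + w"] J_cinner_left[of v] J_cinner_left[of w] cinner_simps)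
  show "J (c *\<^sub>C v) = cnj c *\<^sub>C J v" for c v
    by (rule cinner_ext_left) (simp add: J_cinner_left[of "c *\<^sub>C v"] J_cinner_left[of v] cinner_simps)
  show "surj J" by (metis J_J surjI)
qed (simp add: J_cinner)

lemma J_\<Omega>: "J \<Omega> = \<Omega>"
  using J_vec[OF analytic_one] by (simp add: vec_one \<theta>_def flow_one)

lemma bounded_clinear_J: "bounded_clinear y \<Longrightarrow> bounded_clinear (\<lambda>v. J (y (J v)))"
  using antiunitary_J bounded_clinear_norm_le[of y]
  by (intro bounded_clinearI[of _ "onorm y"])
    (auto simp: antiunitary_def bounded_clinear_add bounded_clinear_scaleC,
      metis antiunitary_J antiunitary_norm)

definition opp :: "'a \<Rightarrow> 'h \<Rightarrow> 'h" where "opp b v = J (\<pi> b (J v))"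

lemma bounded_clinear_opp: "bounded_clinear (opp b)"
  unfolding opp_def[abs_def] by (rule bounded_clinear_J[OF \<pi>_bounded_clinear])

lemma opp_\<Omega>: "opp b \<Omega> = J (vec b)"
  by (simp add: opp_def J_\<Omega> vec_def)

lemma opp_cinner: "cinner (opp b u) v = cinner u (opp (star b) v)"
  unfolding opp_def by (simp add: J_cinner_left[of "\<pi> b (J u)"] J_cinner_right[of u] \<pi>_star_left)

text \<open>Conjugation by \<open>J\<close> turns left multiplication into right multiplication on
  the core.\<close>

lemma opp_vec:
  assumes "b \<in> analytic" "a \<in> analytic"
  shows "opp b (vec a) = vec (a * \<theta> (star b))"
proof -
  have "opp b (vec a) = J (vec (b * \<theta> (star a)))" using assms by (simp add: opp_def J_vec vec_mult)
  also have "\<dots> = vec (\<theta> (star (b * \<theta> (star a))))"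
    using assms by (intro J_vec analytic_mult analytic_\<theta> analytic_star)
  also have "\<theta> (star (b * \<theta> (star a))) = a * \<theta> (star b)"
    using assms by (simp add: star_mult \<theta>_mult analytic_star analytic_star_\<theta> \<theta>_star_\<theta> star_star)
  finally show ?thesis .
qed

lemma opp_continuous [continuous_intros]: "continuous_on A g \<Longrightarrow> continuous_on A (\<lambda>x. opp b (g x))"
  and \<pi>_continuous [continuous_intros]: "continuous_on A g \<Longrightarrow> continuous_on A (\<lambda>x. \<pi> a (g x))"
  by (rule continuous_on_compose2[OF bounded_clinear_continuous_on[of _ UNIV]],
      auto intro: bounded_clinear_opp \<pi>_bounded_clinear)+

text \<open>Left and right multiplications commute by associativity. This holds on the core for
  analytic \<open>a\<close> and \<open>b\<close>; approximation then removes analyticity first from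
  \<open>a\<close> and then from \<open>b\<close>.\<close>

lemma opp_commute: "opp b (\<pi> a v) = \<pi> a (opp b v)"
proof -
  have 1: "opp b (\<pi> a v) = \<pi> a (opp b v)" if ab: "a \<in> analytic" "b \<in> analytic" for a b v
  proof (rule analytic_induct[where P = "\<lambda>v. opp b (\<pi> a v) = \<pi> a (opp b v)"])
    fix c assume "c \<in> analytic"
    then show "opp b (\<pi> a (vec c)) = \<pi> a (opp b (vec c))"
      using ab by (simp add: opp_vec analytic_mult mult.assoc flip: vec_mult)
  qed (intro closed_Collect_eq continuous_intros)
  have 2: "opp b (\<pi> a v) = \<pi> a (opp b v)" if b: "b \<in> analytic" for a b v
  proof -
    obtain c where c: "\<And>n::nat. c n \<in> analytic" "c \<longlonglongrightarrow> a" by (rule analytic_approx[of a]) blast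
    have "(\<lambda>n. opp b (\<pi> (c n) v)) \<longlonglongrightarrow> opp b (\<pi> a v)"
      by (intro bounded_clinear_tendsto[OF bounded_clinear_opp] bounded_linear.tendsto[OF \<pi>_bounded_linear] c)
    moreover have "(\<lambda>n. \<pi> (c n) (opp b v)) \<longlonglongrightarrow> \<pi> a (opp b v)"
      by (intro bounded_linear.tendsto[OF \<pi>_bounded_linear] c)
    ultimately show ?thesis by (simp add: 1 c b LIMSEQ_unique)
  qed
  obtain c where c: "\<And>n::nat. c n \<in> analytic" "c \<longlonglongrightarrow> b" by (rule analytic_approx[of b]) blast
  have tendsto: "(\<lambda>n. opp (c n) w) \<longlonglongrightarrow> opp b w" for w
    unfolding opp_def
    by (intro continuous_on_tendsto_compose[OF J_continuous] bounded_linear.tendsto[OF \<pi>_bounded_linear] c) auto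
  have "(\<lambda>n. opp (c n) (\<pi> a v)) \<longlonglongrightarrow> opp b (\<pi> a v)" by (rule tendsto)
  moreover have "(\<lambda>n. \<pi> a (opp (c n) v)) \<longlonglongrightarrow> \<pi> a (opp b v)"
    by (intro bounded_clinear_tendsto[OF \<pi>_bounded_clinear] tendsto)
  ultimately show ?thesis by (simp add: 2 c LIMSEQ_unique)
qed

text \<open>\<open>J\<close> is a homeomorphism and carries the dense set of vectors
  \<open>vec b\<close> to this one. Cyclicity of \<open>\<Omega>\<close> for the operators
  \<open>opp b\<close> will make it separating for \<open>M\<close>.\<close>

lemma dense_opp: "closure ((\<lambda>b. opp b \<Omega>) ` UNIV) = UNIV"
proof -
  have "v \<in> closure ((\<lambda>b. opp b \<Omega>) ` UNIV)" for v
  proof -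
    have "J v \<in> closure (vec ` UNIV)" by (simp add: dense_vec)
    moreover have "J ` closure (vec ` UNIV) \<subseteq> closure (J ` vec ` UNIV)"
      by (rule continuous_image_closure_subset[OF J_continuous]) simp
    ultimately have "J (J v) \<in> closure (J ` vec ` UNIV)" by blast
    then show ?thesis by (simp add: J_J opp_\<Omega> image_image)
  qed
  then show ?thesis by auto
qed

subsection \<open>The modular operator\<close>

definition P :: "('h \<times> 'h) set" where "P = closure ((\<lambda>a. (vec a, vec (\<theta> a))) ` analytic)"

lemma closed_P: "closed P"
  by (simp add: P_def)

lemma P_core: "a \<in> analytic \<Longrightarrow> (vec a, vec (\<theta> a)) \<in> P"
  unfolding P_def by (rule closure_subset[THEN subsetD]) (rule imageI)

lemma P_induct:
  assumes "(x, y) \<in> P" "closed {z. Q (fst z) (snd z)}" "\<And>a. a \<in> analytic \<Longrightarrow> Q (vec a) (vec (\<theta> a))"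
  shows "Q x y"
proof -
  have "P \<subseteq> {z. Q (fst z) (snd z)}"
    unfolding P_def using assms(2,3) by (intro closure_minimal) auto
  then show ?thesis using assms(1) by auto
qed

lemma graph_adjoint_PI:
  assumes "\<And>a. a \<in> analytic \<Longrightarrow> cinner u (vec (\<theta> a)) = cinner v (vec a)"
  shows "(u, v) \<in> graph_adjoint P"
proof -
  have "cinner u y = cinner v x" if "(x, y) \<in> P" for x y
    using that by (rule P_induct) (auto intro!: closed_Collect_eq continuous_intros assms)
  then show ?thesis by (auto simp: graph_adjoint_def)
qed

lemma P_symmetric: "(x, y) \<in> P \<Longrightarrow> (x, y) \<in> graph_adjoint P"
proof (rule graph_adjoint_PI)
  fix b assume P: "(x, y) \<in> P" and b: "b \<in> analytic"
  from P show "cinner x (vec (\<theta> b)) = cinner y (vec b)"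
    by (rule P_induct) (auto intro!: closed_Collect_eq continuous_intros simp: cinner_\<theta>_symmetric b)
qed

section \<open>The unitary group implementing the flow, and self-adjointness of
  \<open>P\<close>\<close>

definition U :: "real \<Rightarrow> 'h \<Rightarrow> 'h" where
  "U t = (SOME f. continuous_on UNIV f \<and> (\<forall>a. f (vec a) = vec (\<alpha> t a)))"

lemma cinner_vec_\<alpha>: "cinner (vec (\<alpha> t a)) (vec (\<alpha> t b)) = cinner (vec a) (vec b)"
  by (simp add: cinner_vec \<omega>_\<alpha> flip: \<alpha>_star \<alpha>_mult)

lemma U_continuous: "continuous_on UNIV (U t)" and U_vec: "U t (vec a) = vec (\<alpha> t a)"
proof -
  have "norm (vec (\<alpha> t a) - vec (\<alpha> t b)) \<le> 1 * norm (vec a - vec b)" if "a \<in> UNIV" "b \<in> UNIV" for a b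
  proof -
    have "norm (vec (\<alpha> t (a - b))) = norm (vec (a - b))"
      using cinner_vec_\<alpha>[of t "a - b" "a - b"] by (simp add: norm_eq_sqrt_cinner)
    then show ?thesis by (simp add: clinear_diff[OF \<alpha>_clinear] clinear_diff[OF vec_clinear])
  qed
  from dense_extension[where k = "\<lambda>a. vec (\<alpha> t a)", OF dense_vec this]
  obtain f where "continuous_on UNIV f" "\<And>a. a \<in> UNIV \<Longrightarrow> f (vec a) = vec (\<alpha> t a)" by blast
  then have "\<exists>f. continuous_on UNIV f \<and> (\<forall>a. f (vec a) = vec (\<alpha> t a))" by blast
  from someI_ex[OF this] show "continuous_on UNIV (U t)" "U t (vec a) = vec (\<alpha> t a)"
    by (auto simp: U_def)
qed

lemma U_continuous' [continuous_intros]: "continuous_on A g \<Longrightarrow> continuous_on A (\<lambda>x. U t (g x))"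
  by (rule continuous_on_compose2[OF U_continuous]) auto

lemma U_cinner: "cinner (U t v) (vec (\<alpha> t b)) = cinner v (vec b)"
  by (rule dense_induct[OF dense_vec, where P = "\<lambda>v. cinner (U t v) (vec (\<alpha> t b)) = cinner v (vec b)"])
    (auto intro!: closed_Collect_eq continuous_intros simp: U_vec cinner_vec_\<alpha>)

lemma U_dist: "norm (U t v - U t w) = norm (v - w)"
proof (rule dense_induct[OF dense_vec, where P = "\<lambda>v. norm (U t v - U t w) = norm (v - w)"])
  fix a
  have 1: "norm (vec (\<alpha> t c)) = norm (vec c)" for c by (simp add: norm_eq_sqrt_cinner cinner_vec_\<alpha>)
  show "norm (U t (vec a) - U t w) = norm (vec a - w)"
  proof (rule dense_induct[OF dense_vec, where P = "\<lambda>w. norm (U t (vec a) - U t w) = norm (vec a - w)"])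
    show "norm (U t (vec a) - U t (vec b)) = norm (vec a - vec b)" for b
      using 1[of "a - b"] by (simp add: U_vec clinear_diff[OF \<alpha>_clinear] clinear_diff[OF vec_clinear])
  qed (intro closed_Collect_eq continuous_intros)
qed (intro closed_Collect_eq continuous_intros)

lemma norm_U: "norm (U t v) = norm v"
  using U_dist[of t v 0] U_vec[of t 0]
  by (simp add: clinear_zero[OF \<alpha>_clinear] clinear_zero[OF vec_clinear])

lemma continuous_on_vec_\<alpha>: "continuous_on UNIV (\<lambda>t. vec (\<alpha> t a))"
  by (rule bounded_linear.continuous_on[OF vec_bounded_linear continuous_\<alpha>])

text \<open>The maps \<open>U t\<close> are isometric, so orbits of approximating vectors converge
  uniformly in \<open>t\<close>; orbits of \<open>vec b\<close> are continuous because those of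
  \<open>\<alpha>\<close> are.\<close>

lemma U_strongly_continuous: "continuous_on UNIV (\<lambda>t. U t v)"
proof -
  obtain a where a: "(\<lambda>n::nat. vec (a n)) \<longlonglongrightarrow> v"
    using dense_sequence[OF dense_vec, of v] by blast
  have "uniform_limit UNIV (\<lambda>n t. U t (vec (a n))) (\<lambda>t. U t v) sequentially"
  proof (rule uniform_limitI)
    fix \<epsilon> :: real assume "\<epsilon> > 0"
    with a have "\<forall>\<^sub>F n in sequentially. dist (vec (a n)) v < \<epsilon>" by (rule tendstoD)
    then show "\<forall>\<^sub>F n in sequentially. \<forall>t\<in>UNIV. dist (U t (vec (a n))) (U t v) < \<epsilon>"
      by (simp add: dist_norm U_dist)
  qed
  moreover have "continuous_on UNIV (\<lambda>t. U t (vec b))" for b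
    unfolding U_vec by (rule continuous_on_vec_\<alpha>)
  ultimately show ?thesis by (intro uniform_limit_theorem[OF always_eventually]) auto
qed

text \<open>The flow permutes the core and commutes with \<open>\<theta>\<close>, so the unitaries
  map the adjoint into itself. Only the pairing with core vectors is recorded, which is what gets
  integrated later.\<close>

lemma P_adjoint_U:
  assumes uv: "(u, v) \<in> graph_adjoint P" and a: "a \<in> analytic"
  shows "cinner (U t u) (vec (\<theta> a)) = cinner (U t v) (vec a)"
proof -
  define b where "b = flow (of_real (- t)) a"
  have b: "b \<in> analytic" using a by (simp add: b_def analytic_flow)
  have a_eq: "a = \<alpha> t b" and "\<theta> a = \<alpha> t (\<theta> b)"
    using a by (simp_all add: b_def \<theta>_def flow_flow flow_zero analytic_flow flip: flow_of_real)
  moreover have "cinner u (vec (\<theta> b)) = cinner v (vec b)"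
    using uv P_core[OF b] by (auto simp: graph_adjoint_def)
  ultimately show ?thesis by (simp add: U_cinner)
qed

text \<open>For \<open>u = vec b\<close> the smoothed vector is
  \<open>vec (smooth \<epsilon> b)\<close>, a core vector. Both components depend continuously on
  \<open>u\<close>, and \<open>P\<close> is closed, so every \<open>u\<close> is smoothed into the
  domain of \<open>P\<close>.\<close>

lemma P_gauss_smooth:
  assumes eps: "\<epsilon> > 0"
  shows "(gauss_smooth \<epsilon> (\<lambda>t. U t u) 0, gauss_smooth \<epsilon> (\<lambda>t. U t u) half) \<in> P"
proof -
  obtain a where a: "(\<lambda>n::nat. vec (a n)) \<longlonglongrightarrow> u"
    using dense_sequence[OF dense_vec, of u] by blast
  have core: "gauss_smooth \<epsilon> (\<lambda>t. U t (vec b)) z = vec (flow z (smooth \<epsilon> b))" for b z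
    using gauss_smooth_linear[OF eps continuous_\<alpha> norm_\<alpha>_le vec_clinear vec_bounded_linear, of b z]
    by (simp add: U_vec flow_smooth eps)
  have lim: "(\<lambda>n. gauss_smooth \<epsilon> (\<lambda>t. U t (vec (a n))) z) \<longlonglongrightarrow> gauss_smooth \<epsilon> (\<lambda>t. U t u) z" for z
  proof -
    obtain L where L: "\<And>(f :: real \<Rightarrow> 'h) C. continuous_on UNIV f \<Longrightarrow> (\<And>t. norm (f t) \<le> C) \<Longrightarrow>
        norm (gauss_smooth \<epsilon> f z) \<le> L * C"
      using gauss_smooth_bound[OF eps, of z] by blast
    have "norm (gauss_smooth \<epsilon> (\<lambda>t. U t x) z - gauss_smooth \<epsilon> (\<lambda>t. U t y) z) \<le> L * norm (x - y)" for x y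
    proof -
      have "gauss_smooth \<epsilon> (\<lambda>t. U t x) z - gauss_smooth \<epsilon> (\<lambda>t. U t y) z = gauss_smooth \<epsilon> (\<lambda>t. U t x - U t y) z"
        using gauss_smooth_integrable[OF eps U_strongly_continuous order_eq_refl[OF norm_U], of z]
        by (simp add: gauss_smooth_def scaleC_diff_right integral_diff scaleR_diff_right)
      also have "norm \<dots> \<le> L * norm (x - y)"
        by (rule L) (auto intro!: continuous_intros U_strongly_continuous simp: U_dist)
      finally show ?thesis .
    qed
    then have le: "\<forall>\<^sub>F n in sequentially.
        norm (gauss_smooth \<epsilon> (\<lambda>t. U t (vec (a n))) z - gauss_smooth \<epsilon> (\<lambda>t. U t u) z) \<le> L * norm (vec (a n) - u)"
      by simp
    have "(\<lambda>n. L * norm (vec (a n) - u)) \<longlonglongrightarrow> L * norm (u - u)"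
      by (intro tendsto_intros a)
    then have "(\<lambda>n. L * norm (vec (a n) - u)) \<longlonglongrightarrow> 0" by simp
    with le have "(\<lambda>n. gauss_smooth \<epsilon> (\<lambda>t. U t (vec (a n))) z - gauss_smooth \<epsilon> (\<lambda>t. U t u) z) \<longlonglongrightarrow> 0"
      by (rule Lim_null_comparison)
    then show ?thesis by (simp add: LIM_zero_iff)
  qed
  have conv: "(\<lambda>n. (vec (smooth \<epsilon> (a n)), vec (\<theta> (smooth \<epsilon> (a n))))) \<longlonglongrightarrow>
      (gauss_smooth \<epsilon> (\<lambda>t. U t u) 0, gauss_smooth \<epsilon> (\<lambda>t. U t u) half)"
    using tendsto_Pair[OF lim[of 0] lim[of half]]
    by (simp add: core flow_zero analytic_smooth eps flip: \<theta>_def)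
  show ?thesis
    by (rule closed_sequentially[OF _ _ conv]) (simp_all add: closed_P P_core analytic_smooth eps)
qed

text \<open>A pair \<open>(u, v)\<close> in the adjoint is the limit of its Gaussian smoothings, and these lie in \<open>P\<close>
  because the smoothing of \<open>u\<close> is an entire vector.\<close>

lemma P_selfadjoint: "graph_adjoint P = P"
proof
  show "P \<subseteq> graph_adjoint P" using P_symmetric by auto
  show "graph_adjoint P \<subseteq> P"
  proof (clarify)
    fix u v assume uv: "(u, v) \<in> graph_adjoint P"
    have G: "(gauss_smooth \<epsilon> (\<lambda>t. U t u) 0, gauss_smooth \<epsilon> (\<lambda>t. U t v) 0) \<in> P" if eps: "\<epsilon> > 0" for \<epsilon>
    proof -
      have lin: "cinner y (gauss_smooth \<epsilon> (\<lambda>t. U t x) 0) = gauss_smooth \<epsilon> (\<lambda>t. cinner y (U t x)) 0" for x y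
      proof (rule gauss_smooth_linear[OF eps U_strongly_continuous order_eq_refl[OF norm_U]])
        show "clinear (cinner y)" by (simp add: clinear_def cinner_simps scaleC_complex_def)
        show "bounded_linear (cinner y)"
          by (rule bounded_bilinear.bounded_linear_right[OF bounded_bilinear_cinner])
      qed
      \<comment> \<open>\<open>P\<close> sends the smoothed \<open>u\<close> to its continuation at
        \<open>half\<close>. It is compared with the smoothed \<open>v\<close> by moving
        \<open>P\<close> onto a core vector and using the adjoint relation under the
        integral.\<close>
      have "cinner (vec a) (gauss_smooth \<epsilon> (\<lambda>t. U t u) half) = cinner (vec a) (gauss_smooth \<epsilon> (\<lambda>t. U t v) 0)"
        if a: "a \<in> analytic" for a
      proof -
        have "cinner (vec a) (gauss_smooth \<epsilon> (\<lambda>t. U t u) half) = cinner (vec (\<theta> a)) (gauss_smooth \<epsilon> (\<lambda>t. U t u) 0)"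
          using P_symmetric[OF P_core[OF a]] P_gauss_smooth[OF eps, of u] by (auto simp: graph_adjoint_def)
        also have "cinner (vec (\<theta> a)) (U t u) = cinner (vec a) (U t v)" for t
          using P_adjoint_U[OF uv a, of t] by (subst (1 2) cinner_commute) simp
        then have "cinner (vec (\<theta> a)) (gauss_smooth \<epsilon> (\<lambda>t. U t u) 0) = cinner (vec a) (gauss_smooth \<epsilon> (\<lambda>t. U t v) 0)"
          by (simp add: lin)
        finally show ?thesis .
      qed
      then have "gauss_smooth \<epsilon> (\<lambda>t. U t u) half = gauss_smooth \<epsilon> (\<lambda>t. U t v) 0"
        by (rule dense_cinner_ext_right[OF dense_analytic])
      then show ?thesis using P_gauss_smooth[OF eps, of u] by simp
    qed
    have U0: "U 0 x = x" for x
      by (rule dense_induct[OF dense_vec, where P = "\<lambda>x. U 0 x = x"])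
        (auto intro!: closed_Collect_eq continuous_intros simp: U_vec \<alpha>_zero)
    have "(\<lambda>n. gauss_smooth (inverse (real (Suc n))) (\<lambda>t. U t x) 0) \<longlonglongrightarrow> x" for x
      using gauss_smooth_tendsto[OF U_strongly_continuous order_eq_refl[OF norm_U], of x] by (simp add: U0)
    from tendsto_Pair[OF this[of u] this[of v]] show "(u, v) \<in> P"
      by (rule closed_sequentially[OF closed_P, rotated]) (rule G, simp)
  qed
qed

lemma PI: "(\<And>a. a \<in> analytic \<Longrightarrow> cinner u (vec (\<theta> a)) = cinner v (vec a)) \<Longrightarrow> (u, v) \<in> P"
  using graph_adjoint_PI P_selfadjoint by blast

lemma P_positive_selfadjoint: "positive_selfadjoint P"
  unfolding positive_selfadjoint_def
proof (intro conjI)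
  have "vec ` analytic \<subseteq> Domain P" using P_core by auto
  then show "closure (Domain P) = UNIV" using dense_analytic closure_mono by blast
  show "\<forall>(x, y)\<in>P. cinner x y \<in> \<real>\<^sub>\<ge>\<^sub>0"
  proof (clarify)
    fix x y assume "(x, y) \<in> P"
    then show "cinner x y \<in> \<real>\<^sub>\<ge>\<^sub>0"
    proof (rule P_induct)
      show "closed {z :: 'h \<times> 'h. cinner (fst z) (snd z) \<in> \<real>\<^sub>\<ge>\<^sub>0}"
        using closed_vimage[OF closed_nonneg_Reals_complex, of "\<lambda>z :: 'h \<times> 'h. cinner (fst z) (snd z)"]
        by (simp add: vimage_def continuous_intros)
      fix a assume a: "a \<in> analytic"
      \<comment> \<open>A quarter of the period on each factor makes the two factors adjoint to each
        other, so positivity of \<open>\<omega>\<close> applies.\<close>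
      let ?q = "\<i> * of_real (\<beta> / 4)"
      have q: "half = ?q + ?q" "cnj ?q = - ?q" by (simp_all add: half_def complex_eq_iff)
      have "cinner (vec a) (vec (\<theta> a)) = \<omega> (star a * flow ?q (flow ?q a))"
        using a by (simp add: cinner_vec \<theta>_def flow_flow q(1))
      also have "\<dots> = \<omega> (flow (- ?q) (star a) * flow ?q a)"
        using a by (intro \<omega>_flow_mult[symmetric] analytic_star analytic_flow)
      also have "\<dots> = \<omega> (star (flow ?q a) * flow ?q a)"
        using a q(2) by (simp add: flow_star)
      finally show "cinner (vec a) (vec (\<theta> a)) \<in> \<real>\<^sub>\<ge>\<^sub>0" using \<omega>_nonneg by simp
    qed
  qed
qed (rule P_selfadjoint)

text \<open>A kernel vector of a symmetric operator is orthogonal to the range, and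
  \<open>\<theta>\<close> maps the analytic elements onto themselves.\<close>

lemma P_inj: "(y, 0) \<in> P \<Longrightarrow> y = 0"
proof (rule dense_cinner_ext[OF dense_analytic])
  fix a assume P: "(y, 0) \<in> P" and a: "a \<in> analytic"
  have "cinner y (vec (\<theta> (flow (- half) a))) = cinner 0 (vec (flow (- half) a))"
    by (rule graph_selfadjoint_sym[OF P_selfadjoint P P_core[OF analytic_flow[OF a]]])
  then show "cinner y (vec a) = cinner 0 (vec a)" by (simp add: \<theta>_surj a)
qed

text \<open>Says \<open>P Y \<Omega> = J Y* \<Omega>\<close>, tested on the core by moving
  \<open>opp a\<close> past \<open>Y\<close>. Commutation with the operators \<open>opp b\<close> is
  the hypothesis, rather than membership in \<open>M\<close>, because the commutation theorem
  applies it before such \<open>Y\<close> are known to lie in \<open>M\<close>.\<close>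

lemma opp_commutant_P:
  assumes Y: "bounded_clinear Y" and comm: "\<And>b v. Y (opp b v) = opp b (Y v)"
  shows "(Y \<Omega>, J (op_adjoint Y \<Omega>)) \<in> P"
proof (rule PI)
  fix a assume a: "a \<in> analytic"
  have "cinner (J (op_adjoint Y \<Omega>)) (vec a) = cinner (J (vec a)) (op_adjoint Y \<Omega>)"
    by (rule J_cinner_left)
  also have "\<dots> = cinner (Y (opp a \<Omega>)) \<Omega>" by (simp add: cinner_op_adjoint_right[OF Y] opp_\<Omega>)
  also have "\<dots> = cinner (Y \<Omega>) (J (vec (star a)))" by (simp only: comm opp_cinner) (simp only: opp_\<Omega>)
  also have "\<dots> = cinner (Y \<Omega>) (vec (\<theta> a))" using a by (simp add: J_vec analytic_star star_star)
  finally show "cinner (Y \<Omega>) (vec (\<theta> a)) = cinner (J (op_adjoint Y \<Omega>)) (vec a)" by simp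
qed

text \<open>The counterpart for the commutant of \<open>\<pi>\<close>, with the roles of
  \<open>\<pi> a\<close> and \<open>opp a\<close> exchanged:
  \<open>P J X \<Omega> = X* \<Omega>\<close>.\<close>

lemma commutant_P:
  assumes X: "X \<in> commutant (range \<pi>)"
  shows "(J (X \<Omega>), op_adjoint X \<Omega>) \<in> P"
proof (rule PI)
  fix a assume a: "a \<in> analytic"
  have bX: "bounded_clinear X" and comm: "\<And>a v. \<pi> a (X v) = X (\<pi> a v)"
    using X by (auto simp: commutant_def fun_eq_iff)
  have "cinner (J (X \<Omega>)) (vec (\<theta> a)) = cinner (J (vec (\<theta> a))) (X \<Omega>)" by (rule J_cinner_left)
  also have "\<dots> = cinner (vec (star a)) (X \<Omega>)" using a by (simp add: J_vec analytic_\<theta> \<theta>_star_\<theta>)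
  also have "\<dots> = cinner \<Omega> (X (vec a))" by (simp add: vec_def \<pi>_star_left comm)
  also have "\<dots> = cinner (op_adjoint X \<Omega>) (vec a)" by (simp add: cinner_op_adjoint_left[OF bX])
  finally show "cinner (J (X \<Omega>)) (vec (\<theta> a)) = cinner (op_adjoint X \<Omega>) (vec a)" .
qed

section \<open>The enveloping algebra and its modular data\<close>

definition M :: "('h \<Rightarrow> 'h) set" where "M = enveloping_algebra \<pi>"

lemma opp_commutant: "opp b \<in> commutant (range \<pi>)"
  by (auto simp: commutant_def bounded_clinear_opp opp_commute fun_eq_iff)

lemma M_bounded_clinear: "x \<in> M \<Longrightarrow> bounded_clinear x"
  by (simp add: M_def enveloping_algebra_def commutant_def)

lemma M_commute: "x \<in> M \<Longrightarrow> y \<in> commutant (range \<pi>) \<Longrightarrow> x (y v) = y (x v)"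
  by (auto simp: M_def enveloping_algebra_def commutant_def[of "commutant (range \<pi>)"] fun_eq_iff)

lemma M_opp: "x \<in> M \<Longrightarrow> x (opp b v) = opp b (x v)"
  by (rule M_commute[OF _ opp_commutant])

lemma MI: "bounded_clinear x \<Longrightarrow> (\<And>y v. y \<in> commutant (range \<pi>) \<Longrightarrow> x (y v) = y (x v)) \<Longrightarrow> x \<in> M"
  by (auto simp: M_def enveloping_algebra_def commutant_def[of "commutant (range \<pi>)"] fun_eq_iff)

lemma \<pi>_M: "\<pi> a \<in> M"
  by (rule MI[OF \<pi>_bounded_clinear]) (auto simp: commutant_def fun_eq_iff)

text \<open>Members of \<open>M\<close> commute with the operators \<open>opp b\<close>, for which
  \<open>\<Omega>\<close> is cyclic.\<close>

lemma M_separating: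
  assumes "x \<in> M" "y \<in> M" "x \<Omega> = y \<Omega>"
  shows "x = y"
proof
  fix v
  show "x v = y v"
  proof (rule dense_induct[OF dense_opp, where P = "\<lambda>v. x v = y v"])
    show "closed {v. x v = y v}"
      using assms by (intro closed_Collect_eq bounded_clinear_continuous_on M_bounded_clinear)
    show "x (opp b \<Omega>) = y (opp b \<Omega>)" for b by (simp add: M_opp assms)
  qed
qed

lemma relcomp_J: "(x, z) \<in> Q O range (\<lambda>u. (u, J u)) \<longleftrightarrow> (x, J z) \<in> Q"
  unfolding relcomp_range by (metis J_J)

text \<open>Both sides are closed, so each inclusion is checked on generators: elements of
  \<open>M\<close> satisfy \<open>P x \<Omega> = J x* \<Omega>\<close>, and core vectors come from
  \<open>\<pi> a\<close>, which lies in \<open>M\<close>.\<close>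

lemma tomita_operator_eq: "tomita_operator M \<Omega> = P O range (\<lambda>u. (u, J u))"
proof -
  have P_eq: "P O range (\<lambda>u. (u, J u)) = (\<lambda>z. (fst z, J (snd z))) -` P"
    by (rule set_eqI) (simp only: split_paired_all vimage_eq fst_conv snd_conv relcomp_J)
  have cont: "continuous_on UNIV (\<lambda>z :: 'h \<times> 'h. (fst z, J (snd z)))" by (intro continuous_intros)
  show ?thesis
  proof
    have "closed (P O range (\<lambda>u. (u, J u)))"
      unfolding P_eq by (rule closed_vimage[OF closed_P cont])
    moreover have "(x \<Omega>, op_adjoint x \<Omega>) \<in> P O range (\<lambda>u. (u, J u))" if "x \<in> M" for x
      unfolding relcomp_J by (rule opp_commutant_P[OF M_bounded_clinear[OF that] M_opp[OF that]])
    ultimately show "tomita_operator M \<Omega> \<subseteq> P O range (\<lambda>u. (u, J u))"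
      unfolding tomita_operator_def by (intro closure_minimal) auto
  next
    show "P O range (\<lambda>u. (u, J u)) \<subseteq> tomita_operator M \<Omega>"
    proof (clarify)
      fix x y z assume "(x, y) \<in> P"
      then show "(x, J y) \<in> tomita_operator M \<Omega>"
      proof (rule P_induct)
        show "closed {z. (fst z, J (snd z)) \<in> tomita_operator M \<Omega>}"
          using closed_vimage[of "tomita_operator M \<Omega>", OF _ cont] by (simp add: vimage_def tomita_operator_def)
        fix a assume a: "a \<in> analytic"
        have "(vec a, vec (star a)) \<in> (\<lambda>x. (x \<Omega>, op_adjoint x \<Omega>)) ` M"
          using \<pi>_M[of a] by (auto simp: vec_def op_adjoint_\<pi> image_iff intro!: bexI[of _ "\<pi> a"])
        moreover have "J (vec (\<theta> a)) = vec (star a)" using a by (simp add: J_vec analytic_\<theta> \<theta>_star_\<theta>)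
        ultimately show "(vec a, J (vec (\<theta> a))) \<in> tomita_operator M \<Omega>"
          unfolding tomita_operator_def by (auto intro: closure_subset[THEN subsetD])
      qed
    qed
  qed
qed

text \<open>With \<open>S = J P\<close> the antilinear adjoint is \<open>P J\<close>, and the two
  conjugations cancel in the product.\<close>

lemma modular_operator_eq: "modular_operator M \<Omega> = P O P"
proof -
  have adj: "(u, v) \<in> antilinear_graph_adjoint (tomita_operator M \<Omega>) \<longleftrightarrow> (J u, v) \<in> P" for u v
  proof -
    have "(u, v) \<in> antilinear_graph_adjoint (tomita_operator M \<Omega>) \<longleftrightarrow>
        (\<forall>x y. (x, y) \<in> P \<longrightarrow> cinner u (J y) = cinner x v)"
      unfolding antilinear_graph_adjoint_def tomita_operator_eq by auto
    also have "\<dots> \<longleftrightarrow> (\<forall>x y. (x, y) \<in> P \<longrightarrow> cinner (J u) y = cinner v x)"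
    proof -
      have "cinner u (J y) = cinner x v \<longleftrightarrow> cinner (J u) y = cinner v x" for x y
        by (subst J_cinner_right, subst (1 2) cinner_commute) simp
      then show ?thesis by simp
    qed
    also have "\<dots> \<longleftrightarrow> (J u, v) \<in> P"
      using graph_selfadjoint_iff[OF P_selfadjoint, of "J u" v] by auto
    finally show ?thesis .
  qed
  have mem: "(x, z) \<in> A O B \<longleftrightarrow> (\<exists>y. (x, y) \<in> A \<and> (y, z) \<in> B)" for x z and A B :: "('h \<times> 'h) set"
    by auto
  have "(x, z) \<in> modular_operator M \<Omega> \<longleftrightarrow> (x, z) \<in> P O P" for x z
    unfolding modular_operator_def mem adj unfolding tomita_operator_eq relcomp_J by (metis J_J)
  then show ?thesis by (intro set_eqI) (simp only: split_paired_all)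
qed

text \<open>The factorisation \<open>J P\<close> settles existence; a competing antiunitary is
  excluded by uniqueness of the polar decomposition, where injectivity of \<open>P\<close>
  enters.\<close>

lemma modular_conjugation_eq: "modular_conjugation M \<Omega> = J"
  unfolding modular_conjugation_def
proof (rule the_equality)
  show "antiunitary J \<and> (\<exists>P. positive_selfadjoint P \<and> P O P = modular_operator M \<Omega> \<and>
      tomita_operator M \<Omega> = P O range (\<lambda>u. (u, J u)))"
    using antiunitary_J P_positive_selfadjoint modular_operator_eq tomita_operator_eq by blast
  fix J' assume "antiunitary J' \<and> (\<exists>P. positive_selfadjoint P \<and> P O P = modular_operator M \<Omega> \<and>
      tomita_operator M \<Omega> = P O range (\<lambda>u. (u, J' u)))"
  then obtain P' where "antiunitary J'" "positive_selfadjoint P'"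
      "P O range (\<lambda>u. (u, J u)) = P' O range (\<lambda>u. (u, J' u))"
    unfolding tomita_operator_eq by blast
  then show "J' = J"
    using polar_decomposition_unique[OF P_positive_selfadjoint _ antiunitary_J J_J _ _ P_inj] by blast
qed

text \<open>Self-adjointness of \<open>P\<close> gives the commutation in the vacuum state; applying this to
  \<open>\<pi>(b\<^sup>*) Y \<pi>(a)\<close> in place of \<open>Y\<close> gives all matrix coefficients.\<close>

lemma commutant_opp_commute:
  assumes X: "X \<in> commutant (range \<pi>)"
    and Y: "bounded_clinear Y" "\<And>b v. Y (opp b v) = opp b (Y v)"
  shows "X (Y v) = Y (X v)"
proof -
  have bX: "bounded_clinear X" and Xpi: "\<And>a v. \<pi> a (X v) = X (\<pi> a v)"
    using X by (auto simp: commutant_def fun_eq_iff)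
  have vac: "cinner \<Omega> (Y (X \<Omega>)) = cinner \<Omega> (X (Y \<Omega>))"
    if Y: "bounded_clinear Y" "\<And>b v. Y (opp b v) = opp b (Y v)" for Y
  proof -
    \<comment> \<open>Symmetry of \<open>P\<close> on the pairs
      \<open>(J X \<Omega>, X* \<Omega>)\<close> and \<open>(Y \<Omega>, J Y* \<Omega>)\<close>;
      antiunitarity then removes \<open>J\<close> from the left-hand side.\<close>
    have "cinner (J (X \<Omega>)) (J (op_adjoint Y \<Omega>)) = cinner (op_adjoint X \<Omega>) (Y \<Omega>)"
      by (rule graph_selfadjoint_sym[OF P_selfadjoint commutant_P[OF X] opp_commutant_P[OF Y]])
    then show ?thesis by (simp add: J_cinner cinner_op_adjoint_left bX Y)
  qed
  have core: "cinner (vec b) (Y (X (vec a))) = cinner (vec b) (X (Y (vec a)))" for a b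
  proof -
    have "bounded_clinear (\<lambda>v. \<pi> (star b) (Y (\<pi> a v)))"
      using bounded_clinear_compose[OF \<pi>_bounded_clinear bounded_clinear_compose[OF Y(1) \<pi>_bounded_clinear]]
      by (simp add: o_def)
    moreover have "\<pi> (star b) (Y (\<pi> a (opp c v))) = opp c (\<pi> (star b) (Y (\<pi> a v)))" for c v
      by (simp only: opp_commute[symmetric] Y(2))
    ultimately have "cinner \<Omega> (\<pi> (star b) (Y (\<pi> a (X \<Omega>)))) = cinner \<Omega> (X (\<pi> (star b) (Y (\<pi> a \<Omega>))))"
      by (rule vac)
    then show ?thesis by (simp add: Xpi[symmetric] \<pi>_star_right vec_def)
  qed
  have core': "X (Y (vec a)) = Y (X (vec a))" for a
    by (rule dense_cinner_ext_right[OF dense_vec core[symmetric]])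
  have "closed {v. X (Y v) = Y (X v)}"
    using bounded_clinear_continuous_on[OF bounded_clinear_compose[OF bX Y(1)]]
      bounded_clinear_continuous_on[OF bounded_clinear_compose[OF Y(1) bX]]
    by (intro closed_Collect_eq) (simp_all add: o_def)
  then show ?thesis by (rule dense_induct[OF dense_vec]) (rule core')
qed

text \<open>\<open>J X J\<close> commutes with \<open>opp b = J \<pi>(b) J\<close> because
  \<open>X\<close> commutes with \<open>\<pi>(b)\<close>; the preceding lemma extends this to the
  whole commutant of \<open>\<pi>\<close>.\<close>

lemma J_commutant_J:
  assumes X: "X \<in> commutant (range \<pi>)"
  shows "(\<lambda>v. J (X (J v))) \<in> M"
proof -
  have bX: "bounded_clinear X" and Xpi: "\<And>a v. \<pi> a (X v) = X (\<pi> a v)"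
    using X by (auto simp: commutant_def fun_eq_iff)
  show ?thesis
    by (rule MI[OF bounded_clinear_J[OF bX]], rule commutant_opp_commute[symmetric])
      (simp_all add: bounded_clinear_J[OF bX] opp_def J_J Xpi)
qed

text \<open>Elements of \<open>M\<close> commute with \<open>opp a\<close>; conjugating this
  relation by \<open>J\<close> turns \<open>opp a\<close> into \<open>\<pi> a\<close>.\<close>

lemma J_M_J:
  assumes x: "x \<in> M"
  shows "(\<lambda>v. J (x (J v))) \<in> commutant (range \<pi>)"
proof -
  have "\<pi> a (J (x (J v))) = J (x (J (\<pi> a v)))" for a v
  proof -
    have "J (\<pi> a (J (x (J v)))) = x (J (\<pi> a v))"
      using M_opp[OF x, of a "J v"] by (simp add: opp_def J_J)
    then show ?thesis by (metis J_J)
  qed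
  then show ?thesis
    by (auto simp: commutant_def bounded_clinear_J M_bounded_clinear x fun_eq_iff)
qed

end

section \<open>Twisted KMS functionals and the twisted center\<close>

text \<open>The bound by \<open>norm (e a)\<close> lets \<open>f\<close> factor through
  \<open>e\<close> and extend continuously, after which Riesz applies. The sharp bound on
  \<open>w\<close> comes from testing with \<open>w\<close> itself.\<close>

lemma dense_functional_representation:
  fixes e :: "'a::complex_vector \<Rightarrow> 'h::chilbert_space" and f :: "'a \<Rightarrow> complex"
  assumes dense: "closure (e ` UNIV) = UNIV" and e: "clinear e" and f: "clinear f"
    and le: "\<And>a. cmod (f a) \<le> K * norm (e a)" and "0 \<le> K"
  obtains w where "\<And>a. f a = cinner w (e a)" "norm w \<le> K"
proof -
  have "norm (f a - f b) \<le> K * norm (e a - e b)" if "a \<in> UNIV" "b \<in> UNIV" for a b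
    using le[of "a - b"] by (simp add: clinear_diff[OF e] clinear_diff[OF f])
  from dense_extension[where k = f, OF dense this]
  obtain g where g: "continuous_on UNIV g" "\<And>a. a \<in> UNIV \<Longrightarrow> g (e a) = f a" by blast
  have cont: "continuous_on UNIV (\<lambda>x. g (h x))" if "continuous_on UNIV h" for h :: "'h \<Rightarrow> 'h"
    by (rule continuous_on_compose_UNIV[OF g(1) that])
  have add: "g (x + y) = g x + g y" for x y
  proof (rule dense_induct[OF dense, where P = "\<lambda>x. g (x + y) = g x + g y"])
    fix a
    show "g (e a + y) = g (e a) + g y"
    proof (rule dense_induct[OF dense, where P = "\<lambda>y. g (e a + y) = g (e a) + g y"])
      show "g (e a + e b) = g (e a) + g (e b)" for b
        using g(2)[of "a + b"] by (simp add: g(2) clinear_add[OF e] clinear_add[OF f])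
    qed (intro closed_Collect_eq continuous_intros cont g(1))
  qed (intro closed_Collect_eq continuous_intros cont g(1))
  have scale: "g (c *\<^sub>C x) = c *\<^sub>C g x" for c x
  proof (rule dense_induct[OF dense, where P = "\<lambda>x. g (c *\<^sub>C x) = c *\<^sub>C g x"])
    show "g (c *\<^sub>C e b) = c *\<^sub>C g (e b)" for b
      using g(2)[of "c *\<^sub>C b"] by (simp add: g(2) clinear_scaleC[OF e] clinear_scaleC[OF f])
  qed (intro closed_Collect_eq continuous_intros cont g(1))
  have bound: "cmod (g x) \<le> K * norm x" for x
    by (rule dense_induct[OF dense, where P = "\<lambda>x. cmod (g x) \<le> K * norm x"])
      (auto intro!: closed_Collect_le continuous_intros g(1) simp: g(2) le)
  have "clinear g" by (simp add: clinear_def add scale)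
  from riesz_representation[OF this bound] obtain w where w: "\<And>v. g v = cinner w v" by blast
  show ?thesis
  proof (rule that)
    show "f a = cinner w (e a)" for a using w[of "e a"] by (simp add: g(2))
    have "norm w * norm w \<le> K * norm w"
      using bound[of w] w[of w] by (simp add: cinner_self norm_mult power2_eq_square)
    then show "norm w \<le> K" using \<open>0 \<le> K\<close> by (cases "w = 0") auto
  qed
qed

context kms_gns
begin

section \<open>The grading unitary\<close>

abbreviation V :: "'h \<Rightarrow> 'h" where "V \<equiv> grading_unitary \<pi> \<Omega> \<gamma>"

lemma grading_unitary_exists:
  obtains W where "unitary W" "\<And>a. W \<circ> \<pi> a \<circ> W = \<pi> (\<gamma> a)" "W \<Omega> = \<Omega>" "W \<circ> W = id" "\<And>a. W (vec a) = vec (\<gamma> a)"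
proof -
  have iso: "cinner (vec (\<gamma> a)) (vec (\<gamma> b)) = cinner (vec a) (vec b)" for a b
    by (simp add: cinner_vec \<omega>_\<gamma> flip: \<gamma>_star \<gamma>_mult)
  have "norm (vec (\<gamma> a) - vec (\<gamma> b)) \<le> 1 * norm (vec a - vec b)" if "a \<in> UNIV" "b \<in> UNIV" for a b
  proof -
    have "norm (vec (\<gamma> (a - b))) = norm (vec (a - b))" by (simp add: norm_eq_sqrt_cinner iso)
    then show ?thesis by (simp add: clinear_diff[OF \<gamma>_clinear] clinear_diff[OF vec_clinear])
  qed
  from dense_extension[where k = "\<lambda>a. vec (\<gamma> a)", OF dense_vec this]
  obtain W where W: "continuous_on UNIV W" "\<And>a. a \<in> UNIV \<Longrightarrow> W (vec a) = vec (\<gamma> a)" by blast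
  have cont: "continuous_on UNIV (\<lambda>x. W (h x))" if "continuous_on UNIV h" for h :: "'h \<Rightarrow> 'h"
    by (rule continuous_on_compose_UNIV[OF W(1) that])
  have WW: "W (W v) = v" for v
    by (rule dense_induct[OF dense_vec, where P = "\<lambda>v. W (W v) = v"])
      (auto intro!: closed_Collect_eq continuous_intros cont W(1) simp: W(2) \<gamma>_\<gamma>)
  have inner: "cinner (W v) (W w) = cinner v w" for v w
  proof (rule dense_induct[OF dense_vec, where P = "\<lambda>v. cinner (W v) (W w) = cinner v w"])
    fix a
    show "cinner (W (vec a)) (W w) = cinner (vec a) w"
      by (rule dense_induct[OF dense_vec, where P = "\<lambda>w. cinner (W (vec a)) (W w) = cinner (vec a) w"])
        (auto intro!: closed_Collect_eq continuous_intros W(1) simp: W(2) iso)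
  qed (auto intro!: closed_Collect_eq continuous_intros W(1))
  \<comment> \<open>An isometric involution is its own adjoint; linearity follows because the
    right-hand side pairs \<open>v\<close> with a fixed vector.\<close>
  have left: "cinner (W v) w = cinner v (W w)" for v w using inner[of v "W w"] by (simp add: WW)
  have "clinear W"
    unfolding clinear_def
  proof (intro conjI allI)
    show "W (x + y) = W x + W y" for x y
      by (rule cinner_ext_left) (simp add: cinner_simps left)
    show "W (c *\<^sub>C x) = c *\<^sub>C W x" for c x
      by (rule cinner_ext_left) (simp add: cinner_simps left)
  qed
  moreover have "surj W" by (metis WW surjI)
  ultimately have uni: "unitary W" by (simp add: unitary_def inner)
  show ?thesis
  proof (rule that[OF uni])
    fix a
    have "W (\<pi> a (W v)) = \<pi> (\<gamma> a) v" for v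
    proof (rule dense_induct[OF dense_vec, where P = "\<lambda>v. W (\<pi> a (W v)) = \<pi> (\<gamma> a) v"])
      show "W (\<pi> a (W (vec b))) = \<pi> (\<gamma> a) (vec b)" for b
        by (simp add: W(2) \<gamma>_mult \<gamma>_\<gamma> flip: vec_mult)
    qed (intro closed_Collect_eq continuous_intros cont W(1))
    then show "W \<circ> \<pi> a \<circ> W = \<pi> (\<gamma> a)" by (simp add: fun_eq_iff)
  next
    show "W \<Omega> = \<Omega>" using W(2)[of 1] by (simp add: vec_one \<gamma>_one)
  qed (use W(2) WW in \<open>auto simp: fun_eq_iff\<close>)
qed

lemma V_unitary: "unitary V"
  and V_\<Omega>: "V \<Omega> = \<Omega>"
  and V_V: "V (V v) = v"
  and V_vec: "V (vec a) = vec (\<gamma> a)"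
proof -
  obtain W where W: "unitary W" "\<And>a. W \<circ> \<pi> a \<circ> W = \<pi> (\<gamma> a)" "W \<Omega> = \<Omega>" "W \<circ> W = id"
    "\<And>a. W (vec a) = vec (\<gamma> a)"
    by (rule grading_unitary_exists) blast
  have "V = W"
    unfolding grading_unitary_def
  proof (rule the_equality)
    fix V' assume V': "unitary V' \<and> (\<forall>a. V' \<circ> \<pi> a \<circ> V' = \<pi> (\<gamma> a)) \<and> V' \<Omega> = \<Omega> \<and> V' \<circ> V' = id"
    \<comment> \<open>Evaluating the covariance relation at the fixed vector \<open>\<Omega>\<close>
      determines a candidate on all vectors \<open>vec a\<close>.\<close>
    have vec: "V' (vec a) = W (vec a)" for a
    proof -
      have "(V' \<circ> \<pi> a \<circ> V') \<Omega> = \<pi> (\<gamma> a) \<Omega>" "V' \<Omega> = \<Omega>" using V' by simp_all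
      then have "V' (vec a) = vec (\<gamma> a)" by (simp add: vec_def)
      then show ?thesis by (simp only: W(5))
    qed
    have "closed {v. V' v = W v}"
      using V' W(1) by (intro closed_Collect_eq bounded_clinear_continuous_on bounded_clinear_unitary) auto
    then have "V' v = W v" for v by (rule dense_induct[OF dense_vec]) (rule vec)
    then show "V' = W" by (simp add: fun_eq_iff)
  qed (use W in blast)
  moreover have "W (W v) = v" using fun_cong[OF W(4), of v] by simp
  ultimately show "unitary V" "V \<Omega> = \<Omega>" "V (V v) = v" "V (vec a) = vec (\<gamma> a)"
    using W by simp_all
qed

lemma bounded_clinear_V: "bounded_clinear V"
  by (rule bounded_clinear_unitary[OF V_unitary])

section \<open>From functionals to central elements and back\<close>

definition functionals :: "('a \<Rightarrow> complex) set" where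
  "functionals = twisted_KMS_functionals \<beta> \<alpha> \<gamma> \<omega>"

definition central_ball :: "('h \<Rightarrow> 'h) set" where
  "central_ball = unit_ball M \<inter> selfadjoint_part (twisted_center M \<Omega> V)"

lemma central_ball_iff:
  "R \<in> central_ball \<longleftrightarrow> R \<in> M \<and> onorm R \<le> 1 \<and> op_adjoint R = R \<and> (\<forall>v. J (R (J v)) = R (V v))"
  unfolding central_ball_def unit_ball_def selfadjoint_part_def twisted_center_def modular_conjugation_eq
  by (auto simp: fun_eq_iff)

lemma representing_vector_unique:
  assumes "\<And>a. cinner \<Omega> (\<pi> a x) = cinner \<Omega> (\<pi> a y)"
  shows "x = y"
proof (rule dense_cinner_ext_right[OF dense_vec])
  show "cinner (vec a) x = cinner (vec a) y" for a
    using assms[of "star a"] by (simp add: \<pi>_star_right vec_def)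
qed

lemma Re_\<omega>: "Re (\<omega> (star a * a)) = (norm (vec a))\<^sup>2"
  by (simp add: power2_norm_eq_cinner cinner_vec)

lemma dominated_iff: "dominated \<omega> \<rho> \<longleftrightarrow> (\<forall>a b. cmod (\<rho> (star a * b)) \<le> norm (vec a) * norm (vec b))"
  unfolding dominated_def Re_\<omega> by (simp add: abs_le_square_iff flip: power_mult_distrib)

lemma functionals_operator:
  assumes \<rho>: "\<rho> \<in> functionals"
  obtains T where "T \<in> commutant (range \<pi>)" "\<And>u v. cinner (T u) v = cinner u (T v)"
    "\<And>v. norm (T v) \<le> norm v" "\<And>a b. cinner (T (vec a)) (vec b) = \<rho> (star a * b)"
proof -
  have lin: "clinear \<rho>" and herm: "\<And>a. cnj (\<rho> (star a)) = \<rho> a"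
    and dom: "\<And>a b. cmod (\<rho> (star a * b)) \<le> norm (vec a) * norm (vec b)"
    using \<rho> by (auto simp: functionals_def twisted_KMS_functionals_def hermitian_def dominated_iff)
  have "\<exists>w. (\<forall>a. \<rho> (star b * a) = cinner w (vec a)) \<and> norm w \<le> norm (vec b)" for b
  proof -
    have "clinear (\<lambda>a. \<rho> (star b * a))"
      using lin by (simp add: clinear_def distrib_left mult_scaleC_right)
    from dense_functional_representation[OF dense_vec vec_clinear this dom norm_ge_zero] show ?thesis by blast
  qed
  then obtain w where w: "\<And>a b. cinner (w b) (vec a) = \<rho> (star b * a)" and nw: "\<And>b. norm (w b) \<le> norm (vec b)"
    by metis
  have w_diff: "w b - w c = w (b - c)" for b c
    by (rule dense_cinner_ext[OF dense_vec])
      (simp add: cinner_simps w star_diff left_diff_distrib clinear_diff[OF lin])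
  have "norm (w b - w c) \<le> 1 * norm (vec b - vec c)" if "b \<in> UNIV" "c \<in> UNIV" for b c
    using nw[of "b - c"] by (simp add: w_diff clinear_diff[OF vec_clinear])
  from dense_extension[where k = w, OF dense_vec this]
  obtain T where T: "continuous_on UNIV T" "\<And>b. b \<in> UNIV \<Longrightarrow> T (vec b) = w b" by blast
  have T_vec: "cinner (T (vec a)) (vec b) = \<rho> (star a * b)" for a b by (simp add: T(2) w)
  \<comment> \<open>Hermiticity of \<open>\<rho>\<close> enters here; linearity of \<open>T\<close>
    is then a consequence of symmetry.\<close>
  have sym: "cinner (T u) v = cinner u (T v)" for u v
  proof (rule dense_induct[OF dense_vec, where P = "\<lambda>u. cinner (T u) v = cinner u (T v)"])
    fix a
    show "cinner (T (vec a)) v = cinner (vec a) (T v)"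
    proof (rule dense_induct[OF dense_vec, where P = "\<lambda>v. cinner (T (vec a)) v = cinner (vec a) (T v)"])
      fix b
      have "cinner (vec a) (T (vec b)) = cnj (\<rho> (star b * a))" by (subst cinner_commute) (simp add: T_vec)
      also have "\<dots> = \<rho> (star a * b)" using herm[of "star a * b"] by (simp add: star_mult star_star)
      finally show "cinner (T (vec a)) (vec b) = cinner (vec a) (T (vec b))" by (simp add: T_vec)
    qed (intro closed_Collect_eq continuous_intros T(1))
  qed (intro closed_Collect_eq continuous_intros T(1))
  have norm: "norm (T v) \<le> norm v" for v
    by (rule dense_induct[OF dense_vec, where P = "\<lambda>v. norm (T v) \<le> norm v"])
      (auto intro!: closed_Collect_le continuous_intros T(1) simp: T(2) nw)
  have bT: "bounded_clinear T"
  proof (rule bounded_clinearI[where K = 1])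
    show "T (x + y) = T x + T y" for x y
      by (rule cinner_ext_left) (simp add: cinner_simps sym)
    show "T (c *\<^sub>C x) = c *\<^sub>C T x" for c x
      by (rule cinner_ext_left) (simp add: cinner_simps sym)
  qed (simp add: norm)
  have "\<pi> c (T v) = T (\<pi> c v)" for c v
  proof (rule dense_induct[OF dense_vec, where P = "\<lambda>v. \<pi> c (T v) = T (\<pi> c v)"])
    fix b
    show "\<pi> c (T (vec b)) = T (\<pi> c (vec b))"
    proof (rule dense_cinner_ext[OF dense_vec])
      fix a
      have "cinner (T (\<pi> c (vec b))) (vec a) = \<rho> (star (c * b) * a)" by (simp add: T_vec flip: vec_mult)
      also have "\<dots> = cinner (T (vec b)) (\<pi> (star c) (vec a))"
        by (simp add: T_vec star_mult mult.assoc flip: vec_mult)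
      finally show "cinner (\<pi> c (T (vec b))) (vec a) = cinner (T (\<pi> c (vec b))) (vec a)"
        by (simp add: \<pi>_star_right)
    qed
  qed (intro closed_Collect_eq continuous_intros T(1) continuous_on_compose_UNIV[OF T(1)])
  then have "T \<in> commutant (range \<pi>)" using bT by (auto simp: commutant_def fun_eq_iff)
  from that[OF this sym norm T_vec] show ?thesis .
qed

lemma functionals_bound:
  assumes "\<rho> \<in> functionals"
  shows "cmod (\<rho> a) \<le> norm a * 1"
proof -
  have "cmod (\<rho> (star 1 * a)) \<le> norm (vec 1) * norm (vec a)"
    using assms by (simp only: functionals_def twisted_KMS_functionals_def dominated_iff mem_Collect_eq)
  then show ?thesis using norm_\<pi>_le[of a \<Omega>] by (simp add: vec_one norm_\<Omega> vec_def \<pi>_one)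
qed

lemma functionals_representation:
  assumes \<rho>: "\<rho> \<in> functionals"
  obtains R where "R \<in> central_ball" "\<And>a. \<rho> a = cinner \<Omega> (\<pi> a (R \<Omega>))"
proof -
  obtain T where T: "T \<in> commutant (range \<pi>)" and sym: "\<And>u v. cinner (T u) v = cinner u (T v)"
    and norm: "\<And>v. norm (T v) \<le> norm v" and T_vec: "\<And>a b. cinner (T (vec a)) (vec b) = \<rho> (star a * b)"
    using functionals_operator[OF \<rho>] by blast
  have bT: "bounded_clinear T" and comm: "\<And>a v. \<pi> a (T v) = T (\<pi> a v)"
    using T by (auto simp: commutant_def fun_eq_iff)
  have lin: "clinear \<rho>"
    and twist: "\<And>a b. a \<in> analytic \<Longrightarrow> b \<in> analytic \<Longrightarrow> \<rho> (a * flow (\<i> * of_real \<beta>) b) = \<rho> (b * \<gamma> a)"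
    using \<rho> by (auto simp: functionals_def twisted_KMS_functionals_def twisted_KMS_def)
  have inv: "\<rho> (flow z a) = \<rho> a" if "a \<in> analytic" for z a
  proof (rule imaginary_periodic_invariant[OF lin functionals_bound[OF \<rho>] \<beta>_nonzero _ that])
    show "\<rho> (flow (\<i> * of_real \<beta>) b) = \<rho> b" if "b \<in> analytic" for b
      using twist[OF analytic_one that] by (simp add: \<gamma>_one)
  qed
  define R where "R v = J (T (J v))" for v
  have R_sym: "cinner (R u) v = cinner u (R v)" for u v
    unfolding R_def by (subst J_cinner_left, subst sym[symmetric], subst J_cinner_right) simp
  have R_eq: "R v = T (V v)" for v
  proof (rule analytic_induct[where P = "\<lambda>v. R v = T (V v)"])
    fix a assume a: "a \<in> analytic"
    show "R (vec a) = T (V (vec a))"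
    proof (rule dense_cinner_ext_right[OF dense_analytic])
      fix c assume c: "c \<in> analytic"
      have "cinner (vec c) (R (vec a)) = cinner (R (vec c)) (vec a)" by (simp add: R_sym)
      also have "\<dots> = cinner (T (J (vec a))) (J (vec c))"
        unfolding R_def by (subst J_cinner_left) (simp add: sym)
      also have "\<dots> = \<rho> (star (\<theta> (star a)) * \<theta> (star c))" using a c by (simp add: J_vec T_vec)
      also have "\<dots> = \<rho> (flow (- half) a * \<theta> (star c))"
        using a by (simp add: star_\<theta> analytic_star star_star)
      \<comment> \<open>Invariance shifts both factors by \<open>half\<close>: the first returns to
        \<open>a\<close>, and the second reaches \<open>i \<beta>\<close>, where the twisted
        condition applies.\<close>
      also have "\<dots> = \<rho> (flow half (flow (- half) a * \<theta> (star c)))"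
        using a c by (intro inv[symmetric] analytic_mult analytic_flow analytic_\<theta> analytic_star)
      also have "\<dots> = \<rho> (a * flow (\<i> * of_real \<beta>) (star c))"
        using a c by (simp add: flow_mult analytic_flow analytic_star flow_flow flow_zero \<theta>_def half_def algebra_simps)
      also have "\<dots> = cinner (T (vec c)) (V (vec a))"
        using a c by (simp add: twist analytic_star T_vec V_vec)
      finally show "cinner (vec c) (R (vec a)) = cinner (vec c) (T (V (vec a)))" by (simp add: sym)
    qed
  next
    have "continuous_on UNIV R" "continuous_on UNIV (\<lambda>v. T (V v))"
      using bounded_clinear_continuous_on[OF bounded_clinear_J[OF bT]]
        bounded_clinear_continuous_on[OF bounded_clinear_compose[OF bT bounded_clinear_V]]
      by (simp_all add: R_def[abs_def] o_def)
    then show "closed {v. R v = T (V v)}" by (rule closed_Collect_eq)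
  qed
  have "R \<in> central_ball"
    unfolding central_ball_iff
  proof (intro conjI allI)
    show "R \<in> M" using J_commutant_J[OF T] by (simp add: R_def[abs_def])
    show "onorm R \<le> 1"
      by (rule onorm_bound) (use norm antiunitary_norm[OF antiunitary_J] in \<open>simp_all add: R_def\<close>, metis)
    show "op_adjoint R = R" by (rule op_adjoint_eqI) (rule R_sym)
    \<comment> \<open>Both sides equal \<open>T v\<close>: the left because \<open>J\<close> is an
      involution, the right because \<open>R = T V\<close> and \<open>V\<close> is one.\<close>
    show "J (R (J v)) = R (V v)" for v using R_eq[of "V v"] by (simp add: R_def J_J V_V)
  qed
  moreover have "\<rho> a = cinner \<Omega> (\<pi> a (R \<Omega>))" for a
  proof -
    have "cinner \<Omega> (\<pi> a (R \<Omega>)) = cinner (T (vec 1)) (vec a)"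
      by (simp add: R_eq V_\<Omega> comm vec_one sym) (simp add: vec_def)
    then show ?thesis by (simp add: T_vec)
  qed
  ultimately show ?thesis by (rule that)
qed

lemma central_ball_functional:
  assumes R: "R \<in> central_ball"
  shows "(\<lambda>a. cinner \<Omega> (\<pi> a (R \<Omega>))) \<in> functionals"
proof -
  have RM: "R \<in> M" and R1: "onorm R \<le> 1" and adj: "op_adjoint R = R" and JRJ: "\<And>v. J (R (J v)) = R (V v)"
    using R by (auto simp: central_ball_iff)
  have bR: "bounded_clinear R" by (rule M_bounded_clinear[OF RM])
  have R_sym: "cinner (R u) v = cinner u (R v)" for u v
    using cinner_op_adjoint_left[OF bR, of u v] by (simp add: adj)
  \<comment> \<open>\<open>T\<close> has two descriptions: \<open>R V\<close> gives the norm bound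
    and the value at \<open>\<Omega>\<close>, and \<open>J R J\<close> puts it in the
    commutant.\<close>
  define T where "T v = R (V v)" for v
  have T_eq: "T v = J (R (J v))" for v by (simp add: T_def JRJ)
  have "T \<in> commutant (range \<pi>)" using J_M_J[OF RM] by (simp add: T_eq[abs_def])
  then have comm: "\<pi> a (T v) = T (\<pi> a v)" for a v by (auto simp: commutant_def fun_eq_iff)
  have sym: "cinner (T u) v = cinner u (T v)" for u v
    unfolding T_eq by (subst J_cinner_left, subst R_sym[symmetric], subst J_cinner_right) simp
  have norm: "norm (T v) \<le> norm v" for v
  proof -
    have "norm (R (V v)) \<le> onorm R * norm (V v)" by (rule bounded_clinear_norm_le[OF bR])
    also have "\<dots> \<le> 1 * norm (V v)" using R1 by (rule mult_right_mono) simp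
    finally show ?thesis by (simp add: T_def unitary_norm[OF V_unitary])
  qed
  define \<rho> where "\<rho> a = cinner \<Omega> (\<pi> a (R \<Omega>))" for a
  have \<rho>_eq: "\<rho> a = cinner \<Omega> (T (vec a))" for a
    using comm[of a \<Omega>] by (simp add: \<rho>_def T_def V_\<Omega> vec_def)
  have \<rho>_mult: "\<rho> (a * b) = cinner (vec (star a)) (T (vec b))" for a b
    using \<pi>_star_left[of a \<Omega> "T (vec b)"] by (simp add: \<rho>_eq vec_mult) (simp add: vec_def comm)
  have lin: "clinear \<rho>"
    by (simp add: clinear_def \<rho>_def \<pi>_add \<pi>_scaleC cinner_simps scaleC_complex_def)
  have dom: "cmod (\<rho> (star a * b)) \<le> norm (vec a) * norm (vec b)" for a b
  proof -
    have "cmod (\<rho> (star a * b)) \<le> norm (vec a) * norm (T (vec b))"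
      unfolding \<rho>_mult star_star by (rule cinner_Cauchy_Schwarz)
    also have "\<dots> \<le> norm (vec a) * norm (vec b)" by (intro mult_left_mono norm) simp
    finally show ?thesis .
  qed
  have bound: "cmod (\<rho> a) \<le> norm a * 1" for a
    using dom[of 1 a] norm_\<pi>_le[of a \<Omega>] by (simp add: vec_one norm_\<Omega> vec_def \<pi>_one)
  have herm: "hermitian \<rho>"
    unfolding hermitian_def
  proof
    fix a
    have "cnj (\<rho> (star a)) = cinner (T (vec (star a))) \<Omega>" by (simp add: \<rho>_eq flip: cinner_commute)
    also have "\<dots> = cinner (vec (star a)) (T (vec 1))" by (simp add: sym vec_one)
    also have "\<dots> = \<rho> (a * 1)" by (simp only: \<rho>_mult)
    finally show "cnj (\<rho> (star a)) = \<rho> a" by simp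
  qed
  \<comment> \<open>The twisted condition with \<open>i \<beta>\<close> divided between the factors.
    In this form it needs only the central relation, since the shifted factors are images under
    \<open>J\<close>.\<close>
  have half_shift: "\<rho> (flow (- half) a * \<theta> b) = \<rho> (b * \<gamma> a)" if a: "a \<in> analytic" and b: "b \<in> analytic" for a b
  proof -
    have "\<rho> (flow (- half) a * \<theta> b) = cinner (vec (\<theta> (star a))) (T (vec (\<theta> b)))"
      by (simp add: \<rho>_mult \<theta>_star a)
    also have "\<dots> = cinner (J (vec a)) (T (J (vec (star b))))"
      using a b by (simp add: J_vec analytic_star star_star)
    also have "\<dots> = cinner (J (T (J (vec (star b))))) (vec a)" by (rule J_cinner_left)
    also have "\<dots> = cinner (R (vec (star b))) (vec a)" by (simp add: T_eq J_J)
    also have "\<dots> = cinner (vec (star b)) (T (V (vec a)))" by (simp add: R_sym T_def V_V)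
    also have "\<dots> = \<rho> (b * \<gamma> a)" by (simp add: \<rho>_mult V_vec)
    finally show ?thesis .
  qed
  \<comment> \<open>With \<open>a = 1\<close> the divided condition yields the period
    \<open>i \<beta> / 2\<close>. The resulting invariance lets both factors be shifted by
    \<open>half\<close>, which restores the undivided condition.\<close>
  have inv: "\<rho> (flow z a) = \<rho> a" if "a \<in> analytic" for z a
  proof (rule imaginary_periodic_invariant[OF lin bound _ _ that])
    show "\<beta> / 2 \<noteq> 0" using \<beta>_nonzero by simp
    show "\<rho> (flow (\<i> * of_real (\<beta> / 2)) b) = \<rho> b" if "b \<in> analytic" for b
      using half_shift[OF analytic_one that] by (simp add: \<gamma>_one flow_one \<theta>_def half_def)
  qed
  have "twisted_KMS \<beta> \<alpha> \<gamma> \<rho>"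
    unfolding twisted_KMS_def
  proof (intro ballI)
    fix a b assume a: "a \<in> analytic" and b: "b \<in> analytic"
    have "\<rho> (b * \<gamma> a) = \<rho> (flow half (flow (- half) a * \<theta> b))"
      using a b by (simp add: half_shift inv analytic_mult analytic_flow analytic_\<theta>)
    also have "\<dots> = \<rho> (a * flow (\<i> * of_real \<beta>) b)"
      using a b by (simp add: flow_mult analytic_flow flow_flow flow_zero \<theta>_def half_def algebra_simps)
    finally show "\<rho> (a * flow (\<i> * of_real \<beta>) b) = \<rho> (b * \<gamma> a)" by simp
  qed
  then show ?thesis
    using lin herm dom unfolding \<rho>_def[abs_def, symmetric]
    by (simp add: functionals_def twisted_KMS_functionals_def dominated_iff)
qed

section \<open>Convex combinations and the bijection\<close>

lemma functionals_convex:
  assumes "\<rho> \<in> functionals" "\<sigma> \<in> functionals" "t \<in> {0..1}"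
  shows "(\<lambda>a. complex_of_real t * \<rho> a + complex_of_real (1 - t) * \<sigma> a) \<in> functionals"
proof -
  let ?\<tau> = "\<lambda>a. complex_of_real t * \<rho> a + complex_of_real (1 - t) * \<sigma> a"
  have \<rho>: "clinear \<rho>" "twisted_KMS \<beta> \<alpha> \<gamma> \<rho>" "hermitian \<rho>" "dominated \<omega> \<rho>"
    and \<sigma>: "clinear \<sigma>" "twisted_KMS \<beta> \<alpha> \<gamma> \<sigma>" "hermitian \<sigma>" "dominated \<omega> \<sigma>"
    using assms by (auto simp: functionals_def twisted_KMS_functionals_def)
  have "clinear ?\<tau>"
    using \<rho>(1) \<sigma>(1) by (simp add: clinear_def scaleC_complex_def algebra_simps)
  moreover have "twisted_KMS \<beta> \<alpha> \<gamma> ?\<tau>"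
    using \<rho>(2) \<sigma>(2) by (simp add: twisted_KMS_def)
  moreover have "hermitian ?\<tau>"
    using \<rho>(3) \<sigma>(3) by (simp add: hermitian_def)
  moreover have "cmod (?\<tau> (star a * b)) \<le> norm (vec a) * norm (vec b)" for a b
  proof -
    have "cmod (?\<tau> (star a * b)) \<le> t * cmod (\<rho> (star a * b)) + (1 - t) * cmod (\<sigma> (star a * b))"
      by (rule order_trans[OF norm_triangle_ineq])
        (use assms(3) in \<open>simp add: norm_mult del: of_real_diff\<close>)
    also have "\<dots> \<le> t * (norm (vec a) * norm (vec b)) + (1 - t) * (norm (vec a) * norm (vec b))"
      using assms(3) \<rho>(4) \<sigma>(4) by (intro add_mono mult_left_mono) (auto simp: dominated_iff)
    finally show ?thesis by (simp add: algebra_simps)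
  qed
  ultimately show ?thesis
    by (simp add: functionals_def twisted_KMS_functionals_def dominated_iff)
qed

lemma M_convex:
  assumes "R \<in> M" "S \<in> M"
  shows "(\<lambda>v. s *\<^sub>R R v + t *\<^sub>R S v) \<in> M"
proof (rule MI)
  have R: "bounded_clinear R" and S: "bounded_clinear S" using assms by (auto intro: M_bounded_clinear)
  show "bounded_clinear (\<lambda>v. s *\<^sub>R R v + t *\<^sub>R S v)"
  proof (rule bounded_clinearI)
    fix v
    have "norm (s *\<^sub>R R v + t *\<^sub>R S v) \<le> \<bar>s\<bar> * norm (R v) + \<bar>t\<bar> * norm (S v)"
      by (rule order_trans[OF norm_triangle_ineq]) simp
    also have "\<dots> \<le> \<bar>s\<bar> * (onorm R * norm v) + \<bar>t\<bar> * (onorm S * norm v)"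
      by (intro add_mono mult_left_mono bounded_clinear_norm_le R S) auto
    finally show "norm (s *\<^sub>R R v + t *\<^sub>R S v) \<le> (\<bar>s\<bar> * onorm R + \<bar>t\<bar> * onorm S) * norm v"
      by (simp add: algebra_simps)
  qed (simp_all add: bounded_clinear_add R S bounded_clinear_scaleC scaleC_add_right scaleC_scaleR algebra_simps)
  fix y v assume y: "y \<in> commutant (range \<pi>)"
  then have by': "bounded_clinear y" by (simp add: commutant_def)
  show "s *\<^sub>R R (y v) + t *\<^sub>R S (y v) = y (s *\<^sub>R R v + t *\<^sub>R S v)"
    by (simp add: M_commute[OF assms(1) y] M_commute[OF assms(2) y] bounded_clinear_add[OF by'] bounded_clinear_scaleR[OF by'])
qed

text \<open>\<open>\<Omega>\<close> is separating for \<open>M\<close> and the vectors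
  \<open>vec a\<close> are dense, so a functional has at most one representing operator in
  \<open>M\<close>. This makes the choice of \<open>\<Xi>\<close> canonical and gives surjectivity;
  injectivity holds because an operator determines its functional.\<close>

lemma functionals_bijection:
  "\<exists>\<Xi>. bij_betw \<Xi> functionals central_ball \<and>
    (\<forall>\<rho>\<in>functionals. \<forall>R\<in>M. R = \<Xi> \<rho> \<longleftrightarrow> (\<forall>a. \<rho> a = cinner \<Omega> (\<pi> a (R \<Omega>)))) \<and>
    (\<forall>\<rho>\<in>functionals. \<forall>\<sigma>\<in>functionals. \<forall>t\<in>{0..1::real}.
      (\<lambda>a. complex_of_real t * \<rho> a + complex_of_real (1 - t) * \<sigma> a) \<in> functionals \<and>
      \<Xi> (\<lambda>a. complex_of_real t * \<rho> a + complex_of_real (1 - t) * \<sigma> a) =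
        (\<lambda>v. t *\<^sub>R \<Xi> \<rho> v + (1 - t) *\<^sub>R \<Xi> \<sigma> v))"
proof -
  have "\<forall>\<rho>\<in>functionals. \<exists>R. R \<in> central_ball \<and> (\<forall>a. \<rho> a = cinner \<Omega> (\<pi> a (R \<Omega>)))"
    using functionals_representation by blast
  then obtain \<Xi> where ball: "\<And>\<rho>. \<rho> \<in> functionals \<Longrightarrow> \<Xi> \<rho> \<in> central_ball"
    and rep: "\<And>\<rho> a. \<rho> \<in> functionals \<Longrightarrow> \<rho> a = cinner \<Omega> (\<pi> a (\<Xi> \<rho> \<Omega>))"
    using bchoice[of functionals "\<lambda>\<rho> R. R \<in> central_ball \<and> (\<forall>a. \<rho> a = cinner \<Omega> (\<pi> a (R \<Omega>)))"] by metis
  have ballM: "\<Xi> \<rho> \<in> M" if "\<rho> \<in> functionals" for \<rho> using ball[OF that] by (simp add: central_ball_iff)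
  have iff: "R = \<Xi> \<rho> \<longleftrightarrow> (\<forall>a. \<rho> a = cinner \<Omega> (\<pi> a (R \<Omega>)))" if \<rho>: "\<rho> \<in> functionals" and R: "R \<in> M" for \<rho> R
  proof
    assume eq: "\<forall>a. \<rho> a = cinner \<Omega> (\<pi> a (R \<Omega>))"
    have "R \<Omega> = \<Xi> \<rho> \<Omega>"
      by (rule representing_vector_unique) (metis eq rep[OF \<rho>])
    then show "R = \<Xi> \<rho>" by (rule M_separating[OF R ballM[OF \<rho>]])
  qed (use rep[OF \<rho>] in blast)
  have "bij_betw \<Xi> functionals central_ball"
    unfolding bij_betw_def
  proof
    show "inj_on \<Xi> functionals"
      by (rule inj_onI, rule ext) (metis rep)
    show "\<Xi> ` functionals = central_ball"
    proof
      show "central_ball \<subseteq> \<Xi> ` functionals"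
      proof
        fix R assume R: "R \<in> central_ball"
        then have "R \<in> M" by (simp add: central_ball_iff)
        from iff[OF central_ball_functional[OF R] this]
        have "R = \<Xi> (\<lambda>a. cinner \<Omega> (\<pi> a (R \<Omega>)))" by simp
        then show "R \<in> \<Xi> ` functionals" using central_ball_functional[OF R] by blast
      qed
    qed (use ball in blast)
  qed
  moreover have "\<Xi> (\<lambda>a. complex_of_real t * \<rho> a + complex_of_real (1 - t) * \<sigma> a) =
      (\<lambda>v. t *\<^sub>R \<Xi> \<rho> v + (1 - t) *\<^sub>R \<Xi> \<sigma> v)"
    if \<rho>: "\<rho> \<in> functionals" and \<sigma>: "\<sigma> \<in> functionals" and t: "t \<in> {0..1::real}" for \<rho> \<sigma> t
  \<comment> \<open>The combination of operators lies in \<open>M\<close> and represents the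
    combination of functionals; uniqueness within \<open>M\<close> identifies it with the value of
    \<open>\<Xi>\<close>.\<close>
  proof (rule sym, subst iff[OF functionals_convex[OF \<rho> \<sigma> t] M_convex[OF ballM[OF \<rho>] ballM[OF \<sigma>]]], rule allI)
    fix a
    have "cinner \<Omega> (\<pi> a (t *\<^sub>R \<Xi> \<rho> \<Omega> + (1 - t) *\<^sub>R \<Xi> \<sigma> \<Omega>)) =
        t *\<^sub>R cinner \<Omega> (\<pi> a (\<Xi> \<rho> \<Omega>)) + (1 - t) *\<^sub>R cinner \<Omega> (\<pi> a (\<Xi> \<sigma> \<Omega>))"
      by (simp only: bounded_clinear_add[OF \<pi>_bounded_clinear] bounded_clinear_scaleR[OF \<pi>_bounded_clinear] cinner_simps)
    then show "complex_of_real t * \<rho> a + complex_of_real (1 - t) * \<sigma> a =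
        cinner \<Omega> (\<pi> a (t *\<^sub>R \<Xi> \<rho> \<Omega> + (1 - t) *\<^sub>R \<Xi> \<sigma> \<Omega>))"
      by (simp only: scaleR_conv_of_real rep[OF \<rho>, symmetric] rep[OF \<sigma>, symmetric])
  qed
  ultimately show ?thesis using iff functionals_convex by blast
qed

end

theorem theorem2p9:
  fixes \<alpha> :: "real \<Rightarrow> 'a::cstar_algebra \<Rightarrow> 'a"
    and \<gamma> :: "'a \<Rightarrow> 'a"
    and \<beta> :: real
    and \<omega> :: "'a \<Rightarrow> complex"
    and \<pi> :: "'a \<Rightarrow> 'h::chilbert_space \<Rightarrow> 'h"
    and \<Omega> :: 'h
    and M :: "('h \<Rightarrow> 'h) set"
    and V :: "'h \<Rightarrow> 'h"
  assumes "graded_cstar_system \<alpha> \<gamma>"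
    and "\<beta> \<noteq> 0"
    and "\<omega> \<in> invariant_KMS_states \<beta> \<alpha> \<gamma>"
    and "GNS_triple \<omega> \<pi> \<Omega>"
  defines "M \<equiv> enveloping_algebra \<pi>"
    and "V \<equiv> grading_unitary \<pi> \<Omega> \<gamma>"
  shows "\<exists>\<Xi>.
    bij_betw \<Xi> (twisted_KMS_functionals \<beta> \<alpha> \<gamma> \<omega>)
      (unit_ball M \<inter> selfadjoint_part (twisted_center M \<Omega> V)) \<and>
    (\<forall>\<rho> \<in> twisted_KMS_functionals \<beta> \<alpha> \<gamma> \<omega>. \<forall>R \<in> M.
      R = \<Xi> \<rho> \<longleftrightarrow> (\<forall>a. \<rho> a = cinner \<Omega> (\<pi> a (R \<Omega>)))) \<and>
    (\<forall>\<rho> \<in> twisted_KMS_functionals \<beta> \<alpha> \<gamma> \<omega>. \<forall>\<sigma> \<in> twisted_KMS_functionals \<beta> \<alpha> \<gamma> \<omega>.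
      \<forall>t \<in> {0..1::real}.
        (\<lambda>a. complex_of_real t * \<rho> a + complex_of_real (1 - t) * \<sigma> a)
          \<in> twisted_KMS_functionals \<beta> \<alpha> \<gamma> \<omega> \<and>
        \<Xi> (\<lambda>a. complex_of_real t * \<rho> a + complex_of_real (1 - t) * \<sigma> a) =
          (\<lambda>v. t *\<^sub>R \<Xi> \<rho> v + (1 - t) *\<^sub>R \<Xi> \<sigma> v))"
proof -
  interpret kms_gns \<alpha> \<gamma> \<beta> \<omega> \<pi> \<Omega>
    using assms(1-4) by unfold_locales
  show ?thesis
    using functionals_bijection
    unfolding functionals_def central_ball_def M_def assms(5,6) .
qed

end
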